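(* Let $(M,\mathfrak s)$ be an infinitesimally homogeneous variety of complex dimension $n$ such that $\mathfrak s$ is isomorphic to $\mathfrak{sl}_{n+1}(\mathbf C)$. Then there exists a dominant rational map $M\dashrightarrow \mathbf{CP}_n$ conjugating $\mathfrak s$ with the Lie algebra $\mathfrak{sl}_{n+1}(\mathbf C)$ of projective vector fields on $\mathbf{CP}_n$.
   Context: For a complex Lie algebra $\mathfrak g$, an infinitesimally homogeneous variety of type $\mathfrak g$ is a pair $(M,\mathfrak s)$ consisting of a complex smooth irreducible algebraic variety $M$ and a finite-dimensional Lie algebra $\mathfrak s\subset\mathfrak X(M)$ of rational vector fields on $M$, isomorphic to $\mathfrak g$, that spans the tangent space of $M$ at the generic point. A dominant rational map $f:M_1\dashrightarrow M_2$ between varieties of the same dimension (hence generically étale, so that rational vector fields can be pulled back by $f$) conjugates $(M_1,\mathfrak s_1)$ and $(M_2,\mathfrak s_2)$ if $f^*(\mathfrak s_2)=\mathfrak s_1$. The projective vector fields on $\mathbf{CP}_n$ are the infinitesimal generators of the action of $\mathrm{PGL}_{n+1}(\mathbf C)$. *)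

theory Defs
  imports
    "HOL-Analysis.Analysis"
    "HOL-Algebra.Ring"
    "HOL-Library.Function_Algebras"
    "HOL-Library.Extended_Nat"
begin

section \<open>Algebraic varieties over the complex numbers\<close>

text \<open>Varieties are taken in the sense of Serre: a topological space with a sheaf of
  complex-valued functions which is locally affine. A function belonging to \<open>reg M U\<close> is a total
  HOL function of which only the values on \<open>U\<close> matter.\<close>

record 'p fspace =
  zar :: "'p topology"
  reg :: "'p set \<Rightarrow> ('p \<Rightarrow> complex) set"

definition points :: "'p fspace \<Rightarrow> 'p set" where
  "points M = topspace (zar M)"

definition function_sheaf :: "'p fspace \<Rightarrow> bool" where
  "function_sheaf M \<longleftrightarrow>
     (\<forall>U f g. openin (zar M) U \<and> f \<in> reg M U \<and> (\<forall>x\<in>U. f x = g x) \<longrightarrow> g \<in> reg M U) \<and>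
     (\<forall>U V f. openin (zar M) U \<and> openin (zar M) V \<and> V \<subseteq> U \<and> f \<in> reg M U \<longrightarrow> f \<in> reg M V) \<and>
     (\<forall>\<U> f. (\<forall>U\<in>\<U>. openin (zar M) U \<and> f \<in> reg M U) \<longrightarrow> f \<in> reg M (\<Union>\<U>))"

definition open_subspace :: "'p fspace \<Rightarrow> 'p set \<Rightarrow> 'p fspace" where
  "open_subspace M U = \<lparr> zar = subtopology (zar M) U, reg = reg M \<rparr>"

definition morphism :: "'p fspace \<Rightarrow> 'q fspace \<Rightarrow> ('p \<Rightarrow> 'q) \<Rightarrow> bool" where
  "morphism M N \<phi> \<longleftrightarrow> continuous_map (zar M) (zar N) \<phi> \<and>
     (\<forall>V h. openin (zar N) V \<and> h \<in> reg N V \<longrightarrow> h \<circ> \<phi> \<in> reg M (points M \<inter> \<phi> -` V))"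

definition isomorphic_fspaces :: "'p fspace \<Rightarrow> 'q fspace \<Rightarrow> bool" where
  "isomorphic_fspaces M N \<longleftrightarrow> (\<exists>\<phi> \<psi>. morphism M N \<phi> \<and> morphism N M \<psi> \<and>
     (\<forall>x\<in>points M. \<psi> (\<phi> x) = x) \<and> (\<forall>y\<in>points N. \<phi> (\<psi> y) = y))"

text \<open>The algebra of functions generated over the complex numbers by \<open>X\<close>. Since the field is
  infinite, polynomials may be identified with the functions they induce.\<close>

inductive_set poly_funs :: "('v \<Rightarrow> complex) set \<Rightarrow> ('v \<Rightarrow> complex) set"
  for X :: "('v \<Rightarrow> complex) set" where
  gen: "f \<in> X \<Longrightarrow> f \<in> poly_funs X"
| const: "(\<lambda>_. c) \<in> poly_funs X"
| add: "f \<in> poly_funs X \<Longrightarrow> g \<in> poly_funs X \<Longrightarrow> (\<lambda>x. f x + g x) \<in> poly_funs X"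
| mult: "f \<in> poly_funs X \<Longrightarrow> g \<in> poly_funs X \<Longrightarrow> (\<lambda>x. f x * g x) \<in> poly_funs X"

text \<open>Affine \<open>k\<close>-space is encoded as the set of sequences vanishing from index \<open>k\<close> on, because
  \<open>k\<close> has to be quantified inside the definition of a variety.\<close>

definition affine_space :: "nat \<Rightarrow> (nat \<Rightarrow> complex) set" where
  "affine_space k = {x. \<forall>i\<ge>k. x i = 0}"

definition affine_polys :: "nat \<Rightarrow> ((nat \<Rightarrow> complex) \<Rightarrow> complex) set" where
  "affine_polys k = poly_funs {(\<lambda>x. x i) | i. i < k}"

definition algebraic_set :: "nat \<Rightarrow> (nat \<Rightarrow> complex) set \<Rightarrow> bool" where
  "algebraic_set k Z \<longleftrightarrow>
     (\<exists>F \<subseteq> affine_polys k. Z = {x \<in> affine_space k. \<forall>f\<in>F. f x = 0})"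

definition affine_zariski :: "nat \<Rightarrow> (nat \<Rightarrow> complex) set \<Rightarrow> (nat \<Rightarrow> complex) topology" where
  "affine_zariski k Z = topology_generated_by {{x \<in> Z. f x \<noteq> 0} | f. f \<in> affine_polys k}"

definition affine_model :: "nat \<Rightarrow> (nat \<Rightarrow> complex) set \<Rightarrow> (nat \<Rightarrow> complex) fspace" where
  "affine_model k Z = \<lparr> zar = affine_zariski k Z,
     reg = (\<lambda>U. {f. \<forall>x\<in>U. \<exists>V a b. openin (affine_zariski k Z) V \<and> x \<in> V \<and> V \<subseteq> U \<and>
       a \<in> affine_polys k \<and> b \<in> affine_polys k \<and> (\<forall>y\<in>V. b y \<noteq> 0 \<and> f y = a y / b y)}) \<rparr>"

definition prevariety :: "'p fspace \<Rightarrow> bool" where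
  "prevariety M \<longleftrightarrow> function_sheaf M \<and>
     (\<exists>\<U>. finite \<U> \<and> \<Union>\<U> = points M \<and>
       (\<forall>U\<in>\<U>. openin (zar M) U \<and>
         (\<exists>k Z. algebraic_set k Z \<and> isomorphic_fspaces (open_subspace M U) (affine_model k Z))))"

text \<open>Separatedness: any two morphisms into \<open>M\<close> agree on a closed set. Closedness being local on
  the source, affine sources suffice.\<close>

definition separated :: "'p fspace \<Rightarrow> bool" where
  "separated M \<longleftrightarrow> (\<forall>k Z \<phi> \<psi>. algebraic_set k Z \<and>
     morphism (affine_model k Z) M \<phi> \<and> morphism (affine_model k Z) M \<psi> \<longrightarrow>
     closedin (affine_zariski k Z) {x \<in> Z. \<phi> x = \<psi> x})"

definition irreducible_in :: "'p topology \<Rightarrow> 'p set \<Rightarrow> bool" where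
  "irreducible_in T S \<longleftrightarrow> S \<subseteq> topspace T \<and> S \<noteq> {} \<and>
     (\<forall>A B. closedin T A \<and> closedin T B \<and> S \<subseteq> A \<union> B \<longrightarrow> S \<subseteq> A \<or> S \<subseteq> B)"

definition irreducible_variety :: "'p fspace \<Rightarrow> bool" where
  "irreducible_variety M \<longleftrightarrow> prevariety M \<and> separated M \<and> irreducible_in (zar M) (points M)"

definition variety_dim :: "'p fspace \<Rightarrow> enat" where
  "variety_dim M = Sup {enat n | n. \<exists>Z :: nat \<Rightarrow> 'p set.
     (\<forall>i\<le>n. closedin (zar M) (Z i) \<and> irreducible_in (zar M) (Z i)) \<and> (\<forall>i<n. Z i \<subset> Z (Suc i))}"


section \<open>Rational functions, local rings and tangent spaces\<close>

definition rat_reps :: "'p fspace \<Rightarrow> ('p set \<times> ('p \<Rightarrow> complex)) set" where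
  "rat_reps M = {(U, f). openin (zar M) U \<and> U \<noteq> {} \<and> f \<in> reg M U}"

definition rat_rel ::
  "'p fspace \<Rightarrow> (('p set \<times> ('p \<Rightarrow> complex)) \<times> ('p set \<times> ('p \<Rightarrow> complex))) set" where
  "rat_rel M = {((U, f), (V, g)). (U, f) \<in> rat_reps M \<and> (V, g) \<in> rat_reps M \<and>
     (\<forall>x \<in> U \<inter> V. f x = g x)}"

type_synonym 'p ratfun = "('p set \<times> ('p \<Rightarrow> complex)) set"

definition rat_class :: "'p fspace \<Rightarrow> 'p set \<Rightarrow> ('p \<Rightarrow> complex) \<Rightarrow> 'p ratfun" where
  "rat_class M U f = rat_rel M `` {(U, f)}"

definition rat_const :: "'p fspace \<Rightarrow> complex \<Rightarrow> 'p ratfun" where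
  "rat_const M c = rat_class M (points M) (\<lambda>_. c)"

text \<open>The unions over representatives below are unions of equal classes (\<open>M\<close> being irreducible).\<close>

definition function_field :: "'p fspace \<Rightarrow> 'p ratfun ring" where
  "function_field M = \<lparr> carrier = rat_reps M // rat_rel M,
     mult = (\<lambda>\<xi> \<eta>. \<Union>(U, f)\<in>\<xi>. \<Union>(V, g)\<in>\<eta>. rat_class M (U \<inter> V) (\<lambda>x. f x * g x)),
     one = rat_const M 1,
     zero = rat_const M 0,
     add = (\<lambda>\<xi> \<eta>. \<Union>(U, f)\<in>\<xi>. \<Union>(V, g)\<in>\<eta>. rat_class M (U \<inter> V) (\<lambda>x. f x + g x)) \<rparr>"

text \<open>As \<open>M\<close> is irreducible, its local rings are regarded as subrings of the function field.\<close>

definition local_ring :: "'p fspace \<Rightarrow> 'p \<Rightarrow> 'p ratfun set" where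
  "local_ring M p = {\<xi> \<in> carrier (function_field M). \<exists>(U, f)\<in>\<xi>. p \<in> U}"

definition rat_value :: "'p \<Rightarrow> 'p ratfun \<Rightarrow> complex" where
  "rat_value p \<xi> = (THE c. \<exists>(U, f)\<in>\<xi>. p \<in> U \<and> f p = c)"

text \<open>Tangent vectors at \<open>p\<close> are the complex derivations of the local ring at \<open>p\<close> with values in
  the residue field, extended by \<open>0\<close> outside the local ring; linearity over the complex numbers
  follows from additivity, the Leibniz rule and vanishing on constants.\<close>

definition tangent_space :: "'p fspace \<Rightarrow> 'p \<Rightarrow> ('p ratfun \<Rightarrow> complex) set" where
  "tangent_space M p = {\<delta>.
     (\<forall>\<xi>. \<xi> \<notin> local_ring M p \<longrightarrow> \<delta> \<xi> = 0) \<and>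
     (\<forall>c. \<delta> (rat_const M c) = 0) \<and>
     (\<forall>\<xi>\<in>local_ring M p. \<forall>\<eta>\<in>local_ring M p.
        \<delta> (\<xi> \<oplus>\<^bsub>function_field M\<^esub> \<eta>) = \<delta> \<xi> + \<delta> \<eta> \<and>
        \<delta> (\<xi> \<otimes>\<^bsub>function_field M\<^esub> \<eta>) = rat_value p \<xi> * \<delta> \<eta> + rat_value p \<eta> * \<delta> \<xi>)}"

definition fun_scale :: "complex \<Rightarrow> ('a \<Rightarrow> complex) \<Rightarrow> 'a \<Rightarrow> complex" where
  "fun_scale c \<delta> = (\<lambda>x. c * \<delta> x)"

lemma vector_space_fun_scale: "vector_space fun_scale"
  by unfold_locales (auto simp: fun_scale_def fun_eq_iff algebra_simps)

definition smooth :: "'p fspace \<Rightarrow> bool" where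
  "smooth M \<longleftrightarrow>
     (\<forall>p\<in>points M. enat (vector_space.dim fun_scale (tangent_space M p)) = variety_dim M)"


section \<open>Rational vector fields\<close>

definition rat_vector_fields :: "'p fspace \<Rightarrow> ('p ratfun \<Rightarrow> 'p ratfun) set" where
  "rat_vector_fields M = (let K = function_field M in
     {D \<in> carrier K \<rightarrow>\<^sub>E carrier K.
       (\<forall>c. D (rat_const M c) = \<zero>\<^bsub>K\<^esub>) \<and>
       (\<forall>\<xi>\<in>carrier K. \<forall>\<eta>\<in>carrier K.
          D (\<xi> \<oplus>\<^bsub>K\<^esub> \<eta>) = D \<xi> \<oplus>\<^bsub>K\<^esub> D \<eta> \<and>
          D (\<xi> \<otimes>\<^bsub>K\<^esub> \<eta>) = (\<xi> \<otimes>\<^bsub>K\<^esub> D \<eta>) \<oplus>\<^bsub>K\<^esub> (\<eta> \<otimes>\<^bsub>K\<^esub> D \<xi>))})"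

record 'a lie_struct =
  lie_carrier :: "'a set"
  lie_zero :: 'a
  lie_add :: "'a \<Rightarrow> 'a \<Rightarrow> 'a"
  lie_scale :: "complex \<Rightarrow> 'a \<Rightarrow> 'a"
  lie_bracket :: "'a \<Rightarrow> 'a \<Rightarrow> 'a"

definition vector_field_lie :: "'p fspace \<Rightarrow> ('p ratfun \<Rightarrow> 'p ratfun) lie_struct" where
  "vector_field_lie M = (let K = function_field M in
     \<lparr> lie_carrier = rat_vector_fields M,
       lie_zero = (\<lambda>\<xi>\<in>carrier K. \<zero>\<^bsub>K\<^esub>),
       lie_add = (\<lambda>D E. \<lambda>\<xi>\<in>carrier K. D \<xi> \<oplus>\<^bsub>K\<^esub> E \<xi>),
       lie_scale = (\<lambda>c D. \<lambda>\<xi>\<in>carrier K. rat_const M c \<otimes>\<^bsub>K\<^esub> D \<xi>),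
       lie_bracket = (\<lambda>D E. \<lambda>\<xi>\<in>carrier K. D (E \<xi>) \<ominus>\<^bsub>K\<^esub> E (D \<xi>)) \<rparr>)"

definition sl_lie :: "(complex ^ 'm ^ 'm) lie_struct" where
  "sl_lie = \<lparr> lie_carrier = {A. trace A = 0},
     lie_zero = 0,
     lie_add = (+),
     lie_scale = (\<lambda>c A. \<chi> i j. c * A $ i $ j),
     lie_bracket = (\<lambda>A B. A ** B - B ** A) \<rparr>"

definition linear_subspace :: "'a lie_struct \<Rightarrow> 'a set \<Rightarrow> bool" where
  "linear_subspace L V \<longleftrightarrow> V \<subseteq> lie_carrier L \<and> lie_zero L \<in> V \<and>
     (\<forall>x\<in>V. \<forall>y\<in>V. lie_add L x y \<in> V) \<and> (\<forall>c. \<forall>x\<in>V. lie_scale L c x \<in> V)"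

definition lie_subalgebra :: "'a lie_struct \<Rightarrow> 'a set \<Rightarrow> bool" where
  "lie_subalgebra L V \<longleftrightarrow> linear_subspace L V \<and> (\<forall>x\<in>V. \<forall>y\<in>V. lie_bracket L x y \<in> V)"

definition fin_dim :: "'a lie_struct \<Rightarrow> 'a set \<Rightarrow> bool" where
  "fin_dim L V \<longleftrightarrow> (\<exists>B. finite B \<and> B \<subseteq> V \<and> (\<forall>W. linear_subspace L W \<and> B \<subseteq> W \<longrightarrow> V \<subseteq> W))"

definition lie_isomorphic :: "'a lie_struct \<Rightarrow> 'b lie_struct \<Rightarrow> bool" where
  "lie_isomorphic L L' \<longleftrightarrow> (\<exists>\<rho>. bij_betw \<rho> (lie_carrier L) (lie_carrier L') \<and>
     (\<forall>x\<in>lie_carrier L. \<forall>y\<in>lie_carrier L. \<rho> (lie_add L x y) = lie_add L' (\<rho> x) (\<rho> y)) \<and>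
     (\<forall>c. \<forall>x\<in>lie_carrier L. \<rho> (lie_scale L c x) = lie_scale L' c (\<rho> x)) \<and>
     (\<forall>x\<in>lie_carrier L. \<forall>y\<in>lie_carrier L. \<rho> (lie_bracket L x y) = lie_bracket L' (\<rho> x) (\<rho> y)))"

definition regular_at :: "'p fspace \<Rightarrow> 'p \<Rightarrow> ('p ratfun \<Rightarrow> 'p ratfun) \<Rightarrow> bool" where
  "regular_at M p D \<longleftrightarrow> D ` local_ring M p \<subseteq> local_ring M p"

definition vector_at ::
  "'p fspace \<Rightarrow> 'p \<Rightarrow> ('p ratfun \<Rightarrow> 'p ratfun) \<Rightarrow> 'p ratfun \<Rightarrow> complex" where
  "vector_at M p D = (\<lambda>\<xi>. if \<xi> \<in> local_ring M p then rat_value p (D \<xi>) else 0)"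

text \<open>``At the generic point'' means at every point of some non-empty Zariski open set.\<close>

definition spans_tangent_generically ::
  "'p fspace \<Rightarrow> ('p ratfun \<Rightarrow> 'p ratfun) set \<Rightarrow> bool" where
  "spans_tangent_generically M \<ss> \<longleftrightarrow> (\<exists>U. openin (zar M) U \<and> U \<noteq> {} \<and>
     (\<forall>p\<in>U. (\<forall>D\<in>\<ss>. regular_at M p D) \<and>
        module.span fun_scale (vector_at M p ` \<ss>) = tangent_space M p))"

definition infinitesimally_homogeneous ::
  "'p fspace \<Rightarrow> ('p ratfun \<Rightarrow> 'p ratfun) set \<Rightarrow> 'g lie_struct \<Rightarrow> bool" where
  "infinitesimally_homogeneous M \<ss> \<gg> \<longleftrightarrow>
     irreducible_variety M \<and> smooth M \<and>
     lie_subalgebra (vector_field_lie M) \<ss> \<and> fin_dim (vector_field_lie M) \<ss> \<and>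
     lie_isomorphic (vector_field_lie M \<lparr> lie_carrier := \<ss> \<rparr>) \<gg> \<and>
     spans_tangent_generically M \<ss>"


section \<open>Dominant rational maps and conjugation\<close>

text \<open>A rational map is given by a representative \<open>(U, \<phi>)\<close>, with \<open>\<phi>\<close> a morphism on the non-empty
  open set \<open>U\<close>; the notions below depend only on the equivalence class of the representative.\<close>

definition dominant_rational_map :: "'p fspace \<Rightarrow> 'q fspace \<Rightarrow> 'p set \<Rightarrow> ('p \<Rightarrow> 'q) \<Rightarrow> bool" where
  "dominant_rational_map M N U \<phi> \<longleftrightarrow> openin (zar M) U \<and> U \<noteq> {} \<and>
     morphism (open_subspace M U) N \<phi> \<and> zar N closure_of (\<phi> ` U) = points N"

definition pullback_fun :: "'p fspace \<Rightarrow> 'p set \<Rightarrow> ('p \<Rightarrow> 'q) \<Rightarrow> 'q ratfun \<Rightarrow> 'p ratfun" where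
  "pullback_fun M U \<phi> \<xi> = (\<Union>(V, h)\<in>\<xi>. rat_class M (U \<inter> \<phi> -` V) (h \<circ> \<phi>))"

text \<open>For a dominant rational map between varieties of the same dimension, the pull-back of a
  rational vector field \<open>Y\<close> is the unique derivation extending \<open>Y\<close> along the (finite separable)
  embedding of function fields.\<close>

definition pullback_field ::
  "'p fspace \<Rightarrow> 'q fspace \<Rightarrow> 'p set \<Rightarrow> ('p \<Rightarrow> 'q) \<Rightarrow>
   ('q ratfun \<Rightarrow> 'q ratfun) \<Rightarrow> 'p ratfun \<Rightarrow> 'p ratfun" where
  "pullback_field M N U \<phi> Y = (THE X. X \<in> rat_vector_fields M \<and>
     (\<forall>\<xi>\<in>carrier (function_field N). X (pullback_fun M U \<phi> \<xi>) = pullback_fun M U \<phi> (Y \<xi>)))"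

definition conjugates ::
  "'p fspace \<Rightarrow> ('p ratfun \<Rightarrow> 'p ratfun) set \<Rightarrow> 'q fspace \<Rightarrow> ('q ratfun \<Rightarrow> 'q ratfun) set \<Rightarrow>
   'p set \<Rightarrow> ('p \<Rightarrow> 'q) \<Rightarrow> bool" where
  "conjugates M \<ss> N \<tt> U \<phi> \<longleftrightarrow>
     dominant_rational_map M N U \<phi> \<and> pullback_field M N U \<phi> ` \<tt> = \<ss>"


section \<open>Projective space and projective vector fields\<close>

text \<open>The projective space of lines in \<open>complex ^ 'm\<close>; its dimension is \<open>CARD('m) - 1\<close>.\<close>

definition proj_points :: "(complex ^ 'm) set set" where
  "proj_points = {vec.span {v} | v. v \<noteq> 0}"

definition homogeneous_polys :: "nat \<Rightarrow> (complex ^ 'm \<Rightarrow> complex) set" where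
  "homogeneous_polys d = {F \<in> poly_funs {(\<lambda>v. v $ i) | i. True}.
     \<forall>c v. F (c *s v) = c ^ d * F v}"

definition proj_zariski :: "(complex ^ 'm) set topology" where
  "proj_zariski = topology_generated_by
     {{L \<in> proj_points. \<exists>v\<in>L. F v \<noteq> 0} | F d. F \<in> homogeneous_polys d}"

definition CP :: "(complex ^ 'm) set fspace" where
  "CP = \<lparr> zar = proj_zariski,
     reg = (\<lambda>U. {h. \<forall>L\<in>U. \<exists>V d F G. openin proj_zariski V \<and> L \<in> V \<and> V \<subseteq> U \<and>
       F \<in> homogeneous_polys d \<and> G \<in> homogeneous_polys d \<and>
       (\<forall>L'\<in>V. \<forall>v\<in>L' - {0}. G v \<noteq> 0 \<and> h L' = F v / G v)}) \<rparr>"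

text \<open>Every holomorphic one-parameter subgroup of the projective linear group lifts to the general
  linear group, so generators may be computed from one-parameter subgroups of the latter.\<close>

definition one_parameter_subgroup :: "(complex \<Rightarrow> complex ^ 'm ^ 'm) \<Rightarrow> bool" where
  "one_parameter_subgroup \<gamma> \<longleftrightarrow> \<gamma> 0 = mat 1 \<and> (\<forall>s t. \<gamma> (s + t) = \<gamma> s ** \<gamma> t) \<and>
     (\<forall>i j. (\<lambda>t. \<gamma> t $ i $ j) holomorphic_on UNIV)"

definition projective_vector_fields ::
  "((complex ^ 'm) set ratfun \<Rightarrow> (complex ^ 'm) set ratfun) set" where
  "projective_vector_fields = {Y \<in> rat_vector_fields CP. \<exists>\<gamma>. one_parameter_subgroup \<gamma> \<and>
     (\<forall>(U, h) \<in> rat_reps CP. Y (rat_class CP U h) =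
        rat_class CP U (\<lambda>L. deriv (\<lambda>t. h ((*v) (\<gamma> t) ` L)) 0))}"

end

theory Submission
  imports Defs "HOL-Complex_Analysis.Cauchy_Integral_Formula"
begin

text \<open>The choice between columns and rows cannot be avoided: matrices act on projective space
  and on its dual, the two actions differ by the automorphism sending A to minus its transpose, and
  an abstract copy of the Lie algebra does not tell them apart. Smallness of \<open>P\<close> enters
  as follows. Since dim P < N, every vector v has a nonzero covector \<phi> vanishing on P v; then v
  \<otimes> \<phi> lies in the isotropy algebra, and commutators with such matrices stay in
  \<open>P\<close>. This supply of rank one isotropy is what eventually forces rank one elements
  into \<open>P\<close> itself. Once every Q in \<open>P\<close> has the form u \<otimes> \<psi>, tr
  Q = 0 says \<psi>(u) = 0, so tr (A Q) = \<psi>(A u) vanishes as soon as u is an eigenvector of A: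
  the stabiliser of the line of u acts trivially at p. The same fact later shows that a projective
  vector field has only one pull-back, by comparing values at points instead of extending
  derivations along a finite field extension. Nothing is integrated on M. Exponentials occur only
  for matrices, because projective vector fields are defined through one-parameter groups.\<close>

text \<open>Write \<open>N = n + 1\<close>, let \<open>\<delta>\<close> be the action of \<open>gl\<^sub>N\<close> by vector fields in \<open>\<ss>\<close> (scalars acting
  trivially), and for a function \<open>\<xi>\<close> regular at a generic point \<open>p\<close> let \<open>Q\<close> be the matrix with
  \<open>tr (A Q) = (\<delta> A \<xi>) p\<close>. These matrices form a space \<open>P\<close> of dimension at most \<open>n\<close>, stable under
  commutators with its orthogonal for the trace form, which is the isotropy algebra of \<open>p\<close>. Linear
  algebra shows that the columns of all elements of \<open>P\<close> lie on one line, or all the rows do; by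
  irreducibility the same alternative holds at every generic point, and replacing \<open>A\<close> by minus its
  transpose reduces to columns. A nonzero column \<open>u\<close> of the matrices attached to one function then
  satisfies \<open>\<delta> A u = - A u\<close> up to a multiple of \<open>u\<close>, so \<open>p \<mapsto> [u p]\<close> is a rational map to projective
  space carrying \<open>\<delta> A\<close> to the vector field of the one-parameter group \<open>exp (- t A)\<close>. It is dominant:
  differentiating a polynomial relation between the components of \<open>u\<close> along \<open>\<delta>\<close> shows that all its
  derivatives vanish at \<open>u\<close>.\<close>

section \<open>Subspaces of matrices stable under their orthogonal\<close>

text \<open>Bilinear, not Hermitian: the first argument is thought of as a covector, and
  \<open>outer v \<phi>\<close> is the rank one map sending x to \<phi>(x) v.\<close>

definition cdot :: "complex ^ 'm \<Rightarrow> complex ^ 'm \<Rightarrow> complex" where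
  "cdot \<phi> x = (\<Sum>i\<in>UNIV. \<phi> $ i * x $ i)"

definition outer :: "complex ^ 'm \<Rightarrow> complex ^ 'm \<Rightarrow> complex ^ 'm ^ 'm" where
  "outer v \<phi> = (\<chi> i j. v $ i * \<phi> $ j)"

text \<open>On matrices \<open>*s\<close> takes its scalars from the row type, so multiplication by
  a complex number is a separate operation.\<close>

definition matrix_scale :: "complex \<Rightarrow> complex ^ 'm ^ 'm \<Rightarrow> complex ^ 'm ^ 'm" where
  "matrix_scale c A = (\<chi> i j. c * A $ i $ j)"

lemma matrix_scale_nth [simp]: "matrix_scale c A $ i $ j = c * A $ i $ j"
  by (simp add: matrix_scale_def)

lemma outer_nth [simp]: "outer v \<phi> $ i $ j = v $ i * \<phi> $ j"
  by (simp add: outer_def)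

interpretation mat: vector_space "matrix_scale :: complex \<Rightarrow> complex ^ 'm ^ 'm \<Rightarrow> _"
  by unfold_locales (auto simp: vec_eq_iff algebra_simps)

interpretation vec_mat: vector_space_pair "(*s) :: complex \<Rightarrow> complex ^ 'm \<Rightarrow> _"
    "matrix_scale :: complex \<Rightarrow> complex ^ 'm ^ 'm \<Rightarrow> _"
  by unfold_locales

lemma cdot_simps [simp]:
  "cdot (a + b) x = cdot a x + cdot b x" "cdot (a - b) x = cdot a x - cdot b x"
  "cdot (c *s a) x = c * cdot a x" "cdot 0 x = 0" "cdot (- a) x = - cdot a x"
  "cdot a (x + y) = cdot a x + cdot a y" "cdot a (x - y) = cdot a x - cdot a y"
  "cdot a (c *s x) = c * cdot a x" "cdot a 0 = 0" "cdot a (- x) = - cdot a x"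
  by (simp_all add: cdot_def algebra_simps sum.distrib sum_subtractf sum_distrib_left sum_negf)

lemma cdot_commute: "cdot a b = cdot b a"
  by (simp add: cdot_def mult.commute)

lemma cdot_axis: "cdot (axis i 1) x = x $ i"
  by (simp add: cdot_def axis_def if_distrib[of "\<lambda>a. a * _"] cong: if_cong)

lemma ex_cdot_nonzero: "x \<noteq> 0 \<Longrightarrow> \<exists>\<phi>. cdot \<phi> x \<noteq> 0"
  by (metis cdot_axis vec_eq_iff zero_index)

lemma cdot_ext: "(\<And>\<phi>. cdot \<phi> x = cdot \<phi> y) \<Longrightarrow> x = y"
  by (metis cdot_axis vec_eq_iff)

lemma matrix_vector_axis: "(A *v axis k (1 :: complex)) $ i = A $ i $ k"
  by (simp add: matrix_vector_mult_def axis_def if_distrib[of "\<lambda>a. _ * a"] cong: if_cong)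

lemma axis_vector_matrix: "(axis k (1 :: complex) v* A) $ i = A $ k $ i"
  by (simp add: vector_matrix_mult_def axis_def if_distrib[of "\<lambda>a. a * _"] cong: if_cong)

lemma outer_linear:
  "outer (a + b) \<phi> = outer a \<phi> + outer b \<phi>" "outer (a - b) \<phi> = outer a \<phi> - outer b \<phi>"
  "outer (c *s a) \<phi> = matrix_scale c (outer a \<phi>)" "outer 0 \<phi> = 0"
  "outer v (\<phi> + \<psi>) = outer v \<phi> + outer v \<psi>" "outer v (\<phi> - \<psi>) = outer v \<phi> - outer v \<psi>"
  "outer v (c *s \<phi>) = matrix_scale c (outer v \<phi>)" "outer v 0 = 0"
  "outer v (- \<phi>) = - outer v \<phi>" "outer (- v) \<phi> = - outer v \<phi>"
  by (simp_all add: vec_eq_iff algebra_simps)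

lemma cdot_matrix: "cdot (\<phi> v* A) x = cdot \<phi> (A *v x)"
proof -
  have "cdot (\<phi> v* A) x = (\<Sum>j\<in>UNIV. \<Sum>i\<in>UNIV. \<phi> $ i * A $ i $ j * x $ j)"
    by (simp add: cdot_def vector_matrix_mult_def sum_distrib_left sum_distrib_right mult_ac)
  also have "\<dots> = cdot \<phi> (A *v x)"
    by (subst sum.swap) (simp add: cdot_def matrix_vector_mult_def sum_distrib_left mult_ac)
  finally show ?thesis .
qed

lemma outer_matrix_mult:
  "outer v \<phi> ** A = outer v (\<phi> v* A)" "A ** outer v \<phi> = outer (A *v v) \<phi>"
  "outer v \<phi> *v x = cdot \<phi> x *s v" "\<phi> v* outer v \<psi> = cdot \<phi> v *s \<psi>"
  by (simp_all add: vec_eq_iff matrix_matrix_mult_def vector_matrix_mult_def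
      matrix_vector_mult_def cdot_def sum_distrib_left sum_distrib_right mult_ac)

lemma matrix_scale_vec: "matrix_scale c A *v x = c *s (A *v x)" "\<phi> v* matrix_scale c A = c *s (\<phi> v* A)"
  by (simp_all add: vec_eq_iff matrix_vector_mult_def vector_matrix_mult_def sum_distrib_left mult_ac)

lemma vector_scale_matrix: "(c *s \<phi>) v* A = c *s (\<phi> v* (A :: complex ^ 'm ^ 'm))"
  by (simp add: vec_eq_iff vector_matrix_mult_def sum_distrib_left mult_ac)

lemma trace_outer: "trace (outer v \<phi>) = cdot \<phi> v"
  by (simp add: trace_def cdot_def mult.commute)

lemma outer_eq_0_iff: "outer v \<phi> = 0 \<longleftrightarrow> v = 0 \<or> \<phi> = 0"
  by (auto simp: vec_eq_iff)

lemma dim_inter_kernel: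
  assumes "vec.subspace V"
  shows "vec.dim V \<le> Suc (vec.dim (V \<inter> {\<phi>. cdot \<phi> w = 0}))"
proof (cases "V \<subseteq> {\<phi>. cdot \<phi> w = 0}")
  case True
  then have "V \<inter> {\<phi>. cdot \<phi> w = 0} = V" by blast
  then show ?thesis by simp
next
  case False
  then obtain b where b: "b \<in> V" "cdot b w \<noteq> 0" by blast
  have "V \<subseteq> vec.span (insert b (V \<inter> {\<phi>. cdot \<phi> w = 0}))"
  proof
    fix v assume v: "v \<in> V"
    let ?c = "cdot v w / cdot b w"
    have "v - ?c *s b \<in> V \<inter> {\<phi>. cdot \<phi> w = 0}"
      using v b assms by (auto intro: vec.subspace_diff vec.subspace_scale)
    then show "v \<in> vec.span (insert b (V \<inter> {\<phi>. cdot \<phi> w = 0}))"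
      unfolding vec.span_breakdown_eq by (blast intro: vec.span_base)
  qed
  then have "vec.dim V \<le> vec.dim (insert b (V \<inter> {\<phi>. cdot \<phi> w = 0}))" by (rule vec.dim_mono)
  also have "\<dots> \<le> Suc (vec.dim (V \<inter> {\<phi>. cdot \<phi> w = 0}))"
    by (simp add: vec.dim_insert)
  finally show ?thesis .
qed

lemma subspace_kernel: "vec.subspace {\<phi>. \<forall>w\<in>W. cdot \<phi> w = 0}"
  by (auto simp: vec.subspace_def)

lemma dim_annihilator:
  fixes W :: "(complex ^ 'm) set"
  assumes "finite W"
  shows "CARD('m) \<le> vec.dim {\<phi>. \<forall>w\<in>W. cdot \<phi> w = 0} + card W"
  using assms
proof induction
  case empty
  show ?case using vec_dim_card[where 'a = complex and 'n = 'm] by (simp del: vec.dim_UNIV)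
next
  case (insert w W)
  have "{\<phi>. \<forall>w\<in>insert w W. cdot \<phi> w = 0} = {\<phi>. \<forall>w\<in>W. cdot \<phi> w = 0} \<inter> {\<phi>. cdot \<phi> w = 0}"
    by auto
  with dim_inter_kernel[OF subspace_kernel, of W w] insert show ?case by simp
qed

lemma linear_outer: "Vector_Spaces.linear (*s) matrix_scale (outer b)"
  by unfold_locales (simp_all add: outer_linear)

lemma inj_outer: "b \<noteq> 0 \<Longrightarrow> inj (outer b)"
  by (rule injI) (metis eq_iff_diff_eq_0 outer_eq_0_iff outer_linear(6))

text \<open>The bound dim P < N is expressed by a spanning set \<open>S\<close>, the form in which
  the exchange lemma consumes it and in which it survives transposition.\<close>

locale perp_stable =
  fixes P :: "(complex ^ 'm ^ 'm) set" and S :: "(complex ^ 'm ^ 'm) set"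
  assumes subspace_P: "mat.subspace P"
    and span_P: "P \<subseteq> mat.span S" and finite_S: "finite S" and card_S: "card S < CARD('m)"
    and trace_P: "A \<in> P \<Longrightarrow> trace A = 0"
    and stable_P: "(\<And>A. A \<in> P \<Longrightarrow> trace (X ** A) = 0) \<Longrightarrow> A \<in> P \<Longrightarrow> X ** A - A ** X \<in> P"
begin

text \<open>The trace of \<open>outer v \<phi> ** A\<close> is \<phi>(A v). So \<phi> lies in
  \<open>ann v\<close> exactly when \<open>outer v \<phi>\<close> is orthogonal to \<open>P\<close>,
  that is, belongs to the isotropy algebra.\<close>

definition ann :: "complex ^ 'm \<Rightarrow> (complex ^ 'm) set" where
  "ann x = {\<phi>. \<forall>A\<in>P. cdot \<phi> (A *v x) = 0}"

lemma subspace_ann: "vec.subspace (ann x)"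
  by (auto simp: vec.subspace_def ann_def)

text \<open>Extend \<open>Z\<close> to a basis of \<open>P\<close>. The space P x is spanned by the
  images of the remaining basis vectors, at most dim P - card Z of them, and dim P < N.\<close>

lemma dim_ann:
  assumes "Z \<subseteq> P" "mat.independent Z" "\<And>A. A \<in> Z \<Longrightarrow> A *v x = 0"
  shows "card Z < vec.dim (ann x)"
proof -
  obtain B where B: "Z \<subseteq> B" "B \<subseteq> P" "mat.independent B" "P \<subseteq> mat.span B"
    using mat.maximal_independent_subset_extend[OF assms(1,2)] by blast
  have fB: "finite B" and cB: "card B \<le> card S"
    using mat.independent_span_bound[OF finite_S B(3)] B(2) span_P by auto
  let ?W = "(\<lambda>A. A *v x) ` (B - Z)"
  have "card ?W \<le> card (B - Z)" using fB by (intro card_image_le) auto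
  also have "\<dots> = card B - card Z" using fB B(1) by (simp add: card_Diff_subset finite_subset)
  finally have cW: "card ?W + card Z \<le> card S"
    using cB card_mono[OF fB B(1)] by linarith
  have "{\<phi>. \<forall>w\<in>?W. cdot \<phi> w = 0} \<subseteq> ann x"
  proof
    fix \<phi> assume \<phi>: "\<phi> \<in> {\<phi>. \<forall>w\<in>?W. cdot \<phi> w = 0}"
    have "cdot \<phi> (A *v x) = 0" if "A \<in> mat.span B" for A
      using that
    proof (induction rule: mat.span_induct)
      case base
      show ?case
        by (auto simp: mat.subspace_def matrix_vector_mult_add_rdistrib matrix_scale_vec)
    next
      case (step A)
      then show ?case using \<phi> assms(3) by (cases "A \<in> Z") auto
    qed
    then show "\<phi> \<in> ann x" using B(4) by (auto simp: ann_def)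
  qed
  then have "vec.dim {\<phi>. \<forall>w\<in>?W. cdot \<phi> w = 0} \<le> vec.dim (ann x)" by (rule vec.dim_subset)
  moreover have "CARD('m) \<le> vec.dim {\<phi>. \<forall>w\<in>?W. cdot \<phi> w = 0} + card ?W"
    using fB by (intro dim_annihilator) auto
  ultimately show ?thesis using cW card_S by linarith
qed

lemma ann_nonzero: "\<exists>\<phi>\<in>ann x. \<phi> \<noteq> 0"
proof (rule ccontr)
  assume "\<not> ?thesis"
  then have "ann x \<subseteq> {0}" by blast
  then have "vec.dim (ann x) = 0" by simp
  with dim_ann[of "{}" x] show False by (simp add: mat.independent_empty)
qed

text \<open>One nonzero element of \<open>P\<close> killing x already makes \<open>ann x\<close>
  two-dimensional, so it meets the hyperplane of covectors vanishing at w.\<close>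

lemma ann_nonzero_inter:
  assumes "A \<in> P" "A \<noteq> 0" "A *v x = 0"
  shows "\<exists>\<phi>\<in>ann x. cdot \<phi> w = 0 \<and> \<phi> \<noteq> 0"
proof (rule ccontr)
  assume "\<not> ?thesis"
  then have "ann x \<inter> {\<phi>. cdot \<phi> w = 0} \<subseteq> {0}" by blast
  then have "vec.dim (ann x \<inter> {\<phi>. cdot \<phi> w = 0}) = 0" by simp
  with dim_inter_kernel[OF subspace_ann, of x w] dim_ann[of "{A}" x] assms
  show False by simp
qed

text \<open>This is the commutator of the isotropy element \<open>outer v \<phi>\<close> with A,
  expanded.\<close>

lemma stable_outer:
  assumes "\<phi> \<in> ann v" "A \<in> P"
  shows "outer v (\<phi> v* A) - outer (A *v v) \<phi> \<in> P"
proof -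
  have "outer v \<phi> ** A - A ** outer v \<phi> \<in> P"
    using assms by (intro stable_P) (auto simp: outer_matrix_mult trace_outer cdot_matrix ann_def)
  then show ?thesis by (simp add: outer_matrix_mult)
qed

text \<open>Every covector killing v lies in \<open>ann v\<close>, and its commutator with A is v
  \<otimes> (\<phi> A - c \<phi>). Either one of these is nonzero, or A is c plus a rank one matrix,
  and then vanishing of the trace forces c = 0.\<close>

lemma rank_one_of_common_eigenvector:
  assumes v: "v \<noteq> 0" and A: "A \<in> P" "A \<noteq> 0" and ev: "\<And>A. A \<in> P \<Longrightarrow> \<exists>c. A *v v = c *s v"
  shows "\<exists>b \<alpha>. b \<noteq> 0 \<and> \<alpha> \<noteq> 0 \<and> outer b \<alpha> \<in> P"
proof -
  obtain c where c: "A *v v = c *s v" using ev A by blast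
  have P: "outer v (\<phi> v* A - c *s \<phi>) \<in> P" if "cdot \<phi> v = 0" for \<phi>
  proof -
    have "\<phi> \<in> ann v" using that ev by (fastforce simp: ann_def)
    from stable_outer[OF this A(1)] show ?thesis by (simp add: c outer_linear)
  qed
  show ?thesis
  proof (cases "\<exists>\<phi>. cdot \<phi> v = 0 \<and> \<phi> v* A - c *s \<phi> \<noteq> 0")
    case True
    then show ?thesis using P v by blast
  next
    case False
    then have z: "\<phi> v* A = c *s \<phi>" if "cdot \<phi> v = 0" for \<phi> using that by auto
    obtain \<theta>0 where "cdot \<theta>0 v \<noteq> 0" using v ex_cdot_nonzero by blast
    then obtain \<theta> where \<theta>: "cdot \<theta> v = 1" 
      by (metis cdot_simps(3) nonzero_eq_divide_eq times_divide_eq_left)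
    define \<psi> where "\<psi> = \<theta> v* A - c *s \<theta>"
    \<comment> \<open>A covector \<phi> is \<phi>(v) \<theta> plus a covector killing v, and on the
      latter A acts as c. Hence A differs from c only in what it does to \<theta>, which is
      \<psi>.\<close>
    have dec: "A = mat c + outer v \<psi>"
    proof -
      have "cdot \<phi> (A *v x) = cdot \<phi> (c *s x + outer v \<psi> *v x)" for \<phi> x
      proof -
        let ?\<phi> = "\<phi> - cdot \<phi> v *s \<theta>"
        have "cdot (?\<phi> v* A) x = c * cdot ?\<phi> x" 
          by (subst z) (simp_all only: cdot_simps \<theta>, simp)
        then show ?thesis
          by (simp add: outer_matrix_mult cdot_matrix \<psi>_def vector_matrix_mult_diff_distrib
              vector_scale_matrix) (simp add: algebra_simps)
      qed
      then have "A *v x = c *s x + outer v \<psi> *v x" for x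
        by (intro cdot_ext)
      moreover have "mat c *v x = c *s x" for x :: "complex ^ 'm"
        by (simp add: vec_eq_iff matrix_vector_mult_def mat_def if_distrib[of "\<lambda>a. a * _"] if_distrib[of "\<lambda>a. _ * a"] cong: if_cong)
      ultimately show ?thesis
        by (simp add: matrix_eq matrix_vector_mult_add_rdistrib)
    qed
    \<comment> \<open>The rank one summand is traceless because v has eigenvalue c, so tr A = N
      c.\<close>
    have "cdot \<psi> v = 0" using c by (simp add: \<psi>_def cdot_matrix)
    then have "trace A = of_nat CARD('m) * c"
      by (simp add: dec trace_def mat_def sum.distrib) (simp add: cdot_def mult.commute)
    then have "c = 0" using trace_P[OF A(1)] by simp
    then have "A = outer v \<psi>" using dec by (simp add: vec_eq_iff mat_def)
    then show ?thesis using A v outer_eq_0_iff by metis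
  qed
qed

text \<open>If there are no rank one elements, then there is no common eigenvector. This forces
  covectors in \<open>ann v\<close> to vanish at v and \<open>ann v\<close> to have dimension at
  least two; there is then enough freedom to choose two successive commutators whose result has rank
  one.\<close>

lemma ex_rank_one:
  assumes A: "A \<in> P" "A \<noteq> 0"
  shows "\<exists>b \<alpha>. b \<noteq> 0 \<and> \<alpha> \<noteq> 0 \<and> outer b \<alpha> \<in> P"
proof (rule ccontr)
  assume no: "\<not> ?thesis"
  then have r1: "b = 0 \<or> \<alpha> = 0" if "outer b \<alpha> \<in> P" for b \<alpha> using that by blast
  have noev: "\<exists>A\<in>P. \<forall>c. A *v v \<noteq> c *s v" if "v \<noteq> 0" for v
    using rank_one_of_common_eigenvector[OF that A] no by blast
  \<comment> \<open>For \<open>B = [v \<otimes> \<phi>, A]\<close> with \<open>v \<otimes> \<phi>\<close> a multiple of an idempotent, \<open>B\<close> and \<open>[v \<otimes> \<phi>, B]\<close>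
    together contain \<open>(A v) \<otimes> \<phi>\<close>, of rank one.\<close>
  have iso: "cdot \<phi> v = 0" if \<phi>: "\<phi> \<in> ann v" for \<phi> v
  proof (rule ccontr)
    assume nz: "cdot \<phi> v \<noteq> 0"
    then have "v \<noteq> 0" "\<phi> \<noteq> 0" by auto
    then obtain A where A: "A \<in> P" "A *v v \<noteq> 0 *s v" using noev by blast
    let ?B = "outer v (\<phi> v* A) - outer (A *v v) \<phi>"
    have B: "?B \<in> P" using stable_outer[OF \<phi> A(1)] .
    have z: "cdot \<phi> (A *v v) = 0" using \<phi> A by (auto simp: ann_def)
    have "outer v (\<phi> v* ?B) - outer (?B *v v) \<phi> \<in> P" using stable_outer[OF \<phi> B] .
    also have "outer v (\<phi> v* ?B) - outer (?B *v v) \<phi>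
        = matrix_scale (cdot \<phi> v) (outer v (\<phi> v* A) + outer (A *v v) \<phi>)"
      using z by (simp add: outer_matrix_mult outer_linear cdot_matrix
          vector_matrix_mult_diff_rdistrib matrix_vector_mult_diff_rdistrib)
        (simp add: vec_eq_iff algebra_simps)
    finally have "matrix_scale (inverse (cdot \<phi> v)) (matrix_scale (cdot \<phi> v) (outer v (\<phi> v* A) + outer (A *v v) \<phi>)) \<in> P"
      using subspace_P mat.subspace_scale by blast
    then have "outer v (\<phi> v* A) + outer (A *v v) \<phi> \<in> P" using nz by simp
    then have "(outer v (\<phi> v* A) + outer (A *v v) \<phi>) - ?B \<in> P"
      using B subspace_P mat.subspace_diff by blast
    then have "matrix_scale (inverse 2) ((outer v (\<phi> v* A) + outer (A *v v) \<phi>) - ?B) \<in> P"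
      using subspace_P mat.subspace_scale by blast
    moreover have "matrix_scale (inverse 2) ((outer v (\<phi> v* A) + outer (A *v v) \<phi>) - ?B)
       = outer (A *v v) \<phi>"
      by (simp add: vec_eq_iff)
    ultimately show False using r1 A \<open>\<phi> \<noteq> 0\<close> by fastforce
  qed
  \<comment> \<open>The commutator of v \<otimes> \<phi> with A kills v, since \<phi>(v) = \<phi>(A
    v) = 0, and it is nonzero because A v is not a multiple of v. So
    \<open>ann_nonzero_inter\<close> applies to it.\<close>
  have two: "\<exists>\<phi>\<in>ann v. cdot \<phi> w = 0 \<and> \<phi> \<noteq> 0" if v: "v \<noteq> 0" for v w
  proof -
    obtain \<phi> where \<phi>: "\<phi> \<in> ann v" "\<phi> \<noteq> 0" using ann_nonzero by blast
    obtain A where A: "A \<in> P" "\<And>c. A *v v \<noteq> c *s v" using noev[OF v] by blast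
    let ?B = "outer v (\<phi> v* A) - outer (A *v v) \<phi>"
    have B: "?B \<in> P" using stable_outer[OF \<phi>(1) A(1)] .
    have "?B *v v = 0" using iso[OF \<phi>(1)] \<phi>(1) A(1)
      by (simp add: outer_matrix_mult matrix_vector_mult_diff_rdistrib cdot_matrix ann_def)
    moreover have "?B \<noteq> 0"
    proof
      assume e: "?B = 0"
      obtain x where x: "cdot \<phi> x \<noteq> 0" using \<phi>(2) ex_cdot_nonzero cdot_commute by metis
      have "?B *v x = 0" using e by simp
      then have "cdot \<phi> x *s (A *v v) = cdot (\<phi> v* A) x *s v"
        by (simp add: outer_matrix_mult matrix_vector_mult_diff_rdistrib)
      then have "inverse (cdot \<phi> x) *s (cdot \<phi> x *s (A *v v)) = inverse (cdot \<phi> x) *s (cdot (\<phi> v* A) x *s v)"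
        by simp
      then have "A *v v = (inverse (cdot \<phi> x) * cdot (\<phi> v* A) x) *s v"
        using x by (simp add: vec.scale_scale)
      then show False using A by blast
    qed
    ultimately show ?thesis using ann_nonzero_inter B by blast
  qed
  \<comment> \<open>Final contradiction: take B = [w \<otimes> \<psi>, A] and \<alpha> in
    \<open>ann v\<close> with \<alpha>(w) = 0. Since \<alpha>(B v) = 0 and \<psi>(v) is nonzero,
    \<alpha>(A w) = 0, whence \<alpha> B = 0. Then [v \<otimes> \<alpha>, B] reduces to - (B v)
    \<otimes> \<alpha>, which is rank one unless A w is parallel to w.\<close>
  obtain w :: "complex ^ 'm" where w: "w \<noteq> 0"
    using A(2) by (metis matrix_eq matrix_vector_mult_0_right)
  obtain \<psi> where \<psi>: "\<psi> \<in> ann w" "\<psi> \<noteq> 0" using ann_nonzero by blast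
  obtain v where v: "cdot \<psi> v \<noteq> 0" using \<psi>(2) ex_cdot_nonzero cdot_commute by metis
  then have v0: "v \<noteq> 0" by auto
  obtain \<alpha> where \<alpha>: "\<alpha> \<in> ann v" "cdot \<alpha> w = 0" "\<alpha> \<noteq> 0" using two[OF v0] by blast
  obtain A where A: "A \<in> P" "\<And>c. A *v w \<noteq> c *s w" using noev[OF w] by blast
  let ?B = "outer w (\<psi> v* A) - outer (A *v w) \<psi>"
  have B: "?B \<in> P" using stable_outer[OF \<psi>(1) A(1)] .
  have \<alpha>Aw: "cdot \<alpha> (A *v w) = 0"
  proof -
    have "cdot \<alpha> (?B *v v) = 0" using \<alpha>(1) B by (auto simp: ann_def)
    then have "cdot \<psi> v * cdot \<alpha> (A *v w) = 0"
      using \<alpha>(2) by (simp add: outer_matrix_mult matrix_vector_mult_diff_rdistrib)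
    then show ?thesis using v by simp
  qed
  have "outer v (\<alpha> v* ?B) - outer (?B *v v) \<alpha> \<in> P" using stable_outer[OF \<alpha>(1) B] .
  also have "outer v (\<alpha> v* ?B) - outer (?B *v v) \<alpha>
     = outer (cdot \<psi> v *s (A *v w) - cdot (\<psi> v* A) v *s w) \<alpha>"
  proof -
    have "\<alpha> v* ?B = 0" using \<alpha> \<alpha>Aw by (simp add: vector_matrix_mult_diff_rdistrib outer_matrix_mult)
    then show ?thesis by (simp add: outer_matrix_mult matrix_vector_mult_diff_rdistrib outer_linear)
  qed
  finally have "cdot \<psi> v *s (A *v w) = cdot (\<psi> v* A) v *s w" using r1 \<alpha>(3) by fastforce
  then have "inverse (cdot \<psi> v) *s (cdot \<psi> v *s (A *v w)) = inverse (cdot \<psi> v) *s (cdot (\<psi> v* A) v *s w)"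
    by simp
  then have "A *v w = (inverse (cdot \<psi> v) * cdot (\<psi> v* A) v) *s w"
    using v by (simp add: vec.scale_scale)
  then show False using A by blast
qed

text \<open>For \<phi> in \<open>ann x\<close> the value \<phi>(b) is 0, so the commutator of x
  \<otimes> \<phi> with b \<otimes> \<eta> is a nonzero multiple of b \<otimes> \<phi>. This gives
  one inclusion; the converse and the second claim are dimension counts with
  \<open>dim_ann\<close>.\<close>

lemma annihilator_of_rank_one:
  assumes b: "b \<noteq> 0" and \<eta>: "outer b \<eta> \<in> P" "cdot \<eta> x \<noteq> 0"
  shows "ann x = {\<eta>. outer b \<eta> \<in> P}"
    and "\<And>A. A \<in> P \<Longrightarrow> A *v x = 0 \<Longrightarrow> \<exists>\<psi>. A = outer b \<psi>"
proof -
  let ?Y = "{\<eta>. outer b \<eta> \<in> P}" and ?K = "{\<eta>. cdot \<eta> x = 0}"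
  have sY: "vec.subspace ?Y"
    using subspace_P by (auto simp: vec.subspace_def mat.subspace_def outer_linear)
  have sub: "ann x \<subseteq> ?Y"
  proof
    fix \<phi> assume \<phi>: "\<phi> \<in> ann x"
    then have "cdot \<phi> (outer b \<eta> *v x) = 0" using \<eta> by (auto simp: ann_def)
    then have "cdot \<phi> b = 0" using \<eta> by (simp add: outer_matrix_mult)
    then have "outer (cdot \<eta> x *s (- b)) \<phi> \<in> P"
      using stable_outer[OF \<phi> \<eta>(1)] by (simp add: outer_matrix_mult outer_linear)
    then have "matrix_scale (- inverse (cdot \<eta> x)) (outer (cdot \<eta> x *s (- b)) \<phi>) \<in> P"
      using subspace_P mat.subspace_scale by blast
    moreover have "matrix_scale (- inverse (cdot \<eta> x)) (outer (cdot \<eta> x *s (- b)) \<phi>) = outer b \<phi>"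
      using \<eta>(2) by (simp add: vec_eq_iff)
    ultimately show "\<phi> \<in> ?Y" by simp
  qed
  \<comment> \<open>The matrices b \<otimes> \<zeta> with \<zeta> in \<open>C\<close> are
    independent elements of \<open>P\<close> killing x, and there are at least dim ?Y - 1 of
    them.\<close>
  obtain C where C: "C \<subseteq> ?Y \<inter> ?K" "vec.independent C" "card C = vec.dim (?Y \<inter> ?K)"
    using vec.basis_exists by metis
  have iZ: "mat.independent (outer b ` C)"
    by (rule vec_mat.linear_independent_injective_image[OF linear_outer C(2)])
       (use b inj_outer in \<open>blast intro: inj_on_subset\<close>)
  have cZ: "card (outer b ` C) = card C"
    using inj_outer[OF b] by (intro card_image) (blast intro: inj_on_subset)
  have Y: "vec.dim ?Y \<le> Suc (card C)"
    using dim_inter_kernel[OF sY, of x] C(3) by simp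
  have kill: "A \<in> outer b ` C \<Longrightarrow> A *v x = 0" for A
    using C(1) by (auto simp: outer_matrix_mult)
  have "vec.dim ?Y \<le> vec.dim (ann x)"
    using dim_ann[OF _ iZ kill] C(1) cZ Y by force
  then show eq: "ann x = ?Y"
    by (intro vec.subspace_dim_equal subspace_ann sY sub)
  show "\<exists>\<psi>. A = outer b \<psi>" if A: "A \<in> P" "A *v x = 0" for A
  proof (rule ccontr)
    \<comment> \<open>Such an A could be added to the independent family built from
      \<open>C\<close>; the enlarged family has at least dim ?Y members killing x, so
      \<open>dim_ann\<close> would make \<open>ann x\<close> larger than \<open>?Y\<close>.\<close>
    assume no: "\<not> ?thesis"
    have "B \<in> range (outer b)" if "B \<in> mat.span (outer b ` C)" for B
      using that
    proof (induction rule: mat.span_induct)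
      case base
      have "mat.subspace (range (outer b))"
        unfolding mat.subspace_def by (metis (no_types, lifting) outer_linear(5,7,8) rangeE rangeI)
      then show ?case by simp
    qed auto
    then have nA: "A \<notin> mat.span (outer b ` C)" using no by blast
    then have i2: "mat.independent (insert A (outer b ` C))"
      using iZ by (simp add: mat.independent_insert)
    have "finite (outer b ` C)" using C(2) vec.finiteI_independent by blast
    then have "card (insert A (outer b ` C)) = Suc (card C)"
      using nA cZ by (metis card_insert_disjoint mat.span_base)
    moreover have "card (insert A (outer b ` C)) < vec.dim (ann x)"
      using A C(1) kill by (intro dim_ann[OF _ i2]) auto
    ultimately show False using Y eq by simp
  qed
qed

text \<open>When \<alpha>(y) is nonzero, \<alpha> itself lies in \<open>ann y\<close>, so \<alpha> A
  vanishes at y. Vectors with \<alpha>(y) nonzero span the space: a vector in the kernel of \<alpha>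
  is a difference of two of them.\<close>

lemma left_kernel:
  assumes b: "b \<noteq> 0" and \<alpha>: "outer b \<alpha> \<in> P" "\<alpha> \<noteq> 0" and A: "A \<in> P"
  shows "\<alpha> v* A = 0"
proof (rule ccontr)
  assume "\<alpha> v* A \<noteq> 0"
  then obtain x where x: "cdot (\<alpha> v* A) x \<noteq> 0" using ex_cdot_nonzero cdot_commute by metis
  have z: "cdot (\<alpha> v* A) y = 0" if "cdot \<alpha> y \<noteq> 0" for y
    using annihilator_of_rank_one(1)[OF b \<alpha>(1) that] \<alpha>(1) A by (auto simp: ann_def cdot_matrix)
  obtain x0 where x0: "cdot \<alpha> x0 \<noteq> 0" using \<alpha>(2) ex_cdot_nonzero cdot_commute by metis
  have "cdot \<alpha> x = 0" using z x by blast
  then have "cdot \<alpha> (x + x0) \<noteq> 0" using x0 by simp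
  from z[OF this] z[OF x0] x show False by simp
qed

text \<open>Transposition preserves the trace form and reverses commutators up to sign, so each
  one-sided statement about \<open>P\<close> has a mirror image.\<close>

lemma perp_stable_transpose: "perp_stable (transpose ` P) (transpose ` S)"
proof
  have [simp]: "transpose (matrix_scale c A) = matrix_scale c (transpose A)"
     "transpose (A + B) = transpose A + transpose B"
     "transpose (A - B) = transpose A - transpose B"
     "transpose (0 :: complex ^ 'm ^ 'm) = 0" for A B :: "complex ^ 'm ^ 'm" and c
    by (simp_all add: vec_eq_iff transpose_def)
  show "mat.subspace (transpose ` P)"
    unfolding mat.subspace_def
  proof (intro conjI ballI allI)
    show "0 \<in> transpose ` P" using mat.subspace_0[OF subspace_P] by (force intro: image_eqI[of _ _ 0])
    fix x y assume "x \<in> transpose ` P" "y \<in> transpose ` P"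
    then obtain a c where "x = transpose a" "y = transpose c" "a \<in> P" "c \<in> P" by blast
    then show "x + y \<in> transpose ` P"
      using mat.subspace_add[OF subspace_P] by (intro image_eqI[of _ _ "a + c"]) auto
  next
    fix x c assume "x \<in> transpose ` P"
    then obtain a where "x = transpose a" "a \<in> P" by blast
    then show "matrix_scale c x \<in> transpose ` P"
      using mat.subspace_scale[OF subspace_P] by (intro image_eqI[of _ _ "matrix_scale c a"]) auto
  qed
  have "transpose A \<in> mat.span (transpose ` S)" if "A \<in> mat.span S" for A
    using that
  proof (induction rule: mat.span_induct)
    case base
    show ?case
      by (auto simp: mat.subspace_def intro: mat.span_zero mat.span_add mat.span_scale)
  qed (auto intro: mat.span_base)
  then show "transpose ` P \<subseteq> mat.span (transpose ` S)" using span_P by blast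
  show "finite (transpose ` S)" using finite_S by simp
  show "card (transpose ` S) < CARD('m)" using card_S card_image_le[OF finite_S] le_less_trans by blast
  show "trace A = 0" if "A \<in> transpose ` P" for A
    using that trace_P by (auto simp: trace_def transpose_def)
  fix X A assume X: "\<And>A. A \<in> transpose ` P \<Longrightarrow> trace (X ** A) = 0" and A: "A \<in> transpose ` P"
  obtain B where B: "A = transpose B" "B \<in> P" using A by blast
  have tr: "trace (transpose X ** B) = trace (X ** transpose B)" for B
    by (simp add: trace_def matrix_matrix_mult_def transpose_def) (rule sum.swap)
  have "transpose X ** B - B ** transpose X \<in> P"
    using X B(2) tr by (intro stable_P) auto
  then have "- (transpose X ** B - B ** transpose X) \<in> P"
    using mat.subspace_neg[OF subspace_P] by blast
  moreover have "X ** A - A ** X = transpose (- (transpose X ** B - B ** transpose X))"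
    by (simp add: B matrix_transpose_mul)
  ultimately show "X ** A - A ** X \<in> transpose ` P" by blast
qed

lemma right_kernel:
  assumes "b \<noteq> 0" "outer b \<alpha> \<in> P" "\<alpha> \<noteq> 0" "A \<in> P"
  shows "A *v b = 0"
proof -
  have "transpose (outer b \<alpha>) = outer \<alpha> b" by (simp add: vec_eq_iff transpose_def)
  then have "outer \<alpha> b \<in> transpose ` P" using assms(2) by (metis image_eqI)
  then have "b v* transpose A = 0"
    using perp_stable.left_kernel[OF perp_stable_transpose] assms by blast
  then show ?thesis by simp
qed

text \<open>The minors mix two matrices because the direction has to be common to all of
  \<open>P\<close>. As polynomial equations they can also be followed as the point of M
  varies.\<close>

theorem columns_or_rows_parallel:
  "(\<forall>A\<in>P. \<forall>B\<in>P. \<forall>i j k l. A $ i $ k * B $ j $ l = A $ j $ k * B $ i $ l) \<or>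
   (\<forall>A\<in>P. \<forall>B\<in>P. \<forall>i j k l. A $ k $ i * B $ l $ j = A $ k $ j * B $ l $ i)"
proof (cases "P \<subseteq> {0}")
  case True
  then have "A $ i $ j = 0" if "A \<in> P" for A i j using that by auto
  then show ?thesis by simp
next
  case False
  then obtain b \<alpha> where b: "b \<noteq> 0" and \<alpha>: "\<alpha> \<noteq> 0" and ba: "outer b \<alpha> \<in> P"
    using ex_rank_one by blast
  note lk = left_kernel[OF b ba \<alpha>] and rk = right_kernel[OF b ba \<alpha>]
  have neg: "- A \<in> P" if "A \<in> P" for A using mat.subspace_neg[OF subspace_P that] .
  \<comment> \<open>As \<alpha> annihilates \<open>P\<close> from the left, it belongs to every
    \<open>ann w\<close>, and one of the two terms of the commutator disappears. The mirror argument
    with b gives \<open>row\<close>.\<close>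
  have col: "outer (A *v w) \<alpha> \<in> P" if "A \<in> P" for A w
  proof -
    have "\<alpha> \<in> ann w" using lk by (auto simp: ann_def simp flip: cdot_matrix)
    from neg[OF stable_outer[OF this that]] show ?thesis by (simp add: lk[OF that] outer_linear)
  qed
  have row: "outer b (\<phi> v* A) \<in> P" if "A \<in> P" for A \<phi>
  proof -
    have "\<phi> \<in> ann b" using rk by (auto simp: ann_def)
    from stable_outer[OF this that] show ?thesis by (simp add: rk[OF that] outer_linear)
  qed
  show ?thesis
  proof (cases "\<forall>A\<in>P. \<forall>w. \<exists>c. A *v w = c *s b")
    case True
    have "\<exists>f. \<forall>i k. A $ i $ k = b $ i * f k" if "A \<in> P" for A
    proof -
      have "\<forall>k. \<exists>c. A *v axis k 1 = c *s b" using True that by blast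
      from choice[OF this] obtain f where f: "\<And>k. A *v axis k 1 = f k *s b" by blast
      have "A $ i $ k = b $ i * f k" for i k
        using matrix_vector_axis[of A k i] unfolding f vector_smult_component by (metis mult.commute)
      then show ?thesis by blast
    qed
    note par = this
    show ?thesis
    proof (intro disjI1 ballI allI)
      fix A B :: "complex ^ 'm ^ 'm" and i j k l
      assume AB: "A \<in> P" "B \<in> P"
      obtain f where f: "\<And>i k. A $ i $ k = b $ i * f k" using par[OF AB(1)] by blast
      obtain g where g: "\<And>i k. B $ i $ k = b $ i * g k" using par[OF AB(2)] by blast
      show "A $ i $ k * B $ j $ l = A $ j $ k * B $ i $ l" by (simp add: f g)
    qed
  next
    case False
    then obtain A w where A: "A \<in> P" "\<And>c. A *v w \<noteq> c *s b" by blast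
    obtain x0 where "cdot \<alpha> x0 \<noteq> 0" using \<alpha> ex_cdot_nonzero cdot_commute by metis
    then obtain x1 where x1: "cdot \<alpha> x1 = 1"
      by (metis cdot_simps(8) left_inverse)
    have rows: "\<exists>c. \<phi> v* B = c *s \<alpha>" if B: "B \<in> P" for B \<phi>
    proof (rule ccontr)
      assume no: "\<not> ?thesis"
      let ?\<alpha>' = "\<phi> v* B"
      have "?\<alpha>' - cdot ?\<alpha>' x1 *s \<alpha> \<noteq> 0" using no by (metis eq_iff_diff_eq_0)
      then obtain y where y: "cdot (?\<alpha>' - cdot ?\<alpha>' x1 *s \<alpha>) y \<noteq> 0"
        using ex_cdot_nonzero cdot_commute by metis
      \<comment> \<open>\<open>?x\<close> is killed by \<alpha> but not by the row
        \<open>?\<alpha>'\<close>. Thus b \<otimes> \<open>?\<alpha>'\<close> is nonzero on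
        \<open>?x\<close> while (A w) \<otimes> \<alpha> kills it, which forces A w to be parallel
        to b.\<close>
      let ?x = "y - cdot \<alpha> y *s x1"
      have "cdot ?\<alpha>' ?x \<noteq> 0" using y by (simp add: mult.commute)
      moreover have "outer (A *v w) \<alpha> *v ?x = 0" using x1 by (simp add: outer_matrix_mult)
      ultimately obtain \<psi> where "outer (A *v w) \<alpha> = outer b \<psi>"
        using annihilator_of_rank_one(2)[OF b row[OF B]] col[OF A(1)] by blast
      then have "outer (A *v w) \<alpha> *v x1 = outer b \<psi> *v x1" by simp
      then show False using A(2) x1 by (simp add: outer_matrix_mult)
    qed
    have "\<exists>f. \<forall>i k. B $ k $ i = \<alpha> $ i * f k" if "B \<in> P" for B
    proof -
      have "\<forall>k. \<exists>c. axis k 1 v* B = c *s \<alpha>" using rows[OF that] by blast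
      from choice[OF this] obtain f where f: "\<And>k. axis k 1 v* B = f k *s \<alpha>" by blast
      have "B $ k $ i = \<alpha> $ i * f k" for i k
        using axis_vector_matrix[of k B i] unfolding f vector_smult_component by (metis mult.commute)
      then show ?thesis by blast
    qed
    note par = this
    show ?thesis
    proof (intro disjI2 ballI allI)
      fix A B :: "complex ^ 'm ^ 'm" and i j k l
      assume AB: "A \<in> P" "B \<in> P"
      obtain f where f: "\<And>i k. A $ k $ i = \<alpha> $ i * f k" using par[OF AB(1)] by blast
      obtain g where g: "\<And>i k. B $ k $ i = \<alpha> $ i * g k" using par[OF AB(2)] by blast
      show "A $ k $ i * B $ l $ j = A $ k $ j * B $ l $ i" by (simp add: f g)
    qed
  qed
qed

end

section \<open>Rational functions on irreducible spaces with functions\<close>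

text \<open>What is used of regular functions, abstracted so that varieties and projective space
  share one theory.\<close>

locale fn_space =
  fixes M :: "'p fspace"
  assumes reg_cong: "openin (zar M) U \<Longrightarrow> f \<in> reg M U \<Longrightarrow> (\<And>x. x \<in> U \<Longrightarrow> f x = g x) \<Longrightarrow> g \<in> reg M U"
    and reg_restrict: "openin (zar M) U \<Longrightarrow> openin (zar M) V \<Longrightarrow> V \<subseteq> U \<Longrightarrow> f \<in> reg M U \<Longrightarrow> f \<in> reg M V"
    and reg_glue: "(\<And>U. U \<in> \<U> \<Longrightarrow> openin (zar M) U \<and> f \<in> reg M U) \<Longrightarrow> f \<in> reg M (\<Union>\<U>)"
    and reg_const: "openin (zar M) U \<Longrightarrow> (\<lambda>_. c) \<in> reg M U"
    and reg_add: "openin (zar M) U \<Longrightarrow> f \<in> reg M U \<Longrightarrow> g \<in> reg M U \<Longrightarrow> (\<lambda>x. f x + g x) \<in> reg M U"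
    and reg_mult: "openin (zar M) U \<Longrightarrow> f \<in> reg M U \<Longrightarrow> g \<in> reg M U \<Longrightarrow> (\<lambda>x. f x * g x) \<in> reg M U"
    and reg_inverse: "openin (zar M) U \<Longrightarrow> f \<in> reg M U \<Longrightarrow> (\<And>x. x \<in> U \<Longrightarrow> f x \<noteq> 0) \<Longrightarrow>
       (\<lambda>x. inverse (f x)) \<in> reg M U"
    and nonzero_open: "openin (zar M) U \<Longrightarrow> f \<in> reg M U \<Longrightarrow> openin (zar M) {x \<in> U. f x \<noteq> 0}"
begin

lemma reg_local:
  assumes "\<And>x. x \<in> U \<Longrightarrow> \<exists>V g. openin (zar M) V \<and> x \<in> V \<and> V \<subseteq> U \<and> g \<in> reg M V \<and> (\<forall>y\<in>V. f y = g y)"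
  shows "f \<in> reg M U"
proof -
  have "f \<in> reg M (\<Union>{V. openin (zar M) V \<and> V \<subseteq> U \<and> f \<in> reg M V})"
    by (rule reg_glue) blast
  also have "\<Union>{V. openin (zar M) V \<and> V \<subseteq> U \<and> f \<in> reg M V} = U"
  proof
    show "U \<subseteq> \<Union>{V. openin (zar M) V \<and> V \<subseteq> U \<and> f \<in> reg M V}"
    proof
      fix x assume "x \<in> U"
      then obtain V g where V: "openin (zar M) V" "x \<in> V" "V \<subseteq> U" "g \<in> reg M V" "\<forall>y\<in>V. f y = g y"
        using assms by blast
      then have "f \<in> reg M V" using reg_cong[of V g f] by auto
      then show "x \<in> \<Union>{V. openin (zar M) V \<and> V \<subseteq> U \<and> f \<in> reg M V}" using V by blast
    qed
  qed blast
  finally show ?thesis .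
qed

lemma reg_diff: "openin (zar M) U \<Longrightarrow> f \<in> reg M U \<Longrightarrow> g \<in> reg M U \<Longrightarrow> (\<lambda>x. f x - g x) \<in> reg M U"
  using reg_add[of U f "\<lambda>x. (-1) * g x"] reg_mult[OF _ reg_const[of U "-1"], of g] by simp

lemma reg_uminus: "openin (zar M) U \<Longrightarrow> f \<in> reg M U \<Longrightarrow> (\<lambda>x. - f x) \<in> reg M U"
  using reg_diff[OF _ reg_const[of U 0], of f] by simp

lemma reg_divide: "openin (zar M) U \<Longrightarrow> f \<in> reg M U \<Longrightarrow> g \<in> reg M U \<Longrightarrow> (\<And>x. x \<in> U \<Longrightarrow> g x \<noteq> 0) \<Longrightarrow>
   (\<lambda>x. f x / g x) \<in> reg M U"
  using reg_mult[OF _ _ reg_inverse[of U g], of f] by (simp add: divide_inverse)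

lemma open_points: "openin (zar M) (points M)"
  by (simp add: points_def)

lemma open_sub_points: "openin (zar M) U \<Longrightarrow> U \<subseteq> points M"
  by (simp add: points_def openin_subset)

end

text \<open>Irreducibility is taken in the form that nonempty open sets meet. For projective space
  it is obtained later, from M, through the map itself.\<close>

locale rat_space = fn_space M for M :: "'p fspace" +
  assumes irreducible: "openin (zar M) U \<Longrightarrow> openin (zar M) V \<Longrightarrow> U \<noteq> {} \<Longrightarrow> V \<noteq> {} \<Longrightarrow> U \<inter> V \<noteq> {}"
    and points_nonempty: "points M \<noteq> {}"
begin

abbreviation "K \<equiv> function_field M"
abbreviation "cls \<equiv> rat_class M"

lemma reps_iff: "(U, f) \<in> rat_reps M \<longleftrightarrow> openin (zar M) U \<and> U \<noteq> {} \<and> f \<in> reg M U"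
  by (simp add: rat_reps_def)

text \<open>The set where f - g does not vanish is open; were it nonempty, it would meet
  \<open>V\<close>.\<close>

lemma identity:
  assumes "openin (zar M) U" "f \<in> reg M U" "g \<in> reg M U" "openin (zar M) V" "V \<noteq> {}"
    and "\<And>x. x \<in> V \<inter> U \<Longrightarrow> f x = g x" "x \<in> U"
  shows "f x = g x"
proof (rule ccontr)
  assume "f x \<noteq> g x"
  moreover have "openin (zar M) {x \<in> U. f x - g x \<noteq> 0}"
    using assms by (intro nonzero_open reg_diff)
  ultimately have "V \<inter> {x \<in> U. f x - g x \<noteq> 0} \<noteq> {}"
    using assms(4,5,7) by (intro irreducible) auto
  then show False using assms(6) by auto
qed

lemma equiv_rat_rel: "equiv (rat_reps M) (rat_rel M)"
proof (rule equivI)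
  show "rat_rel M \<subseteq> rat_reps M \<times> rat_reps M" by (auto simp: rat_rel_def)
  show "refl_on (rat_reps M) (rat_rel M)" by (auto simp: refl_on_def rat_rel_def)
  show "sym (rat_rel M)" by (auto simp: sym_def rat_rel_def)
  show "trans (rat_rel M)"
  proof (rule transI, clarify)
    fix U f V g W h
    assume a: "((U, f), V, g) \<in> rat_rel M" "((V, g), W, h) \<in> rat_rel M"
    \<comment> \<open>Agreement is known only on the part of U \<inter> W inside V;
      \<open>identity\<close> extends it.\<close>
    have "f x = h x" if "x \<in> U \<inter> W" for x
      using a
      by (intro identity[of "U \<inter> W" f h V x])
         (use that in \<open>auto simp: rat_rel_def rat_reps_def intro: reg_restrict[of U] reg_restrict[of W]\<close>)
    then show "((U, f), W, h) \<in> rat_rel M" using a by (auto simp: rat_rel_def)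
  qed
qed

lemma mem_cls: "(U, f) \<in> rat_reps M \<Longrightarrow>
    (V, g) \<in> cls U f \<longleftrightarrow> (V, g) \<in> rat_reps M \<and> (\<forall>x\<in>U \<inter> V. f x = g x)"
  by (auto simp: rat_class_def rat_rel_def)

lemma cls_eq_iff: "(U, f) \<in> rat_reps M \<Longrightarrow> (V, g) \<in> rat_reps M \<Longrightarrow>
    cls U f = cls V g \<longleftrightarrow> (\<forall>x\<in>U \<inter> V. f x = g x)"
  unfolding rat_class_def using eq_equiv_class_iff[OF equiv_rat_rel, of "(U, f)" "(V, g)"]
  by (auto simp: rat_rel_def)

lemma carrier_K: "carrier K = rat_reps M // rat_rel M"
  by (simp add: function_field_def)

lemma cls_in_K [intro]: "(U, f) \<in> rat_reps M \<Longrightarrow> cls U f \<in> carrier K"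
  unfolding carrier_K rat_class_def by (rule quotientI)

lemma K_cases: "\<xi> \<in> carrier K \<Longrightarrow> (\<And>U f. (U, f) \<in> rat_reps M \<Longrightarrow> \<xi> = cls U f \<Longrightarrow> P) \<Longrightarrow> P"
  unfolding carrier_K rat_class_def by (erule quotientE) auto

lemma mem_K: "\<xi> \<in> carrier K \<Longrightarrow> (U, f) \<in> \<xi> \<Longrightarrow> (U, f) \<in> rat_reps M \<and> \<xi> = cls U f"
  by (erule K_cases) (auto simp: mem_cls cls_eq_iff)

lemma reps_Int:
  assumes "(U, f) \<in> rat_reps M" "(V, g) \<in> rat_reps M"
  shows "openin (zar M) (U \<inter> V)" "U \<inter> V \<noteq> {}" "f \<in> reg M (U \<inter> V)" "g \<in> reg M (U \<inter> V)"
  using assms irreducible[of U V] reg_restrict[of U "U \<inter> V" f] reg_restrict[of V "U \<inter> V" g]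
  by (auto simp: rat_reps_def)

lemma reps_add: "(U, f) \<in> rat_reps M \<Longrightarrow> (V, g) \<in> rat_reps M \<Longrightarrow> (U \<inter> V, \<lambda>x. f x + g x) \<in> rat_reps M"
  and reps_mult: "(U, f) \<in> rat_reps M \<Longrightarrow> (V, g) \<in> rat_reps M \<Longrightarrow> (U \<inter> V, \<lambda>x. f x * g x) \<in> rat_reps M"
  and reps_diff: "(U, f) \<in> rat_reps M \<Longrightarrow> (V, g) \<in> rat_reps M \<Longrightarrow> (U \<inter> V, \<lambda>x. f x - g x) \<in> rat_reps M"
  by (simp_all add: reps_iff[of "U \<inter> V"] reps_Int[of U f V g] reg_add reg_mult reg_diff)

lemma reps_uminus: "(U, f) \<in> rat_reps M \<Longrightarrow> (U, \<lambda>x. - f x) \<in> rat_reps M"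
  by (auto simp: reps_iff intro: reg_uminus)

lemma reps_const: "(points M, \<lambda>_. c) \<in> rat_reps M"
  using points_nonempty open_points by (auto simp: reps_iff intro: reg_const)

lemma reps_restrict: "(U, f) \<in> rat_reps M \<Longrightarrow> openin (zar M) V \<Longrightarrow> V \<noteq> {} \<Longrightarrow> V \<subseteq> U \<Longrightarrow> (V, f) \<in> rat_reps M"
  by (auto simp: reps_iff intro: reg_restrict)

lemma cls_restrict: "(U, f) \<in> rat_reps M \<Longrightarrow> openin (zar M) V \<Longrightarrow> V \<noteq> {} \<Longrightarrow> V \<subseteq> U \<Longrightarrow> cls V f = cls U f"
  by (subst cls_eq_iff) (auto intro: reps_restrict)

lemma UN_eq_const: "\<xi> \<noteq> {} \<Longrightarrow> (\<And>z. z \<in> \<xi> \<Longrightarrow> F z = c) \<Longrightarrow> (\<Union>z\<in>\<xi>. F z) = c"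
  by auto

lemma K_add: 
  assumes "(U, f) \<in> rat_reps M" "(V, g) \<in> rat_reps M"
  shows "cls U f \<oplus>\<^bsub>K\<^esub> cls V g = cls (U \<inter> V) (\<lambda>x. f x + g x)"
proof -
  have U: "(U, f) \<in> cls U f" and V: "(V, g) \<in> cls V g" using assms by (auto simp: mem_cls)
  have "(\<Union>(U', f')\<in>cls U f. \<Union>(V', g')\<in>cls V g. cls (U' \<inter> V') (\<lambda>x. f' x + g' x))
     = cls (U \<inter> V) (\<lambda>x. f x + g x)"
  proof (intro UN_eq_const, use U in blast, clarify, intro UN_eq_const, use V in blast, clarify)
    fix U' f' V' g' assume a: "(U', f') \<in> cls U f" "(V', g') \<in> cls V g"
    then show "cls (U' \<inter> V') (\<lambda>x. f' x + g' x) = cls (U \<inter> V) (\<lambda>x. f x + g x)"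
      using assms by (subst cls_eq_iff) (auto simp: mem_cls intro!: reps_add)
  qed
  then show ?thesis by (simp add: function_field_def)
qed

lemma K_mult: 
  assumes "(U, f) \<in> rat_reps M" "(V, g) \<in> rat_reps M"
  shows "cls U f \<otimes>\<^bsub>K\<^esub> cls V g = cls (U \<inter> V) (\<lambda>x. f x * g x)"
proof -
  have U: "(U, f) \<in> cls U f" and V: "(V, g) \<in> cls V g" using assms by (auto simp: mem_cls)
  have "(\<Union>(U', f')\<in>cls U f. \<Union>(V', g')\<in>cls V g. cls (U' \<inter> V') (\<lambda>x. f' x * g' x))
     = cls (U \<inter> V) (\<lambda>x. f x * g x)"
  proof (intro UN_eq_const, use U in blast, clarify, intro UN_eq_const, use V in blast, clarify)
    fix U' f' V' g' assume a: "(U', f') \<in> cls U f" "(V', g') \<in> cls V g"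
    then show "cls (U' \<inter> V') (\<lambda>x. f' x * g' x) = cls (U \<inter> V) (\<lambda>x. f x * g x)"
      using assms by (subst cls_eq_iff) (auto simp: mem_cls intro!: reps_mult)
  qed
  then show ?thesis by (simp add: function_field_def)
qed

lemma K_zero: "\<zero>\<^bsub>K\<^esub> = rat_const M 0" and K_one: "\<one>\<^bsub>K\<^esub> = rat_const M 1"
  by (simp_all add: function_field_def)

lemma const_in_K: "rat_const M c \<in> carrier K"
  unfolding rat_const_def by (intro cls_in_K reps_const)

lemma cls_eqI: "(U, f) \<in> rat_reps M \<Longrightarrow> (V, g) \<in> rat_reps M \<Longrightarrow> (\<And>x. x \<in> U \<Longrightarrow> x \<in> V \<Longrightarrow> f x = g x) \<Longrightarrow>
    cls U f = cls V g"
  by (simp add: cls_eq_iff)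

lemma cring_K: "cring K"
proof (rule cringI)
  show "abelian_group K"
  proof (rule abelian_groupI)
    fix x y assume x: "x \<in> carrier K" and y: "y \<in> carrier K"
    obtain U f where f: "(U, f) \<in> rat_reps M" "x = cls U f" using x by (rule K_cases)
    obtain V g where g: "(V, g) \<in> rat_reps M" "y = cls V g" using y by (rule K_cases)
    show "x \<oplus>\<^bsub>K\<^esub> y \<in> carrier K" unfolding f g K_add[OF f(1) g(1)]
      by (intro cls_in_K reps_add f g)
    show "x \<oplus>\<^bsub>K\<^esub> y = y \<oplus>\<^bsub>K\<^esub> x" unfolding f g K_add[OF f(1) g(1)] K_add[OF g(1) f(1)]
      by (intro cls_eqI reps_add f g) simp
    fix z assume z: "z \<in> carrier K"
    obtain W h where h: "(W, h) \<in> rat_reps M" "z = cls W h" using z by (rule K_cases)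
    show "x \<oplus>\<^bsub>K\<^esub> y \<oplus>\<^bsub>K\<^esub> z = x \<oplus>\<^bsub>K\<^esub> (y \<oplus>\<^bsub>K\<^esub> z)"
      unfolding f g h K_add[OF f(1) g(1)] K_add[OF g(1) h(1)]
        K_add[OF reps_add[OF f(1) g(1)] h(1)] K_add[OF f(1) reps_add[OF g(1) h(1)]]
      by (intro cls_eqI reps_add f g h) simp
  next
    show "\<zero>\<^bsub>K\<^esub> \<in> carrier K" by (simp add: K_zero const_in_K)
    fix x assume "x \<in> carrier K"
    then obtain U f where f: "(U, f) \<in> rat_reps M" "x = cls U f" by (rule K_cases)
    show "\<zero>\<^bsub>K\<^esub> \<oplus>\<^bsub>K\<^esub> x = x" unfolding f K_zero rat_const_def K_add[OF reps_const f(1)]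
      by (intro cls_eqI reps_add f reps_const) simp
    have "cls U (\<lambda>x. - f x) \<oplus>\<^bsub>K\<^esub> x = \<zero>\<^bsub>K\<^esub>"
      unfolding f K_zero rat_const_def K_add[OF reps_uminus[OF f(1)] f(1)]
      by (intro cls_eqI reps_add f reps_const reps_uminus) simp
    then show "\<exists>y\<in>carrier K. y \<oplus>\<^bsub>K\<^esub> x = \<zero>\<^bsub>K\<^esub>" using cls_in_K[OF reps_uminus[OF f(1)]] by blast
  qed
  show "comm_monoid K"
  proof (rule comm_monoidI)
    fix x y assume x: "x \<in> carrier K" and y: "y \<in> carrier K"
    obtain U f where f: "(U, f) \<in> rat_reps M" "x = cls U f" using x by (rule K_cases)
    obtain V g where g: "(V, g) \<in> rat_reps M" "y = cls V g" using y by (rule K_cases)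
    show "x \<otimes>\<^bsub>K\<^esub> y \<in> carrier K" unfolding f g K_mult[OF f(1) g(1)]
      by (intro cls_in_K reps_mult f g)
    show "x \<otimes>\<^bsub>K\<^esub> y = y \<otimes>\<^bsub>K\<^esub> x" unfolding f g K_mult[OF f(1) g(1)] K_mult[OF g(1) f(1)]
      by (intro cls_eqI reps_mult f g) simp
    fix z assume z: "z \<in> carrier K"
    obtain W h where h: "(W, h) \<in> rat_reps M" "z = cls W h" using z by (rule K_cases)
    show "x \<otimes>\<^bsub>K\<^esub> y \<otimes>\<^bsub>K\<^esub> z = x \<otimes>\<^bsub>K\<^esub> (y \<otimes>\<^bsub>K\<^esub> z)"
      unfolding f g h K_mult[OF f(1) g(1)] K_mult[OF g(1) h(1)]
        K_mult[OF reps_mult[OF f(1) g(1)] h(1)] K_mult[OF f(1) reps_mult[OF g(1) h(1)]]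
      by (intro cls_eqI reps_mult f g h) simp
  next
    show "\<one>\<^bsub>K\<^esub> \<in> carrier K" by (simp add: K_one const_in_K)
    fix x assume "x \<in> carrier K"
    then obtain U f where f: "(U, f) \<in> rat_reps M" "x = cls U f" by (rule K_cases)
    show "\<one>\<^bsub>K\<^esub> \<otimes>\<^bsub>K\<^esub> x = x" unfolding f K_one rat_const_def K_mult[OF reps_const f(1)]
      by (intro cls_eqI reps_mult f reps_const) simp
  qed
  fix x y z assume x: "x \<in> carrier K" and y: "y \<in> carrier K" and z: "z \<in> carrier K"
  obtain U f where f: "(U, f) \<in> rat_reps M" "x = cls U f" using x by (rule K_cases)
  obtain V g where g: "(V, g) \<in> rat_reps M" "y = cls V g" using y by (rule K_cases)
  obtain W h where h: "(W, h) \<in> rat_reps M" "z = cls W h" using z by (rule K_cases)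
  show "(x \<oplus>\<^bsub>K\<^esub> y) \<otimes>\<^bsub>K\<^esub> z = x \<otimes>\<^bsub>K\<^esub> z \<oplus>\<^bsub>K\<^esub> y \<otimes>\<^bsub>K\<^esub> z"
    unfolding f g h K_add[OF f(1) g(1)] K_mult[OF g(1) h(1)] K_mult[OF f(1) h(1)]
      K_mult[OF reps_add[OF f(1) g(1)] h(1)] K_add[OF reps_mult[OF f(1) h(1)] reps_mult[OF g(1) h(1)]]
    by (intro cls_eqI reps_mult reps_add f g h) (simp add: distrib_right)
qed

sublocale K: cring K by (rule cring_K)

lemma K_uminus: "(U, f) \<in> rat_reps M \<Longrightarrow> \<ominus>\<^bsub>K\<^esub> cls U f = cls U (\<lambda>x. - f x)"
proof (rule K.minus_equality)
  assume f: "(U, f) \<in> rat_reps M"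
  show "cls U (\<lambda>x. - f x) \<oplus>\<^bsub>K\<^esub> cls U f = \<zero>\<^bsub>K\<^esub>"
    unfolding K_zero rat_const_def K_add[OF reps_uminus[OF f] f]
    by (intro cls_eqI reps_add f reps_const reps_uminus) simp
qed (auto intro: reps_uminus)

lemma K_minus: "(U, f) \<in> rat_reps M \<Longrightarrow> (V, g) \<in> rat_reps M \<Longrightarrow>
    cls U f \<ominus>\<^bsub>K\<^esub> cls V g = cls (U \<inter> V) (\<lambda>x. f x - g x)"
  by (simp add: a_minus_def K_uminus K_add reps_uminus)

lemma value_cls: "(U, f) \<in> rat_reps M \<Longrightarrow> p \<in> U \<Longrightarrow> rat_value p (cls U f) = f p"
  unfolding rat_value_def
  by (rule the_equality) (auto simp: mem_cls intro!: bexI[of _ "(U, f)"])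

lemma local_ring_cls: "(U, f) \<in> rat_reps M \<Longrightarrow> p \<in> U \<Longrightarrow> cls U f \<in> local_ring M p"
  unfolding local_ring_def by (auto simp: mem_cls intro!: bexI[of _ "(U, f)"])

lemma local_ring_cases:
  assumes "\<xi> \<in> local_ring M p"
  obtains U f where "(U, f) \<in> rat_reps M" "p \<in> U" "\<xi> = cls U f"
  using assms mem_K unfolding local_ring_def by blast

lemma local_ring_carrier: "\<xi> \<in> local_ring M p \<Longrightarrow> \<xi> \<in> carrier K"
  by (simp add: local_ring_def)

lemma local_ring_add: "\<xi> \<in> local_ring M p \<Longrightarrow> \<eta> \<in> local_ring M p \<Longrightarrow> \<xi> \<oplus>\<^bsub>K\<^esub> \<eta> \<in> local_ring M p"
  and value_add: "\<xi> \<in> local_ring M p \<Longrightarrow> \<eta> \<in> local_ring M p \<Longrightarrow> rat_value p (\<xi> \<oplus>\<^bsub>K\<^esub> \<eta>) = rat_value p \<xi> + rat_value p \<eta>"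
  by (auto elim!: local_ring_cases simp: K_add value_cls reps_add intro!: local_ring_cls)

lemma local_ring_mult: "\<xi> \<in> local_ring M p \<Longrightarrow> \<eta> \<in> local_ring M p \<Longrightarrow> \<xi> \<otimes>\<^bsub>K\<^esub> \<eta> \<in> local_ring M p"
  and value_mult: "\<xi> \<in> local_ring M p \<Longrightarrow> \<eta> \<in> local_ring M p \<Longrightarrow> rat_value p (\<xi> \<otimes>\<^bsub>K\<^esub> \<eta>) = rat_value p \<xi> * rat_value p \<eta>"
  by (auto elim!: local_ring_cases simp: K_mult value_cls reps_mult intro!: local_ring_cls)

lemma local_ring_minus: "\<xi> \<in> local_ring M p \<Longrightarrow> \<eta> \<in> local_ring M p \<Longrightarrow> \<xi> \<ominus>\<^bsub>K\<^esub> \<eta> \<in> local_ring M p"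
  and value_minus: "\<xi> \<in> local_ring M p \<Longrightarrow> \<eta> \<in> local_ring M p \<Longrightarrow> rat_value p (\<xi> \<ominus>\<^bsub>K\<^esub> \<eta>) = rat_value p \<xi> - rat_value p \<eta>"
  by (auto elim!: local_ring_cases simp: K_minus value_cls reps_diff intro!: local_ring_cls)

lemma local_ring_const: "p \<in> points M \<Longrightarrow> rat_const M c \<in> local_ring M p"
  and value_const: "p \<in> points M \<Longrightarrow> rat_value p (rat_const M c) = c"
  by (auto simp: rat_const_def value_cls reps_const intro!: local_ring_cls)

text \<open>Local representatives have the same values, so the value function is regular by gluing.
  A rational function without poles on \<open>W\<close> thereby gets a representative with domain
  all of \<open>W\<close>.\<close>

lemma class_of_value:
  assumes W: "openin (zar M) W" "W \<noteq> {}" and \<xi>: "\<And>p. p \<in> W \<Longrightarrow> \<xi> \<in> local_ring M p"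
  shows "(W, \<lambda>p. rat_value p \<xi>) \<in> rat_reps M" "cls W (\<lambda>p. rat_value p \<xi>) = \<xi>"
proof -
  show r: "(W, \<lambda>p. rat_value p \<xi>) \<in> rat_reps M"
  proof -
    have "(\<lambda>p. rat_value p \<xi>) \<in> reg M W"
    proof (rule reg_local)
      fix p assume p: "p \<in> W"
      from \<xi>[OF p] obtain U f where U: "(U, f) \<in> rat_reps M" "p \<in> U" "\<xi> = cls U f"
        by (rule local_ring_cases)
      then show "\<exists>V g. openin (zar M) V \<and> p \<in> V \<and> V \<subseteq> W \<and> g \<in> reg M V \<and> (\<forall>y\<in>V. rat_value y \<xi> = g y)"
        using p W by (intro exI[of _ "U \<inter> W"] exI[of _ f])
          (auto simp: value_cls reps_iff intro: reg_restrict[of U])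
    qed
    then show ?thesis using W by (simp add: reps_iff)
  qed
  obtain p where "p \<in> W" using W by blast
  then obtain U f where U: "(U, f) \<in> rat_reps M" "p \<in> U" "\<xi> = cls U f"
    using \<xi> by (blast elim: local_ring_cases)
  show "cls W (\<lambda>p. rat_value p \<xi>) = \<xi>"
    using r U by (simp add: cls_eq_iff value_cls)
qed

lemma open_local_ring:
  assumes "\<xi> \<in> local_ring M p"
  obtains U where "openin (zar M) U" "p \<in> U" "\<And>q. q \<in> U \<Longrightarrow> \<xi> \<in> local_ring M q"
  using assms by (elim local_ring_cases) (metis local_ring_cls reps_iff)

lemma K_generic:
  assumes "\<xi> \<in> carrier K"
  obtains U where "openin (zar M) U" "U \<noteq> {}" "\<And>q. q \<in> U \<Longrightarrow> \<xi> \<in> local_ring M q"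
  using assms by (elim K_cases) (metis local_ring_cls reps_iff)

lemma K_eqI:
  assumes "openin (zar M) W" "W \<noteq> {}" "\<And>p. p \<in> W \<Longrightarrow> \<xi> \<in> local_ring M p" "\<And>p. p \<in> W \<Longrightarrow> \<eta> \<in> local_ring M p"
    "\<And>p. p \<in> W \<Longrightarrow> rat_value p \<xi> = rat_value p \<eta>"
  shows "\<xi> = \<eta>"
proof -
  have "cls W (\<lambda>p. rat_value p \<xi>) = cls W (\<lambda>p. rat_value p \<eta>)"
    using class_of_value[of W \<xi>] class_of_value[of W \<eta>] assms by (subst cls_eq_iff) auto
  then show ?thesis using class_of_value[of W \<xi>] class_of_value[of W \<eta>] assms by metis
qed

lemma value_nonzero_open:
  assumes "openin (zar M) W" "\<And>p. p \<in> W \<Longrightarrow> \<xi> \<in> local_ring M p"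
  shows "openin (zar M) {p \<in> W. rat_value p \<xi> \<noteq> 0}"
proof (cases "W = {}")
  case False
  then show ?thesis using class_of_value(1)[of W \<xi>] assms
    by (intro nonzero_open) (auto simp: reps_iff)
qed simp

end

section \<open>Varieties and projective space as spaces with functions\<close>

text \<open>In both models a regular function is one that is locally a fraction;
  \<open>Q V f\<close> says that f is a single fraction on V. The axioms need checking only for
  single fractions.\<close>

lemma fn_space_locally:
  fixes M :: "'p fspace" and Q :: "'p set \<Rightarrow> ('p \<Rightarrow> complex) \<Rightarrow> bool"
  assumes reg: "reg M = (\<lambda>U. {h. \<forall>x\<in>U. \<exists>V. x \<in> V \<and> V \<subseteq> U \<and> Q V h})"
    and op: "\<And>V f. Q V f \<Longrightarrow> openin (zar M) V"
    and cong: "\<And>V f g. Q V f \<Longrightarrow> (\<And>x. x \<in> V \<Longrightarrow> f x = g x) \<Longrightarrow> Q V g"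
    and restr: "\<And>V W f. Q V f \<Longrightarrow> openin (zar M) W \<Longrightarrow> W \<subseteq> V \<Longrightarrow> Q W f"
    and const: "\<And>V c. openin (zar M) V \<Longrightarrow> Q V (\<lambda>_. c)"
    and add: "\<And>V f g. Q V f \<Longrightarrow> Q V g \<Longrightarrow> Q V (\<lambda>x. f x + g x)"
    and mult: "\<And>V f g. Q V f \<Longrightarrow> Q V g \<Longrightarrow> Q V (\<lambda>x. f x * g x)"
    and inverse: "\<And>V f. Q V f \<Longrightarrow> (\<And>x. x \<in> V \<Longrightarrow> f x \<noteq> 0) \<Longrightarrow> Q V (\<lambda>x. inverse (f x))"
    and nonzero: "\<And>V f. Q V f \<Longrightarrow> openin (zar M) {x \<in> V. f x \<noteq> 0}"
  shows "fn_space M"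
proof
  have both: "\<exists>V. x \<in> V \<and> V \<subseteq> U \<and> Q V f \<and> Q V g" if "f \<in> reg M U" "g \<in> reg M U" "x \<in> U" for U f g x
  proof -
    from that(1,3) obtain V where V: "x \<in> V" "V \<subseteq> U" "Q V f" unfolding reg by blast
    from that(2,3) obtain W where W: "x \<in> W" "W \<subseteq> U" "Q W g" unfolding reg by blast
    have "openin (zar M) (V \<inter> W)" using op V W by blast
    then show ?thesis using V W restr[of V f "V \<inter> W"] restr[of W g "V \<inter> W"]
      by (intro exI[of _ "V \<inter> W"]) auto
  qed
  fix U V :: "'p set" and f g :: "'p \<Rightarrow> complex" and c :: complex
  show "g \<in> reg M U" if "openin (zar M) U" "f \<in> reg M U" "\<And>x. x \<in> U \<Longrightarrow> f x = g x"
    unfolding reg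
  proof safe
    fix x assume x: "x \<in> U"
    with that(2) obtain V where V: "x \<in> V" "V \<subseteq> U" "Q V f" unfolding reg by blast
    have "Q V g" using cong[OF V(3), of g] that(3) V(2) by blast
    then show "\<exists>V. x \<in> V \<and> V \<subseteq> U \<and> Q V g" using V by blast
  qed
  show "f \<in> reg M V" if "openin (zar M) U" "openin (zar M) V" "V \<subseteq> U" "f \<in> reg M U"
    unfolding reg
  proof safe
    fix x assume x: "x \<in> V"
    with that(3,4) obtain W where W: "x \<in> W" "W \<subseteq> U" "Q W f" unfolding reg by blast
    have "Q (W \<inter> V) f" using restr[OF W(3)] op[OF W(3)] that(2) by blast
    then show "\<exists>W. x \<in> W \<and> W \<subseteq> V \<and> Q W f" using W x by blast
  qed
  show "(\<lambda>_. c) \<in> reg M U" if "openin (zar M) U" unfolding reg using const[OF that] by blast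
  show "(\<lambda>x. f x + g x) \<in> reg M U" if "openin (zar M) U" "f \<in> reg M U" "g \<in> reg M U"
  proof -
    have "\<exists>V. x \<in> V \<and> V \<subseteq> U \<and> Q V (\<lambda>x. f x + g x)" if "x \<in> U" for x
      using both[OF \<open>f \<in> reg M U\<close> \<open>g \<in> reg M U\<close> that] add by meson
    then show ?thesis unfolding reg by blast
  qed
  show "(\<lambda>x. f x * g x) \<in> reg M U" if "openin (zar M) U" "f \<in> reg M U" "g \<in> reg M U"
  proof -
    have "\<exists>V. x \<in> V \<and> V \<subseteq> U \<and> Q V (\<lambda>x. f x * g x)" if "x \<in> U" for x
      using both[OF \<open>f \<in> reg M U\<close> \<open>g \<in> reg M U\<close> that] mult by meson
    then show ?thesis unfolding reg by blast
  qed
  show "(\<lambda>x. inverse (f x)) \<in> reg M U" if "openin (zar M) U" "f \<in> reg M U" "\<And>x. x \<in> U \<Longrightarrow> f x \<noteq> 0"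
    unfolding reg
  proof safe
    fix x assume x: "x \<in> U"
    with that(2) obtain W where W: "x \<in> W" "W \<subseteq> U" "Q W f" unfolding reg by blast
    have "Q W (\<lambda>x. inverse (f x))" using W that(3) by (intro inverse) auto
    then show "\<exists>W. x \<in> W \<and> W \<subseteq> U \<and> Q W (\<lambda>x. inverse (f x))" using W by blast
  qed
  show "openin (zar M) {x \<in> U. f x \<noteq> 0}" if "openin (zar M) U" "f \<in> reg M U"
  proof (subst openin_subopen, safe)
    fix x assume x: "x \<in> U" "f x \<noteq> 0"
    with that(2) obtain W where W: "x \<in> W" "W \<subseteq> U" "Q W f" unfolding reg by blast
    then show "\<exists>T. openin (zar M) T \<and> x \<in> T \<and> T \<subseteq> {x \<in> U. f x \<noteq> 0}"
      using x nonzero[OF W(3)] by (intro exI[of _ "{x \<in> W. f x \<noteq> 0}"]) auto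
  qed
next
  fix \<U> f assume a: "\<And>U. U \<in> \<U> \<Longrightarrow> openin (zar M) U \<and> f \<in> reg M U"
  show "f \<in> reg M (\<Union>\<U>)"
    unfolding reg
  proof safe
    fix x U assume "x \<in> U" "U \<in> \<U>"
    moreover from this a[of U] obtain V where "x \<in> V" "V \<subseteq> U" "Q V f" unfolding reg by blast
    ultimately show "\<exists>V. x \<in> V \<and> V \<subseteq> \<Union>\<U> \<and> Q V f" by blast
  qed
qed

section \<open>Affine models\<close>

lemma affine_polys_closed:
  "(\<lambda>_. c) \<in> affine_polys k"
  "f \<in> affine_polys k \<Longrightarrow> g \<in> affine_polys k \<Longrightarrow> (\<lambda>x. f x + g x) \<in> affine_polys k"
  "f \<in> affine_polys k \<Longrightarrow> g \<in> affine_polys k \<Longrightarrow> (\<lambda>x. f x * g x) \<in> affine_polys k"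
  by (auto simp: affine_polys_def intro: poly_funs.intros)

lemma open_affine_basic: "f \<in> affine_polys k \<Longrightarrow> openin (affine_zariski k Z) {x \<in> Z. f x \<noteq> 0}"
  unfolding affine_zariski_def by (rule topology_generated_by_Basis) blast

lemma topspace_affine_zariski: "topspace (affine_zariski k Z) = Z"
proof
  show "topspace (affine_zariski k Z) \<subseteq> Z" by (auto simp: affine_zariski_def)
  show "Z \<subseteq> topspace (affine_zariski k Z)"
    using openin_subset[OF open_affine_basic[OF affine_polys_closed(1)[of 1 k], of Z]] by simp
qed

definition affine_fraction ::
  "nat \<Rightarrow> (nat \<Rightarrow> complex) set \<Rightarrow> (nat \<Rightarrow> complex) set \<Rightarrow> ((nat \<Rightarrow> complex) \<Rightarrow> complex) \<Rightarrow> bool" where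
  "affine_fraction k Z V f \<longleftrightarrow> openin (affine_zariski k Z) V \<and>
     (\<exists>a b. a \<in> affine_polys k \<and> b \<in> affine_polys k \<and> (\<forall>y\<in>V. b y \<noteq> 0 \<and> f y = a y / b y))"

lemma zar_affine: "zar (affine_model k Z) = affine_zariski k Z"
  by (simp add: affine_model_def)

lemma fn_space_affine: "fn_space (affine_model k Z)"
proof (rule fn_space_locally[where Q = "affine_fraction k Z"])
  show "reg (affine_model k Z) = (\<lambda>U. {h. \<forall>x\<in>U. \<exists>V. x \<in> V \<and> V \<subseteq> U \<and> affine_fraction k Z V h})"
    unfolding affine_model_def affine_fraction_def fspace.select_convs
    by (intro ext Collect_cong ball_cong refl) blast
next
  fix V f g assume f: "affine_fraction k Z V f"
  then obtain a b where ab: "a \<in> affine_polys k" "b \<in> affine_polys k" "\<And>y. y \<in> V \<Longrightarrow> b y \<noteq> 0 \<and> f y = a y / b y"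
    and V: "openin (affine_zariski k Z) V"
    unfolding affine_fraction_def by blast
  show "openin (zar (affine_model k Z)) V" using V by (simp add: affine_model_def)
  show "affine_fraction k Z V g" if "\<And>x. x \<in> V \<Longrightarrow> f x = g x"
    using that ab V unfolding affine_fraction_def by metis
  show "affine_fraction k Z W f" if "openin (zar (affine_model k Z)) W" "W \<subseteq> V" for W
    using that ab unfolding affine_fraction_def affine_model_def by (auto; blast)
  show "affine_fraction k Z V (\<lambda>x. inverse (f x))" if "\<And>x. x \<in> V \<Longrightarrow> f x \<noteq> 0"
    using that ab V unfolding affine_fraction_def
    by (intro conjI exI[of _ b] exI[of _ a]) (fastforce simp: field_simps)+
  have "{x \<in> V. f x \<noteq> 0} = V \<inter> {x \<in> Z. a x \<noteq> 0}"
    using ab(3) openin_subset[OF V] by (auto simp: topspace_affine_zariski)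
  then show "openin (zar (affine_model k Z)) {x \<in> V. f x \<noteq> 0}"
    using openin_Int[OF V open_affine_basic[OF ab(1), of Z]] by (simp add: affine_model_def)
  assume "affine_fraction k Z V g"
  then obtain c d where cd: "c \<in> affine_polys k" "d \<in> affine_polys k" "\<And>y. y \<in> V \<Longrightarrow> d y \<noteq> 0 \<and> g y = c y / d y"
    unfolding affine_fraction_def by blast
  show "affine_fraction k Z V (\<lambda>x. f x + g x)" unfolding affine_fraction_def
    using ab cd V
    by (intro conjI exI[of _ "\<lambda>x. a x * d x + c x * b x"] exI[of _ "\<lambda>x. b x * d x"] affine_polys_closed)
      (auto simp: add_frac_eq)
  show "affine_fraction k Z V (\<lambda>x. f x * g x)" unfolding affine_fraction_def
    using ab cd V
    by (intro conjI exI[of _ "\<lambda>x. a x * c x"] exI[of _ "\<lambda>x. b x * d x"] affine_polys_closed) auto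
next
  fix V and c :: complex assume "openin (zar (affine_model k Z)) V"
  then show "affine_fraction k Z V (\<lambda>_. c)" unfolding affine_fraction_def
    by (intro conjI exI[of _ "\<lambda>x. c"] exI[of _ "\<lambda>x. 1"] affine_polys_closed) (auto simp: affine_model_def)
qed

section \<open>Lines, homogeneous polynomials and projective space\<close>

lemma proj_points_cases:
  assumes "L \<in> proj_points"
  obtains v where "v \<noteq> 0" "v \<in> L" "L = vec.span {v}"
  using assms vec.span_base[of _ "{_}"] unfolding proj_points_def by blast

lemma proj_point_scale:
  assumes "L \<in> proj_points" "v \<in> L" "v \<noteq> 0" "w \<in> L"
  shows "\<exists>c. w = c *s v"
proof -
  from assms(1) obtain u where u: "u \<noteq> 0" "L = vec.span {u}" by (rule proj_points_cases)
  obtain a b where ab: "v = a *s u" "w = b *s u" using assms u by (auto simp: vec.span_singleton)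
  then have "a \<noteq> 0" using assms by auto
  then have "w = (b / a) *s v" using ab by (simp add: vec_eq_iff)
  then show ?thesis by blast
qed

lemma homogeneous_polys_closed:
  "(\<lambda>_. c) \<in> homogeneous_polys 0"
  "F \<in> homogeneous_polys d \<Longrightarrow> G \<in> homogeneous_polys d \<Longrightarrow> (\<lambda>x. F x + G x) \<in> homogeneous_polys d"
  "F \<in> homogeneous_polys d \<Longrightarrow> G \<in> homogeneous_polys e \<Longrightarrow> (\<lambda>x. F x * G x) \<in> homogeneous_polys (d + e)"
  by (auto simp: homogeneous_polys_def power_add algebra_simps intro: poly_funs.intros)

lemma homogeneous_scale: "F \<in> homogeneous_polys d \<Longrightarrow> F (c *s v) = c ^ d * F v"
  by (simp add: homogeneous_polys_def)

definition proj_basic :: "(complex ^ 'm \<Rightarrow> complex) \<Rightarrow> (complex ^ 'm) set set" where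
  "proj_basic F = {L \<in> proj_points. \<exists>v\<in>L. F v \<noteq> 0}"

text \<open>Every vector of L is a multiple c v, and F (c v) = c ^ d * F v; so one nonzero vector of
  the line decides.\<close>

lemma proj_basic_iff:
  assumes "F \<in> homogeneous_polys d" "L \<in> proj_points" "v \<in> L" "v \<noteq> 0"
  shows "L \<in> proj_basic F \<longleftrightarrow> F v \<noteq> 0"
  using assms proj_point_scale[OF assms(2-4)] homogeneous_scale[OF assms(1)]
  unfolding proj_basic_def by force

lemma open_proj_basic: "F \<in> homogeneous_polys d \<Longrightarrow> openin proj_zariski (proj_basic F)"
  unfolding proj_zariski_def proj_basic_def by (rule topology_generated_by_Basis) blast

lemma topspace_proj_zariski: "topspace proj_zariski = proj_points"
proof
  show "topspace (proj_zariski :: (complex ^ 'm) set topology) \<subseteq> proj_points"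
    by (auto simp: proj_zariski_def)
  have "openin proj_zariski (proj_basic (\<lambda>_ :: complex ^ 'm. 1))"
    by (rule open_proj_basic[OF homogeneous_polys_closed(1)])
  moreover have "proj_basic (\<lambda>_ :: complex ^ 'm. 1) = proj_points"
    by (auto simp: proj_basic_def proj_points_def intro: vec.span_zero)
  ultimately show "proj_points \<subseteq> topspace (proj_zariski :: (complex ^ 'm) set topology)"
    using openin_subset by metis
qed

definition proj_fraction :: "(complex ^ 'm) set set \<Rightarrow> ((complex ^ 'm) set \<Rightarrow> complex) \<Rightarrow> bool" where
  "proj_fraction V h \<longleftrightarrow> openin proj_zariski V \<and> (\<exists>d F G. F \<in> homogeneous_polys d \<and> G \<in> homogeneous_polys d \<and>
       (\<forall>L'\<in>V. \<forall>v\<in>L' - {0}. G v \<noteq> 0 \<and> h L' = F v / G v))"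

lemma proj_fractionI:
  assumes "openin proj_zariski V" "F \<in> homogeneous_polys d" "G \<in> homogeneous_polys d"
    "\<And>L v. L \<in> V \<Longrightarrow> v \<in> L - {0} \<Longrightarrow> G v \<noteq> 0" "\<And>L v. L \<in> V \<Longrightarrow> v \<in> L - {0} \<Longrightarrow> h L = F v / G v"
  shows "proj_fraction V h"
  using assms unfolding proj_fraction_def by blast

lemma reg_CP: "reg CP = (\<lambda>U. {h. \<forall>x\<in>U. \<exists>V. x \<in> V \<and> V \<subseteq> U \<and> proj_fraction V h})"
  unfolding CP_def proj_fraction_def fspace.select_convs
  by (intro ext Collect_cong ball_cong refl) blast

lemma zar_CP: "zar CP = proj_zariski"
  by (simp add: CP_def)

lemma fn_space_CP: "fn_space (CP :: (complex ^ 'm) set fspace)"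
proof (rule fn_space_locally[where Q = proj_fraction, OF reg_CP])
  fix V :: "(complex ^ 'm) set set" and f g assume f: "proj_fraction V f"
  then obtain m a b where ab: "a \<in> homogeneous_polys m" "b \<in> homogeneous_polys m"
      "\<And>L v. L \<in> V \<Longrightarrow> v \<in> L \<Longrightarrow> v \<noteq> 0 \<Longrightarrow> b v \<noteq> 0 \<and> f L = a v / b v"
    and V: "openin proj_zariski V"
    unfolding proj_fraction_def by (metis DiffI singletonD)
  have Vp: "L \<in> proj_points" if "L \<in> V" for L
    using that openin_subset[OF V] topspace_proj_zariski by blast
  show "openin (zar CP) V" using V by (simp add: zar_CP)
  show "proj_fraction V g" if "\<And>x. x \<in> V \<Longrightarrow> f x = g x"
    using that ab V unfolding proj_fraction_def by (metis DiffE insertI1)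
  show "proj_fraction W f" if "openin (zar CP) W" "W \<subseteq> V" for W
    using that ab unfolding proj_fraction_def zar_CP
    by (intro conjI exI[of _ m] exI[of _ a] exI[of _ b]) auto
  show "proj_fraction V (\<lambda>x. inverse (f x))" if nz: "\<And>x. x \<in> V \<Longrightarrow> f x \<noteq> 0"

  proof (rule proj_fractionI[OF V ab(2,1)])
    fix L v assume "L \<in> V" "v \<in> L - {0}"
    then show "a v \<noteq> 0" "inverse (f L) = b v / a v"
      using ab(3)[of L v] nz[of L] by auto
  qed
  have "{x \<in> V. f x \<noteq> 0} = V \<inter> proj_basic a"
  proof safe
    fix L assume L: "L \<in> V"
    obtain v where v: "v \<in> L" "v \<noteq> 0" using Vp[OF L] by (blast elim: proj_points_cases)
    note iff = proj_basic_iff[OF ab(1) Vp[OF L] v]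
    show "L \<in> proj_basic a" if "f L \<noteq> 0" using that ab(3)[OF L v] iff by auto
    show False if "f L = 0" "L \<in> proj_basic a" using that ab(3)[OF L v] iff by auto
  qed
  then show "openin (zar CP) {x \<in> V. f x \<noteq> 0}"
    using openin_Int[OF V open_proj_basic[OF ab(1)]] by (simp add: zar_CP)
  assume "proj_fraction V g"
  then obtain n c d where cd: "c \<in> homogeneous_polys n" "d \<in> homogeneous_polys n"
      "\<And>L v. L \<in> V \<Longrightarrow> v \<in> L \<Longrightarrow> v \<noteq> 0 \<Longrightarrow> d v \<noteq> 0 \<and> g L = c v / d v"
    unfolding proj_fraction_def by (metis DiffI singletonD)
  show "proj_fraction V (\<lambda>x. f x + g x)"
  proof (rule proj_fractionI[OF V, of "\<lambda>x. a x * d x + b x * c x" "m + n" "\<lambda>x. b x * d x"];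
      (intro homogeneous_polys_closed ab cd)?)
    fix L v assume "L \<in> V" "v \<in> L - {0}"
    then show "b v * d v \<noteq> 0" "f L + g L = (a v * d v + b v * c v) / (b v * d v)"
      using ab(3)[of L v] cd(3)[of L v] by (auto simp: add_frac_eq mult.commute)
  qed
  show "proj_fraction V (\<lambda>x. f x * g x)"
  proof (rule proj_fractionI[OF V, of "\<lambda>x. a x * c x" "m + n" "\<lambda>x. b x * d x"];
      (intro homogeneous_polys_closed ab cd)?)
    fix L v assume "L \<in> V" "v \<in> L - {0}"
    then show "b v * d v \<noteq> 0" "f L * g L = (a v * c v) / (b v * d v)"
      using ab(3)[of L v] cd(3)[of L v] by auto
  qed
next
  fix V :: "(complex ^ 'm) set set" and c :: complex assume "openin (zar CP) V"
  then show "proj_fraction V (\<lambda>_. c)" unfolding proj_fraction_def zar_CP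
    by (intro conjI exI[of _ "\<lambda>x. c"] exI[of _ "\<lambda>x. 1"] exI[of _ 0] homogeneous_polys_closed) auto
qed

section \<open>Transport of regular functions through an affine chart\<close>

locale chart =
  fixes M :: "'p fspace" and U :: "'p set" and k :: nat and Z :: "(nat \<Rightarrow> complex) set" and \<phi> \<psi>
  assumes sheaf: "function_sheaf M" and open_U: "openin (zar M) U"
    and mor_\<phi>: "morphism (open_subspace M U) (affine_model k Z) \<phi>"
    and mor_\<psi>: "morphism (affine_model k Z) (open_subspace M U) \<psi>"
    and \<psi>_\<phi>: "x \<in> points (open_subspace M U) \<Longrightarrow> \<psi> (\<phi> x) = x"
begin

interpretation aff: fn_space "affine_model k Z" by (rule fn_space_affine)

lemma points_sub: "points (open_subspace M U) = U"
  using openin_subset[OF open_U] by (auto simp: points_def open_subspace_def)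

lemma points_aff: "points (affine_model k Z) = Z"
  by (simp add: points_def affine_model_def topspace_affine_zariski)

lemma open_pre_\<phi>: "openin (affine_zariski k Z) V \<Longrightarrow> openin (zar M) (U \<inter> \<phi> -` V)"
proof -
  assume V: "openin (affine_zariski k Z) V"
  have "openin (subtopology (zar M) U) {x \<in> topspace (subtopology (zar M) U). \<phi> x \<in> V}"
    using mor_\<phi> V unfolding morphism_def
    by (intro openin_continuous_map_preimage[of _ "affine_zariski k Z"]) (auto simp: open_subspace_def affine_model_def)
  moreover have "{x \<in> topspace (subtopology (zar M) U). \<phi> x \<in> V} = U \<inter> \<phi> -` V"
    using openin_subset[OF open_U] by auto
  ultimately show ?thesis using open_U openin_trans_full by metis
qed

lemma open_pre_\<psi>:
  assumes "openin (zar M) W" "W \<subseteq> U"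
  shows "openin (affine_zariski k Z) (Z \<inter> \<psi> -` W)"
proof -
  have "openin (affine_zariski k Z) {x \<in> topspace (affine_zariski k Z). \<psi> x \<in> W}"
    using mor_\<psi> assms open_U unfolding morphism_def
    by (intro openin_continuous_map_preimage[of _ "subtopology (zar M) U"])
      (auto simp: open_subspace_def affine_model_def openin_open_subtopology)
  then show ?thesis by (simp add: topspace_affine_zariski Collect_conj_eq vimage_def)
qed

lemma \<phi>_in: "x \<in> U \<Longrightarrow> \<phi> x \<in> Z"
  using mor_\<phi> points_sub points_aff unfolding morphism_def continuous_map_def points_def
  by blast

lemma pre_pre:
  assumes "W \<subseteq> U"
  shows "U \<inter> \<phi> -` (Z \<inter> \<psi> -` W) = W"
  using assms \<psi>_\<phi> \<phi>_in by (auto simp: points_sub)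

lemma reg_to_aff:
  assumes "openin (zar M) W" "W \<subseteq> U" "f \<in> reg M W"
  shows "f \<circ> \<psi> \<in> reg (affine_model k Z) (Z \<inter> \<psi> -` W)"
  using mor_\<psi> assms open_U points_aff unfolding morphism_def
  by (auto simp: open_subspace_def openin_open_subtopology)

lemma reg_from_aff:
  assumes "openin (zar M) W" "W \<subseteq> U" "g \<in> reg (affine_model k Z) (Z \<inter> \<psi> -` W)"
  shows "g \<circ> \<phi> \<in> reg M W"
proof -
  have "g \<circ> \<phi> \<in> reg (open_subspace M U) (points (open_subspace M U) \<inter> \<phi> -` (Z \<inter> \<psi> -` W))"
    using mor_\<phi> assms(3) open_pre_\<psi>[OF assms(1,2)] unfolding morphism_def zar_affine by blast
  then show ?thesis unfolding points_sub pre_pre[OF assms(2)] by (simp add: open_subspace_def)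
qed

lemma reg_transfer:
  assumes "openin (zar M) W" "W \<subseteq> U" "g \<in> reg (affine_model k Z) (Z \<inter> \<psi> -` W)"
    and "\<And>x. x \<in> W \<Longrightarrow> g (\<phi> x) = f x"
  shows "f \<in> reg M W"
  using reg_from_aff[OF assms(1-3)] sheaf assms(1,4) unfolding function_sheaf_def
  by (metis comp_apply)

lemma reg_chart_const: "openin (zar M) W \<Longrightarrow> W \<subseteq> U \<Longrightarrow> (\<lambda>_. c) \<in> reg M W"
  using aff.reg_const open_pre_\<psi> by (intro reg_transfer[of W "\<lambda>_. c"]) (auto simp: zar_affine)

lemma
  assumes W: "openin (zar M) W" "W \<subseteq> U" and f: "f \<in> reg M W"
  shows reg_chart_add: "g \<in> reg M W \<Longrightarrow> (\<lambda>x. f x + g x) \<in> reg M W"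
    and reg_chart_mult: "g \<in> reg M W \<Longrightarrow> (\<lambda>x. f x * g x) \<in> reg M W"
    and reg_chart_inverse: "(\<And>x. x \<in> W \<Longrightarrow> f x \<noteq> 0) \<Longrightarrow> (\<lambda>x. inverse (f x)) \<in> reg M W"
    and nonzero_chart_open: "openin (zar M) {x \<in> W. f x \<noteq> 0}"
proof -
  have o: "openin (zar (affine_model k Z)) (Z \<inter> \<psi> -` W)"
    using open_pre_\<psi>[OF W] by (simp add: affine_model_def)
  have id: "\<psi> (\<phi> x) = x" if "x \<in> W" for x using that W \<psi>_\<phi> points_sub by blast
  note f' = reg_to_aff[OF W f]
  show "(\<lambda>x. f x + g x) \<in> reg M W" if "g \<in> reg M W"
    using aff.reg_add[OF o f' reg_to_aff[OF W that]] by (rule reg_transfer[OF W]) (simp add: id)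
  show "(\<lambda>x. f x * g x) \<in> reg M W" if "g \<in> reg M W"
    using aff.reg_mult[OF o f' reg_to_aff[OF W that]] by (rule reg_transfer[OF W]) (simp add: id)
  show "(\<lambda>x. inverse (f x)) \<in> reg M W" if "\<And>x. x \<in> W \<Longrightarrow> f x \<noteq> 0"
  proof -
    have "(\<lambda>x. inverse ((f \<circ> \<psi>) x)) \<in> reg (affine_model k Z) (Z \<inter> \<psi> -` W)"
      using that by (intro aff.reg_inverse[OF o f']) auto
    then show ?thesis by (rule reg_transfer[OF W]) (simp add: id)
  qed
  have "openin (affine_zariski k Z) {x \<in> Z \<inter> \<psi> -` W. (f \<circ> \<psi>) x \<noteq> 0}"
    using aff.nonzero_open[OF o f'] by (simp add: affine_model_def)
  from open_pre_\<phi>[OF this] show "openin (zar M) {x \<in> W. f x \<noteq> 0}"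
  proof (rule back_subst[of "openin (zar M)"])
    show "U \<inter> \<phi> -` {x \<in> Z \<inter> \<psi> -` W. (f \<circ> \<psi>) x \<noteq> 0} = {x \<in> W. f x \<noteq> 0}"
      using W id \<phi>_in \<psi>_\<phi> by (auto simp: points_sub)
  qed
qed

lemma reg_poly:
  assumes "a \<in> affine_polys k"
  shows "(\<lambda>x. a (\<phi> x)) \<in> reg M U"
proof -
  have "a \<in> reg (affine_model k Z) (Z \<inter> \<psi> -` U)"
    using open_pre_\<psi>[OF open_U subset_refl] assms affine_polys_closed(1)[of 1 k]
    unfolding affine_model_def by fastforce
  from reg_transfer[OF open_U subset_refl this] show ?thesis by simp
qed

lemma reg_fraction:
  assumes "openin (zar M) W" "W \<subseteq> U" "f \<in> reg M W" "p \<in> W"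
  obtains V a b where "openin (zar M) V" "p \<in> V" "V \<subseteq> W" "a \<in> affine_polys k" "b \<in> affine_polys k"
    "\<And>x. x \<in> V \<Longrightarrow> b (\<phi> x) \<noteq> 0 \<and> f x = a (\<phi> x) / b (\<phi> x)"
proof -
  have p: "\<phi> p \<in> Z \<inter> \<psi> -` W" using assms \<phi>_in \<psi>_\<phi> points_sub by auto
  have "\<forall>y\<in>Z \<inter> \<psi> -` W. \<exists>V a b. openin (affine_zariski k Z) V \<and> y \<in> V \<and> V \<subseteq> Z \<inter> \<psi> -` W \<and>
       a \<in> affine_polys k \<and> b \<in> affine_polys k \<and> (\<forall>y\<in>V. b y \<noteq> 0 \<and> (f \<circ> \<psi>) y = a y / b y)"
    using reg_to_aff[OF assms(1-3)] by (simp add: affine_model_def)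
  from bspec[OF this p] obtain V a b where V: "openin (affine_zariski k Z) V" "\<phi> p \<in> V" "V \<subseteq> Z \<inter> \<psi> -` W"
    and ab: "a \<in> affine_polys k" "b \<in> affine_polys k" "\<forall>y\<in>V. b y \<noteq> 0 \<and> (f \<circ> \<psi>) y = a y / b y" by blast
  show ?thesis
  proof (rule that[of "U \<inter> \<phi> -` V" a b])
    show "openin (zar M) (U \<inter> \<phi> -` V)" by (rule open_pre_\<phi>[OF V(1)])
    show "p \<in> U \<inter> \<phi> -` V" using assms V by auto
    show "U \<inter> \<phi> -` V \<subseteq> W" using V(3) pre_pre[OF assms(2)] by blast
    show "b (\<phi> x) \<noteq> 0 \<and> f x = a (\<phi> x) / b (\<phi> x)" if "x \<in> U \<inter> \<phi> -` V" for x
      using that ab(3) \<psi>_\<phi> points_sub by force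
  qed (use ab in auto)
qed

end

lemma prevariety_charts:
  assumes "prevariety M" "x \<in> points M"
  obtains U k Z \<phi> \<psi> where "x \<in> U" "chart M U k Z \<phi> \<psi>"
proof -
  from assms obtain U k Z where "x \<in> U" "openin (zar M) U"
      "isomorphic_fspaces (open_subspace M U) (affine_model k Z)" "function_sheaf M"
    unfolding prevariety_def by blast
  then show ?thesis unfolding isomorphic_fspaces_def
    by (elim exE conjE) (rule that, auto simp: chart_def)
qed

lemma fn_space_prevariety:
  assumes M: "prevariety M"
  shows "fn_space M"
proof -
  have sheaf: "function_sheaf M" using M by (simp add: prevariety_def)
  \<comment> \<open>Open sets contained in a chart form a base of the topology. The ring operations
    are checked there, where the affine model is available, and glued.\<close>
  define small where "small V \<longleftrightarrow> openin (zar M) V \<and> (\<exists>U k Z \<phi> \<psi>. V \<subseteq> U \<and> chart M U k Z \<phi> \<psi>)" for V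
  have sh3: "f \<in> reg M (\<Union>\<U>)" if "\<And>U. U \<in> \<U> \<Longrightarrow> openin (zar M) U \<and> f \<in> reg M U" for \<U> f
    using sheaf that unfolding function_sheaf_def by meson
  have rs: "f \<in> reg M V" if "openin (zar M) U" "openin (zar M) V" "V \<subseteq> U" "f \<in> reg M U" for U V f
    using sheaf that unfolding function_sheaf_def by blast
  have loc: "\<exists>V. small V \<and> x \<in> V \<and> V \<subseteq> U" if U: "openin (zar M) U" "x \<in> U" for U x
  proof -
    have "x \<in> points M" using openin_subset[OF U(1)] U(2) by (auto simp: points_def)
    from prevariety_charts[OF M this] obtain V k Z \<phi> \<psi> where V: "x \<in> V" "chart M V k Z \<phi> \<psi>" .
    then have "small (U \<inter> V)" using U chart.open_U by (fastforce simp: small_def)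
    then show ?thesis using U V by blast
  qed
  have cover: "\<Union>{V. small V \<and> V \<subseteq> U} = U" if "openin (zar M) U" for U
    using loc[OF that] by blast
  have glue: "f \<in> reg M U" if "openin (zar M) U" "\<And>V. small V \<Longrightarrow> V \<subseteq> U \<Longrightarrow> f \<in> reg M V" for U f
  proof -
    have "f \<in> reg M (\<Union>{V. small V \<and> V \<subseteq> U})"
      by (rule sh3) (use that(2) in \<open>auto simp: small_def\<close>)
    then show ?thesis using cover[OF that(1)] by simp
  qed
  show ?thesis
  proof
    show "g \<in> reg M U" if "openin (zar M) U" "f \<in> reg M U" "\<And>x. x \<in> U \<Longrightarrow> f x = g x" for U f g
      using sheaf[unfolded function_sheaf_def, THEN conjunct1] that by meson
    show "f \<in> reg M V" if "openin (zar M) U" "openin (zar M) V" "V \<subseteq> U" "f \<in> reg M U" for U V f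
      using rs that by blast
    show "f \<in> reg M (\<Union>\<U>)" if "\<And>U. U \<in> \<U> \<Longrightarrow> openin (zar M) U \<and> f \<in> reg M U" for \<U> f
      using that by (rule sh3)
    fix U assume U: "openin (zar M) U"
    show "(\<lambda>_. c) \<in> reg M U" for c
      by (rule glue[OF U]) (auto simp: small_def intro: chart.reg_chart_const)
    fix f assume f: "f \<in> reg M U"
    have fV: "f \<in> reg M V" if "small V" "V \<subseteq> U" for V using rs[OF U _ that(2) f] that by (auto simp: small_def)
    show "(\<lambda>x. inverse (f x)) \<in> reg M U" if "\<And>x. x \<in> U \<Longrightarrow> f x \<noteq> 0"
    proof (rule glue[OF U])
      fix V assume V: "small V" "V \<subseteq> U"
      then show "(\<lambda>x. inverse (f x)) \<in> reg M V" using fV[OF V] that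
        unfolding small_def by (blast intro: chart.reg_chart_inverse)
    qed
    show "openin (zar M) {x \<in> U. f x \<noteq> 0}"
    proof (subst openin_subopen, safe)
      fix x assume x: "x \<in> U" "f x \<noteq> 0"
      obtain V where V: "small V" "x \<in> V" "V \<subseteq> U" using loc[OF U x(1)] by blast
      then have "openin (zar M) {x \<in> V. f x \<noteq> 0}" using fV[OF V(1,3)]
        unfolding small_def by (blast intro: chart.nonzero_chart_open)
      then show "\<exists>T. openin (zar M) T \<and> x \<in> T \<and> T \<subseteq> {x \<in> U. f x \<noteq> 0}" using x V by blast
    qed
    fix g assume g: "g \<in> reg M U"
    have gV: "g \<in> reg M V" if "small V" "V \<subseteq> U" for V using rs[OF U _ that(2) g] that by (auto simp: small_def)
    show "(\<lambda>x. f x + g x) \<in> reg M U"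
    proof (rule glue[OF U])
      fix V assume V: "small V" "V \<subseteq> U"
      then show "(\<lambda>x. f x + g x) \<in> reg M V" using fV[OF V] gV[OF V]
        unfolding small_def by (blast intro: chart.reg_chart_add)
    qed
    show "(\<lambda>x. f x * g x) \<in> reg M U"
    proof (rule glue[OF U])
      fix V assume V: "small V" "V \<subseteq> U"
      then show "(\<lambda>x. f x * g x) \<in> reg M V" using fV[OF V] gV[OF V]
        unfolding small_def by (blast intro: chart.reg_chart_mult)
    qed
  qed
qed

lemma rat_space_variety:
  assumes "irreducible_variety M"
  shows "rat_space M"
proof -
  have M: "prevariety M" and irr: "irreducible_in (zar M) (points M)"
    using assms by (auto simp: irreducible_variety_def)
  interpret fn_space M by (rule fn_space_prevariety[OF M])
  show ?thesis
  proof
    show "points M \<noteq> {}" using irr by (simp add: irreducible_in_def)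
    fix U V assume UV: "openin (zar M) U" "openin (zar M) V" "U \<noteq> {}" "V \<noteq> {}"
    show "U \<inter> V \<noteq> {}"
    proof
      assume "U \<inter> V = {}"
      then have "points M \<subseteq> (points M - U) \<union> (points M - V)" by blast
      moreover have "closedin (zar M) (points M - U)" "closedin (zar M) (points M - V)"
        using UV by (auto simp: points_def intro: closedin_diff)
      ultimately have "points M \<subseteq> points M - U \<or> points M \<subseteq> points M - V"
        using irr unfolding irreducible_in_def by blast
      then show False using UV open_sub_points by blast
    qed
  qed
qed

section \<open>Rational vector fields\<close>

context rat_space
begin

lemma
  assumes "X \<in> rat_vector_fields M"
  shows vf_closed: "\<xi> \<in> carrier K \<Longrightarrow> X \<xi> \<in> carrier K"
    and vf_const: "X (rat_const M c) = rat_const M 0"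
    and vf_add: "\<xi> \<in> carrier K \<Longrightarrow> \<eta> \<in> carrier K \<Longrightarrow> X (\<xi> \<oplus>\<^bsub>K\<^esub> \<eta>) = X \<xi> \<oplus>\<^bsub>K\<^esub> X \<eta>"
    and vf_mult: "\<xi> \<in> carrier K \<Longrightarrow> \<eta> \<in> carrier K \<Longrightarrow>
       X (\<xi> \<otimes>\<^bsub>K\<^esub> \<eta>) = (\<xi> \<otimes>\<^bsub>K\<^esub> X \<eta>) \<oplus>\<^bsub>K\<^esub> (\<eta> \<otimes>\<^bsub>K\<^esub> X \<xi>)"
  using assms unfolding rat_vector_fields_def Let_def K_zero by auto

lemma vf_mult_const:
  assumes X: "X \<in> rat_vector_fields M" and \<xi>: "\<xi> \<in> carrier K"
  shows "X (rat_const M c \<otimes>\<^bsub>K\<^esub> \<xi>) = rat_const M c \<otimes>\<^bsub>K\<^esub> X \<xi>"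
  using vf_mult[OF X const_in_K \<xi>] vf_const[OF X] vf_closed[OF X \<xi>] \<xi> const_in_K
  by (simp flip: K_zero)

lemma open_INT_nonempty:
  assumes "finite I" "openin (zar M) U" "U \<noteq> {}" "\<And>i. i \<in> I \<Longrightarrow> openin (zar M) (V i) \<and> V i \<noteq> {}"
  shows "openin (zar M) (U \<inter> (\<Inter>i\<in>I. V i)) \<and> U \<inter> (\<Inter>i\<in>I. V i) \<noteq> {}"
  using assms(1,4)
proof induction
  case empty
  then show ?case using assms by simp
next
  case (insert i I)
  have "U \<inter> (\<Inter>i\<in>insert i I. V i) = V i \<inter> (U \<inter> (\<Inter>i\<in>I. V i))" by auto
  then show ?case using insert irreducible[of "V i" "U \<inter> (\<Inter>i\<in>I. V i)"] by auto
qed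

lemma vf_eqI:
  assumes X: "X \<in> rat_vector_fields M" "Y \<in> rat_vector_fields M"
    and W: "openin (zar M) W" "W \<noteq> {}"
    and reg: "\<And>p \<xi>. p \<in> W \<Longrightarrow> \<xi> \<in> local_ring M p \<Longrightarrow>
      X \<xi> \<in> local_ring M p \<and> Y \<xi> \<in> local_ring M p \<and> rat_value p (X \<xi>) = rat_value p (Y \<xi>)"
  shows "X = Y"
proof
  fix \<xi> show "X \<xi> = Y \<xi>"
  proof (cases "\<xi> \<in> carrier K")
    case True
    then obtain U where U: "openin (zar M) U" "U \<noteq> {}" "\<And>q. q \<in> U \<Longrightarrow> \<xi> \<in> local_ring M q"
      by (rule K_generic) blast
    show ?thesis
      by (rule K_eqI[of "U \<inter> W"]) (use U W reg irreducible[of U W] in auto)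
  next
    case False
    \<comment> \<open>Outside the carrier both fields are \<open>undefined\<close>, by the
      extensional function space in \<open>rat_vector_fields\<close>.\<close>
    then show ?thesis using X by (auto simp: rat_vector_fields_def Let_def PiE_def extensional_def)
  qed
qed

text \<open>Only the finitely many images of the affine coordinates under X matter: on their common
  domain of regularity the Leibniz rule covers polynomials, and the quotient rule covers the
  fractions that make up the local rings.\<close>

lemma regular_generically:
  assumes X: "X \<in> rat_vector_fields M" and ch: "chart M U k Z \<phi> \<psi>" and U: "U \<noteq> {}"
  obtains W where "openin (zar M) W" "W \<noteq> {}" "\<And>p. p \<in> W \<Longrightarrow> regular_at M p X"
proof -
  interpret chart M U k Z \<phi> \<psi> by (rule ch)
  define P where "P a = cls U (\<lambda>q. a (\<phi> q))" for a
  have rP: "(U, \<lambda>q. a (\<phi> q)) \<in> rat_reps M" if "a \<in> affine_polys k" for a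
    using open_U U reg_poly[OF that] by (simp add: reps_iff)
  define x where "x i = P (\<lambda>y. y i)" for i :: nat
  have coord: "(\<lambda>y. y i) \<in> affine_polys k" if "i < k" for i
    using that unfolding affine_polys_def by (intro poly_funs.gen) blast
  have "\<exists>V. openin (zar M) V \<and> V \<noteq> {} \<and> (\<forall>q\<in>V. X (x i) \<in> local_ring M q)" if "i < k" for i
  proof -
    have "X (x i) \<in> carrier K" unfolding x_def P_def
      by (intro vf_closed[OF X] cls_in_K rP coord that)
    then show ?thesis by (rule K_generic) blast
  qed
  then obtain V where V: "\<And>i. i < k \<Longrightarrow> openin (zar M) (V i) \<and> V i \<noteq> {}"
     "\<And>i q. i < k \<Longrightarrow> q \<in> V i \<Longrightarrow> X (x i) \<in> local_ring M q" by metis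
  define W where "W = U \<inter> (\<Inter>i\<in>{..<k}. V i)"
  have W: "openin (zar M) W" "W \<noteq> {}"
    using open_INT_nonempty[OF _ open_U U, of "{..<k}" V] V(1) by (auto simp: W_def)
  have XP: "X (P a) \<in> local_ring M p" if p: "p \<in> W" and a: "a \<in> affine_polys k" for a p
  proof -
    have pM: "p \<in> points M" using p W open_sub_points by blast
    have pU: "p \<in> U" using p by (simp add: W_def)
    have a': "a \<in> poly_funs {(\<lambda>x. x i) | i. i < k}" using a by (simp add: affine_polys_def)
    then show ?thesis
    proof induction
      case (gen f)
      then show ?case using p V(2) by (auto simp: W_def x_def)
    next
      case (const c)
      have "P (\<lambda>_. c) = rat_const M c" unfolding P_def rat_const_def
        by (intro cls_restrict reps_const open_U U open_sub_points)
      then show ?case by (simp add: vf_const[OF X] local_ring_const pM)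
    next
      case (add f g)
      then have fg: "f \<in> affine_polys k" "g \<in> affine_polys k" by (auto simp: affine_polys_def)
      have "P (\<lambda>x. f x + g x) = P f \<oplus>\<^bsub>K\<^esub> P g" unfolding P_def by (subst K_add) (auto intro: rP fg)
      then show ?case using add.IH by (simp add: vf_add[OF X] P_def cls_in_K rP fg local_ring_add)
    next
      case (mult f g)
      then have fg: "f \<in> affine_polys k" "g \<in> affine_polys k" by (auto simp: affine_polys_def)
      have "P (\<lambda>x. f x * g x) = P f \<otimes>\<^bsub>K\<^esub> P g" unfolding P_def by (subst K_mult) (auto intro: rP fg)
      moreover have "P f \<in> local_ring M p" "P g \<in> local_ring M p"
        unfolding P_def by (auto intro!: local_ring_cls rP fg pU)
      ultimately show ?case using mult.IH
        by (simp add: vf_mult[OF X] local_ring_carrier local_ring_add local_ring_mult)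
    qed
  qed
  show ?thesis
  proof (rule that[OF W])
    fix p assume p: "p \<in> W"
    then have pU: "p \<in> U" by (simp add: W_def)
    show "regular_at M p X" unfolding regular_at_def
    proof safe
      fix \<xi> assume \<xi>: "\<xi> \<in> local_ring M p"
      then obtain V0 f where V0: "(V0, f) \<in> rat_reps M" "p \<in> V0" "\<xi> = cls V0 f" by (rule local_ring_cases)
      have "(V0 \<inter> U, f) \<in> rat_reps M"
        using reps_restrict[OF V0(1), of "V0 \<inter> U"] open_U V0 pU by (auto simp: reps_iff)
      then obtain V1 a b where V1: "openin (zar M) V1" "p \<in> V1" "V1 \<subseteq> V0 \<inter> U" and
          ab: "a \<in> affine_polys k" "b \<in> affine_polys k" "\<And>x. x \<in> V1 \<Longrightarrow> b (\<phi> x) \<noteq> 0 \<and> f x = a (\<phi> x) / b (\<phi> x)"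
        using reg_fraction[of "V0 \<inter> U" f p] V0 pU by (auto simp: reps_iff)
      have r1: "(V1, \<lambda>q. b (\<phi> q)) \<in> rat_reps M" using reps_restrict[OF rP[OF ab(2)] V1(1)] V1 by auto
      have ri: "(V1, \<lambda>q. inverse (b (\<phi> q))) \<in> rat_reps M"
        using r1 ab(3) unfolding reps_iff by (auto intro: reg_inverse)
      \<comment> \<open>\<open>\<beta>\<close> is the inverse of the denominator in the local ring.
        Applying X to \<xi> * P b = P a and solving for X \<xi> gives \<beta> (X (P a) - \<xi> X (P
        b)), which is visibly regular at p.\<close>
      define \<beta> where "\<beta> = cls V1 (\<lambda>q. inverse (b (\<phi> q)))"
      have \<beta>: "\<beta> \<in> local_ring M p" unfolding \<beta>_def by (rule local_ring_cls[OF ri V1(2)])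
      have Pb: "P b \<in> local_ring M p" unfolding P_def by (rule local_ring_cls[OF rP[OF ab(2)] pU])
      have \<beta>b: "\<beta> \<otimes>\<^bsub>K\<^esub> P b = \<one>\<^bsub>K\<^esub>"
        unfolding \<beta>_def P_def K_one rat_const_def K_mult[OF ri rP[OF ab(2)]]
        by (intro cls_eqI reps_mult ri rP ab reps_const) (use ab(3) in auto)
      have fb: "\<xi> \<otimes>\<^bsub>K\<^esub> P b = P a"
      proof -
        have V1r: "(V1, f) \<in> rat_reps M" using reps_restrict[OF V0(1) V1(1)] V1 by auto
        have "\<xi> = cls V1 f" unfolding V0 using cls_restrict[OF V0(1) V1(1)] V1 by auto
        then show ?thesis unfolding P_def
          by (simp add: K_mult[OF V1r rP[OF ab(2)]])
             (intro cls_eqI reps_mult V1r rP ab, use ab(3) in auto)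
      qed
      have c: "\<xi> \<in> carrier K" "P b \<in> carrier K" "\<beta> \<in> carrier K" "X \<xi> \<in> carrier K" "X (P b) \<in> carrier K"
        using \<xi> Pb \<beta> vf_closed[OF X] local_ring_carrier by auto
      have e: "X (P a) = \<xi> \<otimes>\<^bsub>K\<^esub> X (P b) \<oplus>\<^bsub>K\<^esub> P b \<otimes>\<^bsub>K\<^esub> X \<xi>"
        using vf_mult[OF X c(1,2)] fb by simp
      have "X (P a) \<ominus>\<^bsub>K\<^esub> \<xi> \<otimes>\<^bsub>K\<^esub> X (P b) = P b \<otimes>\<^bsub>K\<^esub> X \<xi>"
        unfolding e a_minus_def using c
        by (simp add: K.a_comm[of "\<xi> \<otimes>\<^bsub>K\<^esub> X (P b)"] K.a_assoc K.r_neg)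
      then have "\<beta> \<otimes>\<^bsub>K\<^esub> (X (P a) \<ominus>\<^bsub>K\<^esub> \<xi> \<otimes>\<^bsub>K\<^esub> X (P b)) = X \<xi>"
        using c \<beta>b by (simp flip: K.m_assoc)
      moreover have "\<beta> \<otimes>\<^bsub>K\<^esub> (X (P a) \<ominus>\<^bsub>K\<^esub> \<xi> \<otimes>\<^bsub>K\<^esub> X (P b)) \<in> local_ring M p"
        by (intro local_ring_mult local_ring_minus \<beta> \<xi> XP p ab)
      ultimately show "X \<xi> \<in> local_ring M p" by simp
    qed
  qed
qed

end

section \<open>Actions of \<open>\<gg>\<ll>\<close> by vector fields of small generic rank\<close>

definition matrix_unit :: "'m \<Rightarrow> 'm \<Rightarrow> complex ^ 'm ^ 'm" where
  "matrix_unit i j = outer (axis i 1) (axis j 1)"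

lemma trace_matrix_unit: "trace (matrix_unit j i ** B) = B $ i $ j"
  by (simp add: matrix_unit_def outer_matrix_mult trace_outer axis_vector_matrix)
     (metis cdot_axis cdot_commute axis_vector_matrix)

lemma matrix_diff_rdistrib: "(A - B) ** C = A ** C - B ** (C :: complex ^ 'm ^ 'm)"
  by (simp add: vec_eq_iff matrix_matrix_mult_def left_diff_distrib sum_subtractf)

lemma matrix_expand: "A = (\<Sum>i\<in>UNIV. \<Sum>j\<in>UNIV. matrix_scale (A $ i $ j) (matrix_unit i j))"
proof -
  have "(\<Sum>i\<in>UNIV. \<Sum>j\<in>UNIV. A $ i $ j * (axis i 1 $ a * axis j 1 $ b)) = A $ a $ b" for a b
  proof -
    have "(\<Sum>i\<in>UNIV. \<Sum>j\<in>UNIV. A $ i $ j * (axis i 1 $ a * axis j 1 $ b))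
       = (\<Sum>i\<in>UNIV. \<Sum>j\<in>UNIV. if j = b then (if i = a then A $ i $ j else 0) else 0)"
      by (intro sum.cong refl) (auto simp: axis_def)
    then show ?thesis by simp
  qed
  then show ?thesis by (simp add: vec_eq_iff matrix_unit_def)
qed

text \<open>The identities are required for values at points, which is all that linear algebra at a
  point needs. Letting all matrices act, with the identity acting as zero, makes matrix units
  available. \<open>nontrivial\<close> allows N = 1, where the traceless matrices are zero.\<close>

locale sl_action = rat_space M for M :: "'p fspace" +
  fixes \<delta> :: "complex ^ 'm ^ 'm \<Rightarrow> 'p ratfun \<Rightarrow> 'p ratfun" and U\<^sub>0
  assumes vf: "\<delta> A \<in> rat_vector_fields M"
    and open_U\<^sub>0: "openin (zar M) U\<^sub>0" and U\<^sub>0_nonempty: "U\<^sub>0 \<noteq> {}"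
    and reg_\<delta>: "p \<in> U\<^sub>0 \<Longrightarrow> \<xi> \<in> local_ring M p \<Longrightarrow> \<delta> A \<xi> \<in> local_ring M p"
    and \<delta>_add: "p \<in> U\<^sub>0 \<Longrightarrow> \<xi> \<in> local_ring M p \<Longrightarrow>
        rat_value p (\<delta> (A + B) \<xi>) = rat_value p (\<delta> A \<xi>) + rat_value p (\<delta> B \<xi>)"
    and \<delta>_scale: "p \<in> U\<^sub>0 \<Longrightarrow> \<xi> \<in> local_ring M p \<Longrightarrow>
        rat_value p (\<delta> (matrix_scale c A) \<xi>) = c * rat_value p (\<delta> A \<xi>)"
    and \<delta>_bracket: "p \<in> U\<^sub>0 \<Longrightarrow> \<xi> \<in> local_ring M p \<Longrightarrow>
        rat_value p (\<delta> (A ** B - B ** A) \<xi>) = rat_value p (\<delta> A (\<delta> B \<xi>)) - rat_value p (\<delta> B (\<delta> A \<xi>))"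
    and \<delta>_one: "p \<in> U\<^sub>0 \<Longrightarrow> \<xi> \<in> local_ring M p \<Longrightarrow> rat_value p (\<delta> (mat 1) \<xi>) = 0"
    and small_rank: "p \<in> U\<^sub>0 \<Longrightarrow> \<exists>F. finite F \<and> card F < CARD('m) \<and>
        (\<forall>A. vector_at M p (\<delta> A) \<in> module.span fun_scale F)"
    and nontrivial: "CARD('m) = 1 \<or>
        (\<exists>p\<in>U\<^sub>0. \<exists>\<xi>\<in>local_ring M p. \<exists>A. rat_value p (\<delta> A \<xi>) \<noteq> 0)"
begin

definition dv :: "'p \<Rightarrow> complex ^ 'm ^ 'm \<Rightarrow> 'p ratfun \<Rightarrow> complex" where
  "dv p A \<xi> = rat_value p (\<delta> A \<xi>)"

text \<open>The matrix that represents the linear form A \<mapsto> \<open>dv p A \<xi>\<close> under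
  the trace pairing; this is why the indices are swapped.\<close>

definition symb :: "'p \<Rightarrow> 'p ratfun \<Rightarrow> complex ^ 'm ^ 'm" where
  "symb p \<xi> = (\<chi> i j. dv p (matrix_unit j i) \<xi>)"

lemma U\<^sub>0_points: "p \<in> U\<^sub>0 \<Longrightarrow> p \<in> points M"
  using open_sub_points[OF open_U\<^sub>0] by blast

lemma dv_trace:
  assumes "p \<in> U\<^sub>0" "\<xi> \<in> local_ring M p"
  shows "dv p A \<xi> = trace (A ** symb p \<xi>)"
proof -
  have z: "dv p 0 \<xi> = 0"
    using \<delta>_scale[OF assms, of 0 0] by (simp add: dv_def matrix_scale_def zero_vec_def)
  note add = \<delta>_add[OF assms, folded dv_def] and scale = \<delta>_scale[OF assms, folded dv_def]
  have s: "dv p (\<Sum>x\<in>S. f x) \<xi> = (\<Sum>x\<in>S. dv p (f x) \<xi>)" for S :: "'m set" and f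
    by (induction S rule: infinite_finite_induct) (simp_all add: z add)
  have "dv p A \<xi> = (\<Sum>i\<in>UNIV. \<Sum>j\<in>UNIV. A $ i $ j * dv p (matrix_unit i j) \<xi>)"
    by (subst (1) matrix_expand) (simp add: s scale)
  then show ?thesis by (simp add: trace_def matrix_matrix_mult_def symb_def)
qed

lemma symb_add: "p \<in> U\<^sub>0 \<Longrightarrow> \<xi> \<in> local_ring M p \<Longrightarrow> \<eta> \<in> local_ring M p \<Longrightarrow>
    symb p (\<xi> \<oplus>\<^bsub>K\<^esub> \<eta>) = symb p \<xi> + symb p \<eta>"
  by (simp add: vec_eq_iff symb_def dv_def vf_add[OF vf] local_ring_carrier value_add reg_\<delta>)

lemma symb_scale: "p \<in> U\<^sub>0 \<Longrightarrow> \<xi> \<in> local_ring M p \<Longrightarrow>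
    symb p (rat_const M c \<otimes>\<^bsub>K\<^esub> \<xi>) = matrix_scale c (symb p \<xi>)"
  by (simp add: vec_eq_iff symb_def dv_def vf_mult_const[OF vf] local_ring_carrier value_mult
      local_ring_const value_const U\<^sub>0_points reg_\<delta>)

lemma symb_const: "p \<in> U\<^sub>0 \<Longrightarrow> symb p (rat_const M c) = 0"
  by (simp add: vec_eq_iff symb_def dv_def vf_const[OF vf] value_const U\<^sub>0_points)

lemma dv_commute:
  "p \<in> U\<^sub>0 \<Longrightarrow> \<xi> \<in> local_ring M p \<Longrightarrow> dv p A (\<delta> B \<xi>) = dv p (A ** B - B ** A) \<xi> + dv p B (\<delta> A \<xi>)"
  using \<delta>_bracket by (simp add: dv_def)

text \<open>Symbols depend on \<xi> only through fewer than N tangent vectors. A matrix X orthogonal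
  to all symbols acts as zero at p, and then the commutator of X with the symbol of \<xi> is again a
  symbol, that of \<open>\<delta> X \<xi>\<close>.\<close>

lemma perp_stable_symb:
  assumes p: "p \<in> U\<^sub>0"
  shows "\<exists>S. perp_stable (symb p ` local_ring M p) S"
proof -
  obtain F where F: "finite F" "card F < CARD('m)" "\<And>A. vector_at M p (\<delta> A) \<in> module.span fun_scale F"
    using small_rank[OF p] by blast
  interpret fs: vector_space fun_scale by (rule vector_space_fun_scale)
  have "\<forall>A. \<exists>u. vector_at M p (\<delta> A) = (\<Sum>b\<in>F. fun_scale (u b) b)"
    using F(3) unfolding fs.span_finite[OF F(1)] by blast
  from choice[OF this] obtain u where u: "\<And>A. vector_at M p (\<delta> A) = (\<Sum>b\<in>F. fun_scale (u A b) b)"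
    by blast
  have dvu: "dv p A \<xi> = (\<Sum>b\<in>F. u A b * b \<xi>)" if "\<xi> \<in> local_ring M p" for A \<xi>
  proof -
    have "dv p A \<xi> = vector_at M p (\<delta> A) \<xi>" using that by (simp add: dv_def vector_at_def)
    also have "\<dots> = (\<Sum>b\<in>F. fun_scale (u A b) b) \<xi>" by (simp only: u)
    also have "\<dots> = (\<Sum>b\<in>F. u A b * b \<xi>)" using F(1)
      by (induction F rule: finite_induct) (auto simp: fun_scale_def)
    finally show ?thesis .
  qed
  \<comment> \<open>The coefficient of the tangent vector \<open>b\<close> in the action of A is
    linear in A on the matrix units; \<open>C b\<close> records it as a matrix, so that the symbol
    of \<xi> is the combination of the \<open>C b\<close> with weights
    \<open>b \<xi>\<close>.\<close>
  define C where "C b = (\<chi> i j. u (matrix_unit j i) b)" for b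
  have "perp_stable (symb p ` local_ring M p) (C ` F)"
  proof
    show "mat.subspace (symb p ` local_ring M p)"
      unfolding mat.subspace_def
    proof (intro conjI ballI allI)
      show "0 \<in> symb p ` local_ring M p"
        using symb_const[OF p, of 0] local_ring_const[OF U\<^sub>0_points[OF p], of 0] by (metis image_eqI)
      fix x y assume "x \<in> symb p ` local_ring M p" "y \<in> symb p ` local_ring M p"
      then show "x + y \<in> symb p ` local_ring M p"
        by clarify (metis symb_add[OF p] local_ring_add image_eqI)
    next
      fix x c assume "x \<in> symb p ` local_ring M p"
      then show "matrix_scale c x \<in> symb p ` local_ring M p"
        by clarify (metis symb_scale[OF p] local_ring_mult local_ring_const[OF U\<^sub>0_points[OF p]] image_eqI)
    qed
    have "symb p \<xi> \<in> mat.span (C ` F)" if "\<xi> \<in> local_ring M p" for \<xi>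
    proof -
      have "symb p \<xi> = (\<Sum>b\<in>F. matrix_scale (b \<xi>) (C b))"
        by (simp add: vec_eq_iff symb_def dvu[OF that] C_def mult.commute)
      moreover have "(\<Sum>b\<in>F. matrix_scale (b \<xi>) (C b)) \<in> mat.span (C ` F)"
        by (rule mat.span_sum, rule mat.span_scale, rule mat.span_base) simp
      ultimately show ?thesis by simp
    qed
    then show "symb p ` local_ring M p \<subseteq> mat.span (C ` F)" by blast
    show "finite (C ` F)" using F by simp
    show "card (C ` F) < CARD('m)" using card_image_le[OF F(1)] F(2) le_less_trans by blast
    show "trace A = 0" if "A \<in> symb p ` local_ring M p" for A
      using that dv_trace[OF p, of _ "mat 1"] \<delta>_one[OF p] by (auto simp: dv_def)
    fix X A assume X: "\<And>A. A \<in> symb p ` local_ring M p \<Longrightarrow> trace (X ** A) = 0"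
      and "A \<in> symb p ` local_ring M p"
    then obtain \<xi> where \<xi>: "\<xi> \<in> local_ring M p" "A = symb p \<xi>" by blast
    have X0: "dv p X \<eta> = 0" if "\<eta> \<in> local_ring M p" for \<eta> 
      using X[OF imageI[OF that]] dv_trace[OF p that] by simp
    have "X ** A - A ** X = symb p (\<delta> X \<xi>)"
    proof -
      have "(X ** A - A ** X) $ i $ j = symb p (\<delta> X \<xi>) $ i $ j" for i j
      proof -
        \<comment> \<open>With E a matrix unit, E (X \<xi>) = [E, X] \<xi> + X (E \<xi>) at p, and
          the last term is 0 because X is isotropic. Cyclicity turns tr ([E, X] A) into tr (E
          [X, A]).\<close>
        have "symb p (\<delta> X \<xi>) $ i $ j = trace ((matrix_unit j i ** X - X ** matrix_unit j i) ** A)"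
          using X0[OF reg_\<delta>[OF p \<xi>(1)], of "matrix_unit j i"] dv_commute[OF p \<xi>(1), of "matrix_unit j i" X]
          unfolding dv_trace[OF p \<xi>(1), symmetric] \<xi>(2) by (simp add: symb_def)
        also have "\<dots> = trace (matrix_unit j i ** (X ** A)) - trace (X ** (matrix_unit j i ** A))"
          by (simp only: matrix_diff_rdistrib trace_sub matrix_mul_assoc)
        also have "trace (X ** (matrix_unit j i ** A)) = trace (matrix_unit j i ** (A ** X))"
          by (subst trace_mul_sym) (simp only: matrix_mul_assoc)
        finally show ?thesis by (simp add: trace_matrix_unit)
      qed
      then show ?thesis by (simp add: vec_eq_iff)
    qed
    then show "X ** A - A ** X \<in> symb p ` local_ring M p" using reg_\<delta>[OF p \<xi>(1)] by blast
  qed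
  then show ?thesis by blast
qed

definition col_minor :: "'p \<Rightarrow> 'p ratfun \<Rightarrow> 'p ratfun \<Rightarrow> 'm \<Rightarrow> 'm \<Rightarrow> 'm \<Rightarrow> 'm \<Rightarrow> complex" where
  "col_minor p \<xi> \<eta> i j k l = symb p \<xi> $ i $ k * symb p \<eta> $ j $ l - symb p \<xi> $ j $ k * symb p \<eta> $ i $ l"

definition row_minor :: "'p \<Rightarrow> 'p ratfun \<Rightarrow> 'p ratfun \<Rightarrow> 'm \<Rightarrow> 'm \<Rightarrow> 'm \<Rightarrow> 'm \<Rightarrow> complex" where
  "row_minor p \<xi> \<eta> i j k l = symb p \<xi> $ k $ i * symb p \<eta> $ l $ j - symb p \<xi> $ k $ j * symb p \<eta> $ l $ i"

text \<open>The minor is the value of a single rational function \<open>\<zeta>\<close> regular near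
  p, so it stays nonzero on a neighbourhood.\<close>

lemma minor_open:
  assumes p: "p \<in> U\<^sub>0" and \<xi>: "\<xi> \<in> local_ring M p" and \<eta>: "\<eta> \<in> local_ring M p"
    and nz: "symb p \<xi> $ i $ j * symb p \<eta> $ k $ l - symb p \<xi> $ a $ b * symb p \<eta> $ c $ d \<noteq> 0"
  obtains V where "openin (zar M) V" "V \<subseteq> U\<^sub>0" "p \<in> V" "\<And>q. q \<in> V \<Longrightarrow> \<xi> \<in> local_ring M q \<and> \<eta> \<in> local_ring M q \<and>
      symb q \<xi> $ i $ j * symb q \<eta> $ k $ l - symb q \<xi> $ a $ b * symb q \<eta> $ c $ d \<noteq> 0"
proof -
  obtain V1 where V1: "openin (zar M) V1" "p \<in> V1" "\<And>q. q \<in> V1 \<Longrightarrow> \<xi> \<in> local_ring M q"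
    using open_local_ring[OF \<xi>] by blast
  obtain V2 where V2: "openin (zar M) V2" "p \<in> V2" "\<And>q. q \<in> V2 \<Longrightarrow> \<eta> \<in> local_ring M q"
    using open_local_ring[OF \<eta>] by blast
  let ?V = "V1 \<inter> V2 \<inter> U\<^sub>0"
  define \<zeta> where "\<zeta> = \<delta> (matrix_unit j i) \<xi> \<otimes>\<^bsub>K\<^esub> \<delta> (matrix_unit l k) \<eta> \<ominus>\<^bsub>K\<^esub> \<delta> (matrix_unit b a) \<xi> \<otimes>\<^bsub>K\<^esub> \<delta> (matrix_unit d c) \<eta>"
  have L: "\<zeta> \<in> local_ring M q" if "q \<in> ?V" for q
    unfolding \<zeta>_def using that V1 V2 by (intro local_ring_minus local_ring_mult reg_\<delta>) auto
  have v: "rat_value q \<zeta> = symb q \<xi> $ i $ j * symb q \<eta> $ k $ l - symb q \<xi> $ a $ b * symb q \<eta> $ c $ d"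
    if "q \<in> ?V" for q
    using that V1 V2 by (simp add: \<zeta>_def value_minus value_mult local_ring_mult reg_\<delta> symb_def dv_def)
  have "openin (zar M) {q \<in> ?V. rat_value q \<zeta> \<noteq> 0}"
    using V1 V2 open_U\<^sub>0 L by (intro value_nonzero_open) auto
  then show ?thesis
    by (rule that) (use V1 V2 v p nz in auto)
qed

text \<open>If each alternative failed at some point, each would fail on a nonempty open set. These
  two sets meet, and at a common point the alternative for matrix spaces is contradicted.\<close>

lemma columns_or_rows:
  "(\<forall>p\<in>U\<^sub>0. \<forall>\<xi>\<in>local_ring M p. \<forall>\<eta>\<in>local_ring M p. \<forall>i j k l. col_minor p \<xi> \<eta> i j k l = 0) \<or>
   (\<forall>p\<in>U\<^sub>0. \<forall>\<xi>\<in>local_ring M p. \<forall>\<eta>\<in>local_ring M p. \<forall>i j k l. row_minor p \<xi> \<eta> i j k l = 0)"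
proof (rule ccontr)
  assume "\<not> ?thesis"
  then obtain p \<xi> \<eta> i j k l q \<xi>' \<eta>' i' j' k' l' where
    p: "p \<in> U\<^sub>0" "\<xi> \<in> local_ring M p" "\<eta> \<in> local_ring M p" "col_minor p \<xi> \<eta> i j k l \<noteq> 0" and
    q: "q \<in> U\<^sub>0" "\<xi>' \<in> local_ring M q" "\<eta>' \<in> local_ring M q" "row_minor q \<xi>' \<eta>' i' j' k' l' \<noteq> 0"
    by blast
  obtain V where V: "openin (zar M) V" "V \<subseteq> U\<^sub>0" "p \<in> V"
    "\<And>r. r \<in> V \<Longrightarrow> \<xi> \<in> local_ring M r \<and> \<eta> \<in> local_ring M r \<and> col_minor r \<xi> \<eta> i j k l \<noteq> 0"
    using minor_open[OF p(1-3) p(4)[unfolded col_minor_def]] unfolding col_minor_def by blast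
  obtain W where W: "openin (zar M) W" "W \<subseteq> U\<^sub>0" "q \<in> W"
    "\<And>r. r \<in> W \<Longrightarrow> \<xi>' \<in> local_ring M r \<and> \<eta>' \<in> local_ring M r \<and> row_minor r \<xi>' \<eta>' i' j' k' l' \<noteq> 0"
    using minor_open[OF q(1-3) q(4)[unfolded row_minor_def]] unfolding row_minor_def by blast
  obtain r where r: "r \<in> V" "r \<in> W" using irreducible[OF V(1) W(1)] V W by blast
  then obtain S where "perp_stable (symb r ` local_ring M r) S" using perp_stable_symb V by blast
  from perp_stable.columns_or_rows_parallel[OF this] show False
  proof
    assume a: "\<forall>A\<in>symb r ` local_ring M r. \<forall>B\<in>symb r ` local_ring M r. \<forall>i j k l.
        A $ i $ k * B $ j $ l = A $ j $ k * B $ i $ l"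
    show False using a[rule_format, OF imageI imageI, of \<xi> \<eta> i k j l] V(4)[OF r(1)]
      by (simp add: col_minor_def)
  next
    assume a: "\<forall>A\<in>symb r ` local_ring M r. \<forall>B\<in>symb r ` local_ring M r. \<forall>i j k l.
        A $ k $ i * B $ l $ j = A $ k $ j * B $ l $ i"
    show False using a[rule_format, OF imageI imageI, of \<xi>' \<eta>' k' i' l' j'] W(4)[OF r(2)]
      by (simp add: row_minor_def)
  qed
qed

end

section \<open>The contragredient action and the reduction to columns\<close>

lemma transpose_simps:
  "transpose (A + B) = transpose A + transpose B" "transpose (A - B) = transpose A - transpose B"
  "transpose (- A) = - transpose A" "transpose (matrix_scale c D) = matrix_scale c (transpose D)"
  by (simp_all add: vec_eq_iff transpose_def)

lemma transpose_matrix_unit: "transpose (matrix_unit i j) = matrix_unit j i"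
  by (simp add: vec_eq_iff transpose_def matrix_unit_def mult.commute)

context sl_action
begin

text \<open>A \<mapsto> - A^T is a Lie algebra automorphism sending the identity to its negative, so
  all laws persist while the set of vector fields is unchanged.\<close>

lemma contragredient: "sl_action M (\<lambda>A. \<delta> (- transpose A)) U\<^sub>0"
proof
  fix p \<xi> A B c assume p: "p \<in> U\<^sub>0" and \<xi>: "\<xi> \<in> local_ring M p"
  show "\<delta> (- transpose A) \<xi> \<in> local_ring M p" using reg_\<delta>[OF p \<xi>] .
  show "rat_value p (\<delta> (- transpose (A + B)) \<xi>) =
      rat_value p (\<delta> (- transpose A) \<xi>) + rat_value p (\<delta> (- transpose B) \<xi>)"
    using \<delta>_add[OF p \<xi>, of "- transpose A" "- transpose B"] by (simp add: transpose_simps)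
  have "- transpose (matrix_scale c A) = matrix_scale c (- transpose A)" by (simp add: vec_eq_iff transpose_def)
  then show "rat_value p (\<delta> (- transpose (matrix_scale c A)) \<xi>) = c * rat_value p (\<delta> (- transpose A) \<xi>)"
    by (simp only: \<delta>_scale[OF p \<xi>])
  have "- transpose (A ** B - B ** A) = (- transpose A) ** (- transpose B) - (- transpose B) ** (- transpose A)"
    by (simp add: transpose_simps matrix_transpose_mul)
      (simp add: vec_eq_iff matrix_matrix_mult_def sum_negf)
  then show "rat_value p (\<delta> (- transpose (A ** B - B ** A)) \<xi>) =
       rat_value p (\<delta> (- transpose A) (\<delta> (- transpose B) \<xi>)) -
       rat_value p (\<delta> (- transpose B) (\<delta> (- transpose A) \<xi>))"
    by (simp only: \<delta>_bracket[OF p \<xi>])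
  have "- transpose (mat 1) = matrix_scale (-1) (mat 1 :: complex ^ 'm ^ 'm)"
    by (simp add: vec_eq_iff transpose_def mat_def)
  then show "rat_value p (\<delta> (- transpose (mat 1)) \<xi>) = 0" by (simp only: \<delta>_scale[OF p \<xi>] \<delta>_one[OF p \<xi>] mult_zero_right)
next
  fix p assume "p \<in> U\<^sub>0"
  then show "\<exists>F. finite F \<and> card F < CARD('m) \<and>
        (\<forall>A. vector_at M p (\<delta> (- transpose A)) \<in> module.span fun_scale F)"
    using small_rank by blast
next
  have "\<delta> A = \<delta> (- transpose (- transpose A))" for A by (simp add: transpose_simps)
  then show "CARD('m) = 1 \<or> (\<exists>p\<in>U\<^sub>0. \<exists>\<xi>\<in>local_ring M p. \<exists>A. rat_value p (\<delta> (- transpose A) \<xi>) \<noteq> 0)"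
    using nontrivial by metis
qed (use vf open_U\<^sub>0 U\<^sub>0_nonempty in auto)

lemma dv_minus: "p \<in> U\<^sub>0 \<Longrightarrow> \<xi> \<in> local_ring M p \<Longrightarrow> dv p (- A) \<xi> = - dv p A \<xi>"
  using dv_trace[of p \<xi> "- A"] dv_trace[of p \<xi> A] by (simp add: trace_def matrix_matrix_mult_def sum_negf)

end

locale column_action = sl_action M \<delta> U\<^sub>0
  for M :: "'p fspace" and \<delta> :: "complex ^ 'm ^ 'm \<Rightarrow> 'p ratfun \<Rightarrow> 'p ratfun" and U\<^sub>0 +
  assumes columns: "p \<in> U\<^sub>0 \<Longrightarrow> \<xi> \<in> local_ring M p \<Longrightarrow> \<eta> \<in> local_ring M p \<Longrightarrow>
     symb p \<xi> $ i $ k * symb p \<eta> $ j $ l = symb p \<xi> $ j $ k * symb p \<eta> $ i $ l"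

text \<open>Symbols of the contragredient action are minus the transposed symbols: parallel rows
  become parallel columns.\<close>

lemma (in sl_action) column_action_cases:
  obtains "column_action M \<delta> U\<^sub>0" | "column_action M (\<lambda>A. \<delta> (- transpose A)) U\<^sub>0"
proof (cases "\<forall>p\<in>U\<^sub>0. \<forall>\<xi>\<in>local_ring M p. \<forall>\<eta>\<in>local_ring M p. \<forall>i j k l. col_minor p \<xi> \<eta> i j k l = 0")
  case True
  have "column_action M \<delta> U\<^sub>0"
    by unfold_locales (use True in \<open>auto simp: col_minor_def\<close>)
  then show ?thesis by (rule that)
next
  case False
  with columns_or_rows have rows:
    "\<forall>p\<in>U\<^sub>0. \<forall>\<xi>\<in>local_ring M p. \<forall>\<eta>\<in>local_ring M p. \<forall>i j k l. row_minor p \<xi> \<eta> i j k l = 0"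
    by blast
  interpret c: sl_action M "\<lambda>A. \<delta> (- transpose A)" U\<^sub>0 by (rule contragredient)
  have s: "c.symb p \<xi> $ i $ j = - symb p \<xi> $ j $ i" if "p \<in> U\<^sub>0" "\<xi> \<in> local_ring M p" for p \<xi> i j
  proof -
    have "c.dv p (matrix_unit j i) \<xi> = dv p (- matrix_unit i j) \<xi>"
      by (simp add: c.dv_def dv_def transpose_matrix_unit)
    then show ?thesis by (simp add: c.symb_def symb_def dv_minus[OF that])
  qed
  have "column_action M (\<lambda>A. \<delta> (- transpose A)) U\<^sub>0"
  proof
    fix p \<xi> \<eta> i k j l assume a: "p \<in> U\<^sub>0" "\<xi> \<in> local_ring M p" "\<eta> \<in> local_ring M p"
    then have "row_minor p \<xi> \<eta> i j k l = 0" using rows by blast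
    then show "c.symb p \<xi> $ i $ k * c.symb p \<eta> $ j $ l = c.symb p \<xi> $ j $ k * c.symb p \<eta> $ i $ l"
      using a by (simp add: s row_minor_def)
  qed
  then show ?thesis by (rule that)
qed

context column_action
begin

text \<open>The components of \<open>u\<close> are the homogeneous coordinates of the map to projective space.\<close>

definition frame :: "'p set \<Rightarrow> ('p \<Rightarrow> complex ^ 'm) \<Rightarrow> 'm \<Rightarrow> (complex ^ 'm ^ 'm \<Rightarrow> 'p \<Rightarrow> complex) \<Rightarrow> bool" where
  "frame V u i\<^sub>0 \<mu> \<longleftrightarrow> openin (zar M) V \<and> V \<noteq> {} \<and> V \<subseteq> U\<^sub>0 \<and> (\<forall>i. (\<lambda>p. u p $ i) \<in> reg M V) \<and>
     (\<forall>p\<in>V. u p $ i\<^sub>0 \<noteq> 0) \<and>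
     (\<forall>A. \<forall>p\<in>V. \<forall>i. dv p A (cls V (\<lambda>p. u p $ i)) = \<mu> A p * u p $ i - (A *v u p) $ i) \<and>
     (\<forall>A c. \<forall>p\<in>V. \<forall>\<xi>\<in>local_ring M p. A *v u p = c *s u p \<longrightarrow> dv p A \<xi> = 0)"

lemma frame_exists: "\<exists>V u i\<^sub>0 \<mu>. frame V u i\<^sub>0 \<mu>"
proof (cases "\<exists>p\<in>U\<^sub>0. \<exists>\<xi>\<in>local_ring M p. symb p \<xi> \<noteq> 0")
  case False
  \<comment> \<open>With all symbols zero, \<open>nontrivial\<close> leaves N = 1. Projective space
    is then a point, and the constant frame 1 works, \<open>\<mu>\<close> being the only entry of
    A.\<close>
  then have z: "dv p A \<xi> = 0" if "p \<in> U\<^sub>0" "\<xi> \<in> local_ring M p" for p A \<xi>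
    using dv_trace[OF that, of A] that by (simp add: trace_def matrix_matrix_mult_def)
  then have "CARD('m) = 1" using nontrivial by (auto simp: dv_def)
  then obtain i\<^sub>0 :: 'm where "UNIV = {i\<^sub>0}" by (auto simp: card_1_singleton_iff)
  note i\<^sub>0 = this
  have mv: "(A *v x) $ i = A $ i\<^sub>0 $ i\<^sub>0 * x $ i\<^sub>0" for A :: "complex ^ 'm ^ 'm" and x i
  proof -
    have "i = i\<^sub>0" using i\<^sub>0 by auto
    then show ?thesis by (simp add: matrix_vector_mult_def i\<^sub>0)
  qed
  have "(U\<^sub>0, \<lambda>_. 1) \<in> rat_reps M" using open_U\<^sub>0 U\<^sub>0_nonempty by (simp add: reps_iff reg_const)
  then have "frame U\<^sub>0 (\<lambda>_. 1) i\<^sub>0 (\<lambda>A _. A $ i\<^sub>0 $ i\<^sub>0)"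
    unfolding frame_def using open_U\<^sub>0 U\<^sub>0_nonempty z local_ring_cls[of U\<^sub>0 "\<lambda>_. 1"]
    by (auto simp: reg_const mv)
  then show ?thesis by blast
next
  case True
  then obtain p\<^sub>0 \<xi> where p\<^sub>0: "p\<^sub>0 \<in> U\<^sub>0" "\<xi> \<in> local_ring M p\<^sub>0" "symb p\<^sub>0 \<xi> \<noteq> 0" by blast
  then obtain i\<^sub>0 k\<^sub>0 where nz: "symb p\<^sub>0 \<xi> $ i\<^sub>0 $ k\<^sub>0 \<noteq> 0" by (auto simp: vec_eq_iff)
  obtain W where W: "openin (zar M) W" "p\<^sub>0 \<in> W" "\<And>q. q \<in> W \<Longrightarrow> \<xi> \<in> local_ring M q"
    using open_local_ring[OF p\<^sub>0(2)] by blast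
  \<comment> \<open>The column \<open>k\<^sub>0\<close> of the symbol of one fixed function;
    restricting to \<open>V\<close> keeps its entry \<open>i\<^sub>0\<close> nonzero.\<close>
  define u where "u p = (\<chi> i. symb p \<xi> $ i $ k\<^sub>0)" for p
  define V where "V = {q \<in> W \<inter> U\<^sub>0. rat_value q (\<delta> (matrix_unit k\<^sub>0 i\<^sub>0) \<xi>) \<noteq> 0}"
  have V: "openin (zar M) V" unfolding V_def
    using W open_U\<^sub>0 by (intro value_nonzero_open reg_\<delta>) auto
  have V0: "p\<^sub>0 \<in> V" using W p\<^sub>0 nz by (auto simp: V_def symb_def dv_def)
  then have Vne: "V \<noteq> {}" by blast
  have VU: "p \<in> U\<^sub>0" and V\<xi>: "\<xi> \<in> local_ring M p" and u0: "u p $ i\<^sub>0 \<noteq> 0" if "p \<in> V" for p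
    using that W by (auto simp: V_def u_def symb_def dv_def)
  have u_val: "(\<lambda>p. u p $ i) = (\<lambda>p. rat_value p (\<delta> (matrix_unit k\<^sub>0 i) \<xi>))" for i
    by (auto simp: u_def symb_def dv_def)
  have u_cls: "(V, \<lambda>p. u p $ i) \<in> rat_reps M" "cls V (\<lambda>p. u p $ i) = \<delta> (matrix_unit k\<^sub>0 i) \<xi>" for i
    unfolding u_val using class_of_value[OF V Vne, of "\<delta> (matrix_unit k\<^sub>0 i) \<xi>"] reg_\<delta>[OF VU V\<xi>]
    by simp_all
  \<comment> \<open>Comparison with the nonzero column \<open>u\<close> shows that every symbol at p
    factors through u.\<close>
  have fac: "symb p \<eta> = outer (u p) (\<chi> l. symb p \<eta> $ i\<^sub>0 $ l / u p $ i\<^sub>0)"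
    if "p \<in> V" "\<eta> \<in> local_ring M p" for p \<eta>
    using columns[OF VU[OF that(1)] that(2) V\<xi>[OF that(1)]] u0[OF that(1)]
    by (simp add: vec_eq_iff u_def field_simps)
  \<comment> \<open>Put Q = \<open>symb p \<xi>\<close>. Differentiating the column u along A yields
    the column \<open>k\<^sub>0\<close> of Q A - A Q + \<open>symb p (\<delta> A \<xi>)\<close>. The
    first and last terms have columns parallel to u and make up \<open>\<mu> A p\<close>; the middle
    one is A u.\<close>
  define \<mu> where "\<mu> A p = ((symb p \<xi> ** A) $ i\<^sub>0 $ k\<^sub>0 + symb p (\<delta> A \<xi>) $ i\<^sub>0 $ k\<^sub>0) / u p $ i\<^sub>0" for A p
  have eq: "dv p A (cls V (\<lambda>p. u p $ i)) = \<mu> A p * u p $ i - (A *v u p) $ i" if p: "p \<in> V" for A p i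
  proof -
    note pU = VU[OF p] and p\<xi> = V\<xi>[OF p]
    have "dv p A (\<delta> (matrix_unit k\<^sub>0 i) \<xi>)
        = trace ((A ** matrix_unit k\<^sub>0 i - matrix_unit k\<^sub>0 i ** A) ** symb p \<xi>) + dv p (matrix_unit k\<^sub>0 i) (\<delta> A \<xi>)"
      by (simp only: dv_commute[OF pU p\<xi>, of A "matrix_unit k\<^sub>0 i"] dv_trace[OF pU p\<xi>])
    also have "trace ((A ** matrix_unit k\<^sub>0 i - matrix_unit k\<^sub>0 i ** A) ** symb p \<xi>)
        = trace (A ** (matrix_unit k\<^sub>0 i ** symb p \<xi>)) - trace (matrix_unit k\<^sub>0 i ** (A ** symb p \<xi>))"
      by (simp only: matrix_diff_rdistrib trace_sub matrix_mul_assoc)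
    also have "trace (A ** (matrix_unit k\<^sub>0 i ** symb p \<xi>)) = trace (matrix_unit k\<^sub>0 i ** (symb p \<xi> ** A))"
      by (subst trace_mul_sym) (simp only: matrix_mul_assoc)
    also have "dv p (matrix_unit k\<^sub>0 i) (\<delta> A \<xi>) = symb p (\<delta> A \<xi>) $ i $ k\<^sub>0" by (simp add: symb_def)
    finally have 1: "dv p A (\<delta> (matrix_unit k\<^sub>0 i) \<xi>)
        = (symb p \<xi> ** A) $ i $ k\<^sub>0 - (A ** symb p \<xi>) $ i $ k\<^sub>0 + symb p (\<delta> A \<xi>) $ i $ k\<^sub>0"
      by (simp add: trace_matrix_unit)
    have 2: "(A ** symb p \<xi>) $ i $ k\<^sub>0 = (A *v u p) $ i"
      by (simp add: matrix_matrix_mult_def matrix_vector_mult_def u_def)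
    have 3: "B $ i $ k\<^sub>0 = u p $ i * (B $ i\<^sub>0 $ k\<^sub>0 / u p $ i\<^sub>0)" if "B = outer (u p) \<psi>" for B \<psi>
      using u0[OF p] that by simp
    have "symb p \<xi> ** A = outer (u p) ((\<chi> l. symb p \<xi> $ i\<^sub>0 $ l / u p $ i\<^sub>0) v* A)"
      by (subst fac[OF p p\<xi>]) (simp add: outer_matrix_mult)
    from 1 3[OF this] 2 3[OF fac[OF p reg_\<delta>[OF pU p\<xi>]]] show ?thesis
      by (simp add: u_cls \<mu>_def algebra_simps add_divide_distrib)
  qed
  have van: "dv p A \<eta> = 0" if p: "p \<in> V" and \<eta>: "\<eta> \<in> local_ring M p" and A: "A *v u p = c *s u p" for p A c \<eta>
  proof -
    define \<psi> where "\<psi> = (\<chi> l. symb p \<eta> $ i\<^sub>0 $ l / u p $ i\<^sub>0)"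
    have f: "symb p \<eta> = outer (u p) \<psi>" using fac[OF p \<eta>] by (simp add: \<psi>_def)
    \<comment> \<open>The identity matrix acts as zero, so \<psi>(u) = 0, and an eigenvector u of A
      gives tr (A Q) = \<psi>(A u) = c \<psi>(u) = 0.\<close>
    have "cdot \<psi> (u p) = dv p (mat 1) \<eta>" by (simp add: dv_trace[OF VU[OF p] \<eta>] f trace_outer)
    then have "cdot \<psi> (u p) = 0" using \<delta>_one[OF VU[OF p] \<eta>] by (simp add: dv_def)
    then show ?thesis by (simp add: dv_trace[OF VU[OF p] \<eta>] f outer_matrix_mult trace_outer A)
  qed
  have "frame V u i\<^sub>0 \<mu>"
    unfolding frame_def
    using V V0 VU u0 u_cls(1) eq van by (auto simp: reps_iff)
  then show ?thesis by blast
qed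

end

section \<open>Polynomials in the components of a frame\<close>

abbreviation vec_polys :: "(complex ^ 'm \<Rightarrow> complex) set" where
  "vec_polys \<equiv> poly_funs {(\<lambda>v. v $ i) | i. True}"

text \<open>Polynomials are functions here, so partial derivatives are attached to a way of building
  F. One induction then yields the chain rule both for holomorphic curves and for derivations of the
  function field.\<close>

inductive is_grad :: "(complex ^ 'm \<Rightarrow> complex) \<Rightarrow> ('m \<Rightarrow> complex ^ 'm \<Rightarrow> complex) \<Rightarrow> bool" where
  coord: "is_grad (\<lambda>v. v $ i) (\<lambda>j _. if j = i then 1 else 0)"
| const: "is_grad (\<lambda>_. c) (\<lambda>_ _. 0)"
| add: "is_grad F G \<Longrightarrow> is_grad F' G' \<Longrightarrow> is_grad (\<lambda>v. F v + F' v) (\<lambda>j v. G j v + G' j v)"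
| mult: "is_grad F G \<Longrightarrow> is_grad F' G' \<Longrightarrow> is_grad (\<lambda>v. F v * F' v) (\<lambda>j v. F v * G' j v + F' v * G j v)"

lemma grad_exists: "F \<in> vec_polys \<Longrightarrow> \<exists>G. is_grad F G"
proof (induction rule: poly_funs.induct)
  case (gen f)
  then show ?case using is_grad.coord by blast
qed (blast intro: is_grad.intros)+

lemma grad_polys:
  assumes "is_grad F G"
  shows "F \<in> vec_polys" "G i \<in> vec_polys"
proof -
  have "F \<in> vec_polys \<and> (\<forall>i. G i \<in> vec_polys)"
    using assms
  proof induction
    case (coord i)
    have "(\<lambda>_. if j = i then 1 else 0) \<in> vec_polys" for j by (rule poly_funs.const)
    moreover have "(\<lambda>v. v $ i) \<in> vec_polys" by (rule poly_funs.gen) blast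
    ultimately show ?case by blast
  next
    case (mult F G F' G')
    then have "(\<lambda>v. F v * G' j v + F' v * G j v) \<in> vec_polys" for j
      by (intro poly_funs.add poly_funs.mult) auto
    then show ?case using mult by (auto intro: poly_funs.mult)
  qed (auto intro: poly_funs.const poly_funs.add)
  then show "F \<in> vec_polys" "G i \<in> vec_polys" by auto
qed

lemma vec_polys_sum: "(\<And>i. i \<in> I \<Longrightarrow> f i \<in> vec_polys) \<Longrightarrow> (\<lambda>v. \<Sum>i\<in>I. f i v) \<in> vec_polys"
  by (induction I rule: infinite_finite_induct) (auto intro: poly_funs.const poly_funs.add)

lemma grad_chain:
  assumes "is_grad F G" and "\<And>i. ((\<lambda>s. \<gamma> s $ i) has_field_derivative \<gamma>' $ i) (at t)"
  shows "((\<lambda>s. F (\<gamma> s)) has_field_derivative (\<Sum>i\<in>UNIV. G i (\<gamma> t) * \<gamma>' $ i)) (at t)"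
  using assms(1)
proof induction
  case (coord i)
  have "(\<Sum>j\<in>UNIV. (if j = i then 1 else 0) * \<gamma>' $ j) = \<gamma>' $ i"
    by (simp add: if_distrib[of "\<lambda>a. a * _"] cong: if_cong)
  then show ?case using assms(2)[of i] by simp
next
  case (add F G F' G')
  have "(\<Sum>i\<in>UNIV. (G i (\<gamma> t) + G' i (\<gamma> t)) * \<gamma>' $ i)
      = (\<Sum>i\<in>UNIV. G i (\<gamma> t) * \<gamma>' $ i) + (\<Sum>i\<in>UNIV. G' i (\<gamma> t) * \<gamma>' $ i)"
    by (simp add: distrib_right sum.distrib)
  then show ?case using DERIV_add[OF add.IH] by simp
next
  case (mult F G F' G')
  have "(\<Sum>i\<in>UNIV. (F (\<gamma> t) * G' i (\<gamma> t) + F' (\<gamma> t) * G i (\<gamma> t)) * \<gamma>' $ i)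
      = (\<Sum>i\<in>UNIV. G i (\<gamma> t) * \<gamma>' $ i) * F' (\<gamma> t) + (\<Sum>i\<in>UNIV. G' i (\<gamma> t) * \<gamma>' $ i) * F (\<gamma> t)"
    by (simp add: sum_distrib_left sum_distrib_right flip: sum.distrib) (simp add: algebra_simps)
  then show ?case using DERIV_mult[OF mult.IH] by simp
qed simp

lemma line_has_derivative: "((\<lambda>s. (v + s *s w) $ i) has_field_derivative w $ i) (at (t :: complex))"
  by (auto intro!: derivative_eq_intros)

text \<open>On the line from v to x the polynomial becomes an entire function of one variable, all
  of whose derivatives at 0 are values at v of members of \<open>Z\<close>.\<close>

lemma poly_zero_if_derivatives_vanish:
  fixes Z :: "(complex ^ 'm \<Rightarrow> complex) set"
  assumes Z: "\<And>F w. F \<in> Z \<Longrightarrow> \<exists>G. is_grad F G \<and> (\<lambda>v. \<Sum>i\<in>UNIV. G i v * w $ i) \<in> Z"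
    and v: "\<And>F. F \<in> Z \<Longrightarrow> F v = 0" and F: "F \<in> Z"
  shows "F x = 0"
proof -
  define w where "w = x - v"
  have step: "\<exists>H\<in>Z. \<forall>t. ((\<lambda>s. F (v + s *s w)) has_field_derivative H (v + t *s w)) (at t)" if F: "F \<in> Z" for F
  proof -
    obtain G where G: "is_grad F G" "(\<lambda>v. \<Sum>i\<in>UNIV. G i v * w $ i) \<in> Z" using Z[OF F] by blast
    show ?thesis
      by (rule bexI[OF _ G(2)], rule allI, rule grad_chain[OF G(1) line_has_derivative])
  qed
  have z: "(deriv ^^ k) (\<lambda>s. F (v + s *s w)) 0 = 0" if "F \<in> Z" for k F
    using that
  proof (induction k arbitrary: F)
    case 0
    then show ?case using v by simp
  next
    case (Suc k)
    obtain H where H: "H \<in> Z" "\<And>t. ((\<lambda>s. F (v + s *s w)) has_field_derivative H (v + t *s w)) (at t)"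
      using step[OF Suc.prems] by blast
    have "deriv (\<lambda>s. F (v + s *s w)) = (\<lambda>t. H (v + t *s w))"
      using H(2) DERIV_imp_deriv by blast
    then show ?case using Suc.IH[OF H(1)] by (simp only: funpow_Suc_right comp_apply)
  qed
  have "(\<lambda>s. F (v + s *s w)) holomorphic_on UNIV"
    using step[OF F] unfolding holomorphic_on_def field_differentiable_def by auto
  from holomorphic_fun_eq_0_on_connected[OF this open_UNIV connected_UNIV z[OF F], of 1]
  show ?thesis by (simp add: w_def)
qed

context fn_space
begin

lemma reg_vec_poly:
  assumes "F \<in> vec_polys" "openin (zar M) V" "\<And>i. (\<lambda>p. f p $ i) \<in> reg M V"
  shows "(\<lambda>p. F (f p)) \<in> reg M V"
  using assms(1)
proof induction
  case (gen F)
  then show ?case using assms(3) by auto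
qed (auto intro: reg_const reg_add reg_mult assms)

end

context rat_space
begin

text \<open>The chain rule for derivations, the algebraic counterpart of
  \<open>grad_chain\<close>.\<close>

lemma vf_grad:
  assumes X: "X \<in> rat_vector_fields M" "regular_at M p X" and FG: "is_grad F G"
    and V: "openin (zar M) V" "p \<in> V" and f: "\<And>i. (\<lambda>q. f q $ i) \<in> reg M V"
  shows "rat_value p (X (cls V (\<lambda>q. F (f q)))) = (\<Sum>i\<in>UNIV. G i (f p) * rat_value p (X (cls V (\<lambda>q. f q $ i))))"
proof -
  have rep: "(V, \<lambda>q. F (f q)) \<in> rat_reps M" if "F \<in> vec_polys" for F
    using reg_vec_poly[OF that V(1), of f] f V by (auto simp: reps_iff)
  have L: "cls V (\<lambda>q. F (f q)) \<in> local_ring M p" if "F \<in> vec_polys" for F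
    by (rule local_ring_cls[OF rep[OF that] V(2)])
  have XL: "X (cls V (\<lambda>q. F (f q))) \<in> local_ring M p" if "F \<in> vec_polys" for F
    using L[OF that] X(2) by (auto simp: regular_at_def)
  have pM: "p \<in> points M" using V open_sub_points by blast
  show ?thesis
    using FG
  proof induction
    case (coord i)
    then show ?case by (simp add: if_distrib[of "\<lambda>a. a * _"] cong: if_cong)
  next
    case (const c)
    have "cls V (\<lambda>_. c) = rat_const M c" unfolding rat_const_def
      using V by (intro cls_restrict reps_const open_sub_points) auto
    then show ?case by (simp add: vf_const[OF X(1)] value_const[OF pM])
  next
    case (add F G F' G')
    note F = grad_polys(1)[OF add.hyps(1)] and F' = grad_polys(1)[OF add.hyps(2)]
    have "cls V (\<lambda>q. F (f q) + F' (f q)) = cls V (\<lambda>q. F (f q)) \<oplus>\<^bsub>K\<^esub> cls V (\<lambda>q. F' (f q))"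
      by (simp add: K_add[OF rep[OF F] rep[OF F']])
    then show ?case
      by (simp add: vf_add[OF X(1)] cls_in_K rep[OF F] rep[OF F'] value_add XL[OF F] XL[OF F'] add.IH distrib_right sum.distrib)
  next
    case (mult F G F' G')
    note F = grad_polys(1)[OF mult.hyps(1)] and F' = grad_polys(1)[OF mult.hyps(2)]
    have "cls V (\<lambda>q. F (f q) * F' (f q)) = cls V (\<lambda>q. F (f q)) \<otimes>\<^bsub>K\<^esub> cls V (\<lambda>q. F' (f q))"
      by (simp add: K_mult[OF rep[OF F] rep[OF F']])
    then have "rat_value p (X (cls V (\<lambda>q. F (f q) * F' (f q))))
       = F (f p) * rat_value p (X (cls V (\<lambda>q. F' (f q)))) + F' (f p) * rat_value p (X (cls V (\<lambda>q. F (f q))))"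
      using V by (simp add: vf_mult[OF X(1)] cls_in_K rep[OF F] rep[OF F'] value_add value_mult
          local_ring_mult L[OF F] L[OF F'] XL[OF F] XL[OF F'] value_cls)
    also have "\<dots> = (\<Sum>i\<in>UNIV. (F (f p) * G' i (f p) + F' (f p) * G i (f p)) * rat_value p (X (cls V (\<lambda>q. f q $ i))))"
      by (simp add: mult.IH sum_distrib_left distrib_right sum.distrib mult.assoc)
    finally show ?case .
  qed
qed

end

context column_action
begin

lemma regular_at_\<delta>: "p \<in> U\<^sub>0 \<Longrightarrow> regular_at M p (\<delta> A)"
  using reg_\<delta> by (auto simp: regular_at_def)

text \<open>The algebraic form of dominance: no nonzero homogeneous polynomial vanishes on the image
  of the frame. The moves - A u point in all directions, so vanishing along the frame passes to
  every partial derivative.\<close>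

lemma frame_poly_zero:
  assumes fr: "frame V u i\<^sub>0 \<mu>" and F: "F \<in> homogeneous_polys d" "\<And>p. p \<in> V \<Longrightarrow> F (u p) = 0"
  shows "F x = 0"
proof -
  have V: "openin (zar M) V" "V \<noteq> {}" "V \<subseteq> U\<^sub>0" and u: "\<And>i. (\<lambda>p. u p $ i) \<in> reg M V"
    and u0: "\<And>p. p \<in> V \<Longrightarrow> u p $ i\<^sub>0 \<noteq> 0"
    and du: "\<And>A p i. p \<in> V \<Longrightarrow> dv p A (cls V (\<lambda>p. u p $ i)) = \<mu> A p * u p $ i - (A *v u p) $ i"
    using fr by (auto simp: frame_def)
  \<comment> \<open>Vanishing is required on the whole punctured line through \<open>u p\<close>, so
    that radial derivatives vanish too; they carry the uncontrolled factor
    \<open>\<mu>\<close>.\<close>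
  define Z where "Z = {F \<in> vec_polys. \<forall>c. c \<noteq> 0 \<longrightarrow> (\<forall>p\<in>V. F (c *s u p) = 0)}"
  have closed: "G i \<in> Z" if F: "F \<in> Z" and G: "is_grad F G" for F G i
  proof -
    have "G i (c *s u p) = 0" if c: "c \<noteq> 0" and p: "p \<in> V" for c p
    proof -
      \<comment> \<open>This A sends u to its entry \<open>i\<^sub>0\<close>, which is nonzero,
        times the i-th basis vector, and so isolates the i-th partial derivative.\<close>
      define A where "A = matrix_unit i i\<^sub>0"
      have Au: "(A *v u p) $ j = (if j = i then u p $ i\<^sub>0 else 0)" for j
        by (simp add: A_def matrix_unit_def outer_matrix_mult cdot_axis) (simp add: axis_def)
      have cu: "(\<lambda>q. (c *s u q) $ j) \<in> reg M V" for j
        using reg_mult[OF V(1) reg_const[OF V(1), of c] u[of j]] by simp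
      have urep: "(V, \<lambda>q. u q $ j) \<in> rat_reps M" for j using V u by (simp add: reps_iff)
      have pU: "p \<in> U\<^sub>0" and pM: "p \<in> points M" using p V U\<^sub>0_points by auto
      have "rat_value p (\<delta> A (cls V (\<lambda>q. F (c *s u q))))
         = (\<Sum>j\<in>UNIV. G j (c *s u p) * rat_value p (\<delta> A (cls V (\<lambda>q. (c *s u q) $ j))))"
        by (rule vf_grad[OF vf regular_at_\<delta>[OF pU] G V(1) p cu])
      moreover have "cls V (\<lambda>q. F (c *s u q)) = rat_const M 0"
      proof -
        have Fp: "F \<in> vec_polys" and F0: "\<And>q. q \<in> V \<Longrightarrow> F (c *s u q) = 0" using F c by (simp_all add: Z_def)
        have "(V, \<lambda>q. F (c *s u q)) \<in> rat_reps M"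
          using reg_vec_poly[OF Fp V(1) cu] V by (simp add: reps_iff)
        then show ?thesis unfolding rat_const_def by (intro cls_eqI reps_const) (use F0 in auto)
      qed
      moreover have "rat_value p (\<delta> A (cls V (\<lambda>q. (c *s u q) $ j))) = c * (\<mu> A p * u p $ j - (A *v u p) $ j)" for j
      proof -
        have "cls V (\<lambda>q. (c *s u q) $ j) = rat_const M c \<otimes>\<^bsub>K\<^esub> cls V (\<lambda>q. u q $ j)"
          unfolding rat_const_def K_mult[OF reps_const urep]
          using V open_sub_points[OF V(1)] by (simp add: Int_absorb1)
        then show ?thesis using du[OF p, of A j]
          by (simp add: vf_mult_const[OF vf] cls_in_K urep value_mult value_const pM local_ring_const
              reg_\<delta>[OF pU] local_ring_cls[OF urep p] dv_def)
      qed
      ultimately have "(\<Sum>j\<in>UNIV. G j (c *s u p) * (c * (\<mu> A p * u p $ j - (A *v u p) $ j))) = 0"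
        by (simp add: vf_const[OF vf] value_const[OF pM])
      also have "(\<Sum>j\<in>UNIV. G j (c *s u p) * (c * (\<mu> A p * u p $ j - (A *v u p) $ j)))
         = c * \<mu> A p * (\<Sum>j\<in>UNIV. G j (c *s u p) * u p $ j) - c * (\<Sum>j\<in>UNIV. G j (c *s u p) * (A *v u p) $ j)"
        by (simp add: sum_distrib_left right_diff_distrib sum_subtractf mult_ac)
      \<comment> \<open>F vanishes at s u for all s other than 0, hence so does its derivative in
        the radial direction at s = c.\<close>
      also have "(\<Sum>j\<in>UNIV. G j (c *s u p) * u p $ j) = 0"
      proof -
        have "((\<lambda>s. F (s *s u p)) has_field_derivative (\<Sum>j\<in>UNIV. G j (c *s u p) * u p $ j)) (at c)"
          by (rule grad_chain[OF G]) (auto intro!: derivative_eq_intros)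
        moreover have "((\<lambda>s. F (s *s u p)) has_field_derivative 0) (at c)"
        proof (rule has_field_derivative_transform_within_open[where S = "- {0}"])
          show "((\<lambda>_. 0) has_field_derivative 0) (at c)" by simp
          show "0 = F (x *s u p)" if "x \<in> - {0}" for x using that F p by (simp add: Z_def)
        qed (use c in auto)
        ultimately show ?thesis by (rule DERIV_unique)
      qed
      also have "(\<Sum>j\<in>UNIV. G j (c *s u p) * (A *v u p) $ j) = G i (c *s u p) * u p $ i\<^sub>0"
        by (simp add: Au if_distrib[of "\<lambda>a. _ * a"] cong: if_cong)
      finally show ?thesis using c u0[OF p] by simp
    qed
    then show ?thesis using grad_polys(2)[OF G] by (simp add: Z_def)
  qed
  obtain p where p: "p \<in> V" using V by blast
  have "F \<in> Z" using F by (auto simp: Z_def homogeneous_polys_def)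
  then show ?thesis
  proof (rule poly_zero_if_derivatives_vanish[rotated 2])
    fix F assume F: "F \<in> Z"
    show "F (u p) = 0" using F p by (auto simp: Z_def dest: spec[of _ 1])
    fix w :: "complex ^ 'm"
    have "F \<in> vec_polys" using F by (simp add: Z_def)
    then obtain G where G: "is_grad F G" using grad_exists by blast
    have "(\<lambda>v. G i v * w $ i) \<in> vec_polys" for i
      by (rule poly_funs.mult[OF grad_polys(2)[OF G] poly_funs.const])
    then have "(\<lambda>v. \<Sum>i\<in>UNIV. G i v * w $ i) \<in> vec_polys" by (rule vec_polys_sum)
    then have "(\<lambda>v. \<Sum>i\<in>UNIV. G i v * w $ i) \<in> Z" using closed[OF F G] by (simp add: Z_def)
    then show "\<exists>G. is_grad F G \<and> (\<lambda>v. \<Sum>i\<in>UNIV. G i v * w $ i) \<in> Z" using G by blast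
  qed
qed

end

section \<open>The rational map to projective space\<close>

text \<open>Products of homogeneous polynomials are homogeneous, so the generating sets are closed
  under intersection up to refinement and form a base.\<close>

lemma proj_zariski_base:
  assumes "openin proj_zariski W" "L \<in> W"
  obtains F d where "F \<in> homogeneous_polys d" "L \<in> proj_basic F" "proj_basic F \<subseteq> W"
proof -
  have "generate_topology_on {{L \<in> proj_points. \<exists>v\<in>L. F v \<noteq> 0} | F d. F \<in> homogeneous_polys d} W"
    using assms(1) unfolding proj_zariski_def openin_topology_generated_by_iff .
  then have "\<forall>L\<in>W. \<exists>F d. F \<in> homogeneous_polys d \<and> L \<in> proj_basic F \<and> proj_basic F \<subseteq> W"
  proof induction
    case (Int a b)
    show ?case
    proof
      fix L assume L: "L \<in> a \<inter> b"
      obtain F d where F: "F \<in> homogeneous_polys d" "L \<in> proj_basic F" "proj_basic F \<subseteq> a" using Int L by blast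
      obtain G e where G: "G \<in> homogeneous_polys e" "L \<in> proj_basic G" "proj_basic G \<subseteq> b" using Int L by blast
      have Lp: "L \<in> proj_points" using F by (simp add: proj_basic_def)
      then obtain v where v: "v \<in> L" "v \<noteq> 0" by (blast elim: proj_points_cases)
      have "L \<in> proj_basic (\<lambda>v. F v * G v)"
        using proj_basic_iff[OF F(1) Lp v] proj_basic_iff[OF G(1) Lp v] F G
          proj_basic_iff[OF homogeneous_polys_closed(3)[OF F(1) G(1)] Lp v] by simp
      moreover have "proj_basic (\<lambda>v. F v * G v) \<subseteq> a \<inter> b" using F(3) G(3) by (auto simp: proj_basic_def)
      ultimately show "\<exists>F d. F \<in> homogeneous_polys d \<and> L \<in> proj_basic F \<and> proj_basic F \<subseteq> a \<inter> b"
        using homogeneous_polys_closed(3)[OF F(1) G(1)] by blast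
    qed
  next
    case (UN k)
    then show ?case by blast
  next
    case (Basis s)
    then show ?case unfolding proj_basic_def by blast
  qed simp
  then show ?thesis using assms(2) that by blast
qed

locale framed_action = column_action M \<delta> U\<^sub>0
  for M :: "'p fspace" and \<delta> :: "complex ^ 'm ^ 'm \<Rightarrow> 'p ratfun \<Rightarrow> 'p ratfun" and U\<^sub>0 +
  fixes V u i\<^sub>0 \<mu>
  assumes frame: "frame V u i\<^sub>0 \<mu>"
begin

lemma
  shows V_open: "openin (zar M) V" and V_ne: "V \<noteq> {}" and V_sub: "V \<subseteq> U\<^sub>0"
    and u_reg: "(\<lambda>p. u p $ i) \<in> reg M V" and u_nz: "p \<in> V \<Longrightarrow> u p $ i\<^sub>0 \<noteq> 0"
    and du: "p \<in> V \<Longrightarrow> dv p A (cls V (\<lambda>p. u p $ i)) = \<mu> A p * u p $ i - (A *v u p) $ i"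
    and dv_eigen: "p \<in> V \<Longrightarrow> \<xi> \<in> local_ring M p \<Longrightarrow> A *v u p = c *s u p \<Longrightarrow> dv p A \<xi> = 0"
  using frame unfolding frame_def by blast+

lemma u_ne: "p \<in> V \<Longrightarrow> u p \<noteq> 0"
  using u_nz by force

definition proj_map :: "'p \<Rightarrow> (complex ^ 'm) set" where
  "proj_map p = vec.span {u p}"

lemma proj_map_in: "p \<in> V \<Longrightarrow> proj_map p \<in> proj_points"
  using u_ne by (auto simp: proj_map_def proj_points_def)

lemma u_in_proj_map: "u p \<in> proj_map p"
  by (simp add: proj_map_def vec.span_base)

lemma proj_map_basic: "F \<in> homogeneous_polys d \<Longrightarrow> p \<in> V \<Longrightarrow> proj_map p \<in> proj_basic F \<longleftrightarrow> F (u p) \<noteq> 0"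
  by (intro proj_basic_iff proj_map_in u_in_proj_map u_ne)

lemma reg_poly_u: "F \<in> homogeneous_polys d \<Longrightarrow> (\<lambda>p. F (u p)) \<in> reg M V"
  using reg_vec_poly[of F V u, OF _ V_open u_reg] by (simp add: homogeneous_polys_def)

lemma open_preimage:
  assumes W: "openin proj_zariski W"
  shows "openin (zar M) (V \<inter> proj_map -` W)"
proof (subst openin_subopen, safe)
  fix p assume p: "p \<in> V" "proj_map p \<in> W"
  obtain F d where F: "F \<in> homogeneous_polys d" "proj_map p \<in> proj_basic F" "proj_basic F \<subseteq> W"
    using proj_zariski_base[OF W p(2)] .
  show "\<exists>T. openin (zar M) T \<and> p \<in> T \<and> T \<subseteq> V \<inter> proj_map -` W"
  proof (intro exI conjI)
    show "openin (zar M) {q \<in> V. F (u q) \<noteq> 0}" by (rule nonzero_open[OF V_open reg_poly_u[OF F(1)]])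
    show "p \<in> {q \<in> V. F (u q) \<noteq> 0}" using p F proj_map_basic[OF F(1)] by auto
    show "{q \<in> V. F (u q) \<noteq> 0} \<subseteq> V \<inter> proj_map -` W" using F(3) proj_map_basic[OF F(1)] by auto
  qed
qed

text \<open>A basic open subset of \<open>W\<close> comes from a polynomial that is not identically
  zero, and by \<open>frame_poly_zero\<close> it is nonzero at some \<open>u p\<close>.\<close>

lemma preimage_nonempty:
  assumes W: "openin proj_zariski W" "W \<noteq> {}"
  shows "V \<inter> proj_map -` W \<noteq> {}"
proof -
  obtain L where L: "L \<in> W" using W by blast
  obtain F d where F: "F \<in> homogeneous_polys d" "L \<in> proj_basic F" "proj_basic F \<subseteq> W"
    using proj_zariski_base[OF W(1) L] .
  have "\<exists>p\<in>V. F (u p) \<noteq> 0"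
    using frame_poly_zero[OF frame F(1)] F(2) by (auto simp: proj_basic_def)
  then show ?thesis using F proj_map_basic[OF F(1)] by auto
qed

lemma reg_pullback:
  assumes W: "openin proj_zariski W" and h: "h \<in> reg CP W"
  shows "h \<circ> proj_map \<in> reg M (V \<inter> proj_map -` W)"
proof (rule reg_local)
  fix p assume p: "p \<in> V \<inter> proj_map -` W"
  then obtain V' where V': "proj_map p \<in> V'" "V' \<subseteq> W" "proj_fraction V' h" using h unfolding reg_CP by blast
  then obtain d F G where FG: "openin proj_zariski V'" "F \<in> homogeneous_polys d" "G \<in> homogeneous_polys d"
       "\<And>L v. L \<in> V' \<Longrightarrow> v \<in> L - {0} \<Longrightarrow> G v \<noteq> 0 \<and> h L = F v / G v" unfolding proj_fraction_def by blast
  let ?T = "V \<inter> proj_map -` V'"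
  have T: "openin (zar M) ?T" by (rule open_preimage[OF FG(1)])
  have eq: "G (u q) \<noteq> 0 \<and> h (proj_map q) = F (u q) / G (u q)" if "q \<in> ?T" for q
    using that FG(4)[of "proj_map q" "u q"] u_in_proj_map u_ne by auto
  show "\<exists>T g. openin (zar M) T \<and> p \<in> T \<and> T \<subseteq> V \<inter> proj_map -` W \<and> g \<in> reg M T \<and> (\<forall>y\<in>T. (h \<circ> proj_map) y = g y)"
  proof (intro exI conjI ballI)
    show "(\<lambda>q. F (u q) / G (u q)) \<in> reg M ?T"
      using eq FG by (intro reg_divide T) (auto intro: reg_restrict[OF V_open T _ reg_poly_u])
  qed (use T p V' eq in auto)
qed

lemma dominant: "dominant_rational_map M CP V proj_map"
  unfolding dominant_rational_map_def
proof (intro conjI V_open V_ne)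
  have pts: "points (open_subspace M V) = V"
    using open_sub_points[OF V_open] by (auto simp: points_def open_subspace_def)
  show "morphism (open_subspace M V) CP proj_map"
    unfolding morphism_def
  proof (intro conjI allI impI)
    show "continuous_map (zar (open_subspace M V)) (zar CP) proj_map"
      unfolding continuous_map_def
    proof (intro conjI ballI allI impI Pi_I)
      fix p assume "p \<in> topspace (zar (open_subspace M V))"
      then have "p \<in> V" by (simp add: open_subspace_def)
      then show "proj_map p \<in> topspace (zar CP)" by (simp add: zar_CP topspace_proj_zariski proj_map_in)
    next
      fix W :: "(complex ^ 'm) set set" assume "openin (zar CP) W"
      then have "openin (zar M) (V \<inter> proj_map -` W)" using open_preimage by (simp add: zar_CP)
      moreover have "{x \<in> topspace (zar (open_subspace M V)). proj_map x \<in> W} = V \<inter> proj_map -` W"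
        using pts by (auto simp: points_def)
      ultimately show "openin (zar (open_subspace M V)) {x \<in> topspace (zar (open_subspace M V)). proj_map x \<in> W}"
        using V_open by (simp add: open_subspace_def openin_open_subtopology)
    qed
    fix W and h :: "(complex ^ 'm) set \<Rightarrow> complex" assume "openin (zar CP) W \<and> h \<in> reg CP W"
    then show "h \<circ> proj_map \<in> reg (open_subspace M V) (points (open_subspace M V) \<inter> proj_map -` W)"
      using reg_pullback unfolding pts by (simp add: zar_CP open_subspace_def)
  qed
  show "zar CP closure_of proj_map ` V = points CP"
  proof (rule ccontr)
    assume ne: "\<not> ?thesis"
    let ?W = "points (CP :: (complex ^ 'm) set fspace) - zar CP closure_of proj_map ` V"
    have "?W \<noteq> {}" using ne closure_of_subset_topspace[of "zar CP" "proj_map ` V"] by (auto simp: points_def)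
    moreover have "openin proj_zariski ?W"
      unfolding points_def zar_CP by (intro openin_diff openin_topspace closedin_closure_of)
    ultimately have "V \<inter> proj_map -` ?W \<noteq> {}" by (rule preimage_nonempty[rotated])
    then obtain p where p: "p \<in> V" "proj_map p \<in> ?W" by blast
    have "proj_map ` V \<subseteq> topspace (zar CP)" using proj_map_in by (auto simp: zar_CP topspace_proj_zariski)
    then have "proj_map p \<in> zar CP closure_of proj_map ` V" using closure_of_subset p by blast
    then show False using p by blast
  qed
qed

text \<open>Preimages of two nonempty open sets are nonempty and open in M, hence meet; so
  irreducibility descends from M.\<close>

lemma rat_space_CP: "rat_space (CP :: (complex ^ 'm) set fspace)"
proof -
  interpret CP: fn_space "CP :: (complex ^ 'm) set fspace" by (rule fn_space_CP)
  show ?thesis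
  proof
    show "points (CP :: (complex ^ 'm) set fspace) \<noteq> {}"
      using V_ne proj_map_in by (auto simp: points_def zar_CP topspace_proj_zariski)
    fix W W' :: "(complex ^ 'm) set set" assume W: "openin (zar CP) W" "openin (zar CP) W'" "W \<noteq> {}" "W' \<noteq> {}"
    have "(V \<inter> proj_map -` W) \<inter> (V \<inter> proj_map -` W') \<noteq> {}"
      using W by (intro irreducible open_preimage preimage_nonempty) (auto simp: zar_CP)
    then show "W \<inter> W' \<noteq> {}" by blast
  qed
qed

sublocale CP: rat_space "CP :: (complex ^ 'm) set fspace"
  by (rule rat_space_CP)

end

section \<open>One-parameter groups of matrices\<close>

primrec matrix_pow :: "complex ^ 'm ^ 'm \<Rightarrow> nat \<Rightarrow> complex ^ 'm ^ 'm" where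
  "matrix_pow A 0 = mat 1"
| "matrix_pow A (Suc k) = A ** matrix_pow A k"

definition matrix_exp :: "complex ^ 'm ^ 'm \<Rightarrow> complex \<Rightarrow> complex ^ 'm ^ 'm" where
  "matrix_exp A t = (\<chi> i j. \<Sum>k. (matrix_pow A k $ i $ j / fact k) * t ^ k)"

lemma matrix_pow_bound:
  fixes A :: "complex ^ 'm ^ 'm"
  assumes "\<And>i j. norm (A $ i $ j) \<le> a"
  shows "norm (matrix_pow A k $ i $ j) \<le> (of_nat CARD('m) * a) ^ k"
proof (induction k arbitrary: i)
  case 0
  show ?case by (simp add: mat_def)
next
  case (Suc k)
  have a: "0 \<le> a" using assms[of i i] norm_ge_zero order_trans by blast
  have "norm (matrix_pow A (Suc k) $ i $ j) \<le> (\<Sum>l\<in>UNIV. norm (A $ i $ l * matrix_pow A k $ l $ j))"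
    by (simp add: matrix_matrix_mult_def) (rule norm_sum)
  also have "\<dots> \<le> (\<Sum>l\<in>(UNIV :: 'm set). a * (of_nat CARD('m) * a) ^ k)"
    by (intro sum_mono) (auto simp: norm_mult intro!: mult_mono Suc.IH assms a)
  also have "\<dots> = (of_nat CARD('m) * a) ^ Suc k" by simp
  finally show ?case .
qed

lemma matrix_exp_summable:
  fixes A :: "complex ^ 'm ^ 'm"
  shows "summable (\<lambda>k. (matrix_pow A k $ i $ j / fact k) * t ^ k)"
proof -
  define a where "a = (\<Sum>i\<in>UNIV. \<Sum>j\<in>UNIV. norm (A $ i $ j))"
  have a: "norm (A $ i $ j) \<le> a" for i j
  proof -
    have "norm (A $ i $ j) \<le> (\<Sum>j\<in>UNIV. norm (A $ i $ j))" by (rule member_le_sum) auto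
    also have "\<dots> \<le> a" unfolding a_def by (rule member_le_sum) (auto intro: sum_nonneg)
    finally show ?thesis .
  qed
  show ?thesis
  proof (rule summable_comparison_test')
    show "summable (\<lambda>k. inverse (fact k) * (of_nat CARD('m) * a * norm t) ^ k)" by (rule summable_exp)
    show "norm ((matrix_pow A k $ i $ j / fact k) * t ^ k) \<le> inverse (fact k) * (of_nat CARD('m) * a * norm t) ^ k" for k
      using mult_right_mono[OF matrix_pow_bound[OF a, of k i j], of "norm t ^ k / fact k"]
      by (simp add: norm_mult norm_divide norm_power power_mult_distrib field_simps)
  qed
qed

lemma matrix_exp_derivative:
  "((\<lambda>t. matrix_exp A t $ i $ j) has_field_derivative (A ** matrix_exp A t) $ i $ j) (at t)"
proof -
  define c where "c i j k = matrix_pow A k $ i $ j / fact k" for i j k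
  have s: "summable (\<lambda>k. c i j k * t ^ k)" for i j t unfolding c_def by (rule matrix_exp_summable)
  have d: "diffs (c i j) k * t ^ k = (\<Sum>l\<in>UNIV. A $ i $ l * (c l j k * t ^ k))" for k
  proof -
    have "diffs (c i j) k = (A ** matrix_pow A k) $ i $ j / fact k"
      by (simp add: diffs_def c_def del: of_nat_Suc)
    then show ?thesis
      by (simp add: matrix_matrix_mult_def c_def sum_divide_distrib sum_distrib_right sum_distrib_left mult_ac)
  qed
  have "((\<lambda>t. \<Sum>k. c i j k * t ^ k) has_field_derivative (\<Sum>k. diffs (c i j) k * t ^ k)) (at t)"
    by (rule termdiffs_strong_converges_everywhere[OF s])
  also have "(\<Sum>k. diffs (c i j) k * t ^ k) = (\<Sum>l\<in>UNIV. A $ i $ l * (\<Sum>k. c l j k * t ^ k))"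
    unfolding d by (subst suminf_sum) (auto intro: summable_mult s simp: suminf_mult[OF s])
  finally show ?thesis by (simp add: matrix_exp_def c_def matrix_matrix_mult_def)
qed

lemma matrix_exp_0: "matrix_exp A 0 = mat 1"
proof -
  have "matrix_exp A 0 $ i $ j = mat 1 $ i $ j" for i j
    unfolding matrix_exp_def vec_lambda_beta powser_zero by simp
  then show ?thesis by (simp add: vec_eq_iff)
qed

lemma matrix_vector_derivative:
  assumes "\<And>j. ((\<lambda>t. B t $ i $ j) has_field_derivative (B' :: complex ^ 'm ^ 'm) $ i $ j) (at t)"
  shows "((\<lambda>t. (B t *v y) $ i) has_field_derivative (B' *v y) $ i) (at t)"
  unfolding matrix_vector_mult_def vec_lambda_beta by (intro DERIV_sum DERIV_cmult_right assms)

text \<open>The derivative of the pairing of c with g is the pairing of c A with g, so every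
  derivative of such a pairing vanishes at 0, and the pairing is entire.\<close>

lemma linear_ode_zero:
  fixes g :: "complex \<Rightarrow> complex ^ 'm"
  assumes g: "\<And>t i. ((\<lambda>t. g t $ i) has_field_derivative (A *v g t) $ i) (at t)" and g0: "g 0 = 0"
  shows "g t = 0"
proof -
  have lin: "((\<lambda>t. cdot c (g t)) has_field_derivative cdot (c v* A) (g t)) (at t)" for c t
    unfolding cdot_matrix unfolding cdot_def by (intro DERIV_sum DERIV_cmult g)
  have z: "(deriv ^^ k) (\<lambda>t. cdot c (g t)) 0 = 0" for k c
  proof (induction k arbitrary: c)
    case 0
    show ?case by (simp add: g0)
  next
    case (Suc k)
    have "deriv (\<lambda>t. cdot c (g t)) = (\<lambda>t. cdot (c v* A) (g t))" using lin DERIV_imp_deriv by blast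
    then show ?case using Suc.IH by (simp only: funpow_Suc_right comp_apply)
  qed
  have "(\<lambda>t. cdot c (g t)) holomorphic_on UNIV" for c
    using lin unfolding holomorphic_on_def field_differentiable_def by auto
  from holomorphic_fun_eq_0_on_connected[OF this open_UNIV connected_UNIV z, of t]
  have "cdot c (g t) = cdot c 0" for c by simp
  then show ?thesis by (rule cdot_ext)
qed

text \<open>As functions of one parameter, both sides applied to a vector solve g' = A g with the
  same initial value.\<close>

lemma matrix_exp_add: "matrix_exp A (s + t) = matrix_exp A s ** matrix_exp A t"
proof -
  have "matrix_exp A (t + s) *v x - matrix_exp A t *v (matrix_exp A s *v x) = 0" for x t s
  proof (rule linear_ode_zero[of "\<lambda>t. matrix_exp A (t + s) *v x - matrix_exp A t *v (matrix_exp A s *v x)" A])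
    fix t i
    have 1: "((\<lambda>t. matrix_exp A (t + s) $ i $ j) has_field_derivative (A ** matrix_exp A (t + s)) $ i $ j) (at t)" for j
      using DERIV_shift[of "\<lambda>t. matrix_exp A t $ i $ j" _ t s] matrix_exp_derivative[of A i j "t + s"] by simp
    have "((\<lambda>t. (matrix_exp A (t + s) *v x - matrix_exp A t *v (matrix_exp A s *v x)) $ i)
       has_field_derivative ((A ** matrix_exp A (t + s)) *v x - (A ** matrix_exp A t) *v (matrix_exp A s *v x)) $ i) (at t)"
      unfolding vector_minus_component
      by (intro DERIV_diff matrix_vector_derivative 1 matrix_exp_derivative)
    then show "((\<lambda>t. (matrix_exp A (t + s) *v x - matrix_exp A t *v (matrix_exp A s *v x)) $ i)
       has_field_derivative (A *v (matrix_exp A (t + s) *v x - matrix_exp A t *v (matrix_exp A s *v x))) $ i) (at t)"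
      by (simp only: matrix_vector_mult_diff_distrib matrix_vector_mul_assoc matrix_mul_assoc)
  qed (simp add: matrix_exp_0)
  then have "matrix_exp A (t + s) *v x = (matrix_exp A t ** matrix_exp A s) *v x" for x t s
    by (simp add: matrix_vector_mul_assoc)
  then show ?thesis by (simp add: matrix_eq)
qed

lemma one_parameter_matrix_exp: "one_parameter_subgroup (matrix_exp A)"
  unfolding one_parameter_subgroup_def
proof (intro conjI allI)
  show "(\<lambda>t. matrix_exp A t $ i $ j) holomorphic_on UNIV" for i j
    using matrix_exp_derivative unfolding holomorphic_on_def field_differentiable_def by blast
qed (rule matrix_exp_0 matrix_exp_add)+

section \<open>Projective vector fields\<close>

text \<open>With F' the gradient of F, this is the derivative of F along the linear vector field v
  \<mapsto> C v.\<close>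

definition along :: "(complex ^ 'm \<Rightarrow> complex) \<Rightarrow> ('m \<Rightarrow> complex ^ 'm \<Rightarrow> complex) \<Rightarrow> complex ^ 'm ^ 'm \<Rightarrow> complex ^ 'm \<Rightarrow> complex" where
  "along F F' C v = (\<Sum>i\<in>UNIV. F' i v * (C *v v) $ i)"

text \<open>A linear field commutes with dilations: moving c v along C is c times moving v along C.
  Differentiating the homogeneity relation at t = 0 gives the same degree.\<close>

lemma along_homogeneous:
  assumes F: "F \<in> homogeneous_polys d" and F': "is_grad F F'"
  shows "along F F' C \<in> homogeneous_polys d"
proof -
  have lin: "(\<lambda>v. (C *v v) $ i) \<in> vec_polys" for i
  proof -
    have "(\<lambda>v. C $ i $ j * v $ j) \<in> vec_polys" for j
      by (rule poly_funs.mult[OF poly_funs.const]) (rule poly_funs.gen, blast)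
    then show ?thesis unfolding matrix_vector_mult_def vec_lambda_beta by (rule vec_polys_sum)
  qed
  have "(\<lambda>v. \<Sum>i\<in>UNIV. F' i v * (C *v v) $ i) \<in> vec_polys"
    by (rule vec_polys_sum, rule poly_funs.mult[OF grad_polys(2)[OF F'] lin])
  then have "along F F' C \<in> vec_polys" unfolding along_def .
  moreover have "along F F' C (c *s v) = c ^ d * along F F' C v" for c v
  proof -
    have 1: "((\<lambda>t. F (w + t *s (C *v w))) has_field_derivative along F F' C w) (at 0)" for w
      using grad_chain[OF F' line_has_derivative[of w "C *v w" _ 0]] by (simp add: along_def)
    have "((\<lambda>t. F (c *s v + t *s (C *v (c *s v)))) has_field_derivative along F F' C (c *s v)) (at 0)" by (rule 1)
    also have "(\<lambda>t. F (c *s v + t *s (C *v (c *s v)))) = (\<lambda>t. c ^ d * F (v + t *s (C *v v)))"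
    proof
      fix t
      have "c *s v + t *s (C *v (c *s v)) = c *s (v + t *s (C *v v))"
        by (simp add: vec_eq_iff matrix_vector_mult_def sum_distrib_left algebra_simps)
      then show "F (c *s v + t *s (C *v (c *s v))) = c ^ d * F (v + t *s (C *v v))"
        by (simp only: homogeneous_scale[OF F])
    qed
    finally show ?thesis using DERIV_cmult[OF 1[of v], of "c ^ d"] by (rule DERIV_unique)
  qed
  ultimately show ?thesis by (simp add: homogeneous_polys_def)
qed

lemma euler_homogeneous:
  assumes F: "F \<in> homogeneous_polys d" and F': "is_grad F F'"
  shows "(\<Sum>i\<in>UNIV. F' i v * v $ i) = of_nat d * F v"
proof -
  have "((\<lambda>s. F (s *s v)) has_field_derivative (\<Sum>i\<in>UNIV. F' i (1 *s v) * v $ i)) (at 1)"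
    by (rule grad_chain[OF F']) (auto intro!: derivative_eq_intros)
  moreover have "((\<lambda>s. s ^ d * F v) has_field_derivative of_nat d * F v) (at 1)"
    by (auto intro!: derivative_eq_intros)
  ultimately show ?thesis using DERIV_unique by (fastforce simp: homogeneous_scale[OF F])
qed

lemma reg_CP_fraction:
  assumes "h \<in> reg CP W" "L \<in> W"
  obtains V d F G where "L \<in> V" "V \<subseteq> W" "openin proj_zariski V"
    "F \<in> homogeneous_polys d" "G \<in> homogeneous_polys d"
    "\<And>L v. L \<in> V \<Longrightarrow> v \<in> L - {0} \<Longrightarrow> G v \<noteq> 0 \<and> h L = F v / G v"
proof -
  have "\<forall>x\<in>W. \<exists>V. x \<in> V \<and> V \<subseteq> W \<and> proj_fraction V h" using assms(1) by (simp add: reg_CP)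
  from bspec[OF this assms(2)] obtain V where V: "L \<in> V" "V \<subseteq> W" "proj_fraction V h" by (elim exE conjE)
  from V(3) obtain d F G where FG: "openin proj_zariski V" "F \<in> homogeneous_polys d" "G \<in> homogeneous_polys d"
     "\<forall>L'\<in>V. \<forall>v\<in>L' - {0}. G v \<noteq> 0 \<and> h L' = F v / G v"
    unfolding proj_fraction_def by (elim exE conjE)
  show ?thesis by (rule that[OF V(1,2) FG(1-3)]) (use FG(4) in auto)
qed

locale one_parameter =
  fixes \<gamma> :: "complex \<Rightarrow> complex ^ 'm ^ 'm"
  assumes one_parameter: "one_parameter_subgroup \<gamma>"
begin

definition generator :: "complex ^ 'm ^ 'm" where
  "generator = (\<chi> i j. deriv (\<lambda>t. \<gamma> t $ i $ j) 0)"

definition flow_deriv :: "((complex ^ 'm) set \<Rightarrow> complex) \<Rightarrow> (complex ^ 'm) set \<Rightarrow> complex" where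
  "flow_deriv h L = deriv (\<lambda>t. h ((*v) (\<gamma> t) ` L)) 0"

lemma \<gamma>_0: "\<gamma> 0 = mat 1" and \<gamma>_inverse: "\<gamma> (- t) ** \<gamma> t = mat 1"
  using one_parameter unfolding one_parameter_subgroup_def by (auto, metis add.left_inverse)

lemma \<gamma>_deriv: "((\<lambda>t. \<gamma> t $ i $ j) has_field_derivative generator $ i $ j) (at 0)"
  using one_parameter unfolding one_parameter_subgroup_def generator_def
  by (auto intro: holomorphic_derivI[OF _ open_UNIV])

lemma \<gamma>_vec_deriv: "((\<lambda>t. (\<gamma> t *v v) $ i) has_field_derivative (generator *v v) $ i) (at 0)"
  by (rule matrix_vector_derivative[OF \<gamma>_deriv])

lemma \<gamma>_nonzero: "v \<noteq> 0 \<Longrightarrow> \<gamma> t *v v \<noteq> 0"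
  by (metis \<gamma>_inverse matrix_vector_mul_assoc matrix_vector_mul_lid matrix_vector_mult_0_right)

lemma \<gamma>_proj: 
  assumes "L \<in> proj_points" "v \<in> L" "v \<noteq> 0"
  shows "(*v) (\<gamma> t) ` L \<in> proj_points" "\<gamma> t *v v \<in> (*v) (\<gamma> t) ` L - {0}"
proof -
  show "\<gamma> t *v v \<in> (*v) (\<gamma> t) ` L - {0}" using assms \<gamma>_nonzero by blast
  obtain w where w: "w \<noteq> 0" "L = vec.span {w}" using assms(1) by (rule proj_points_cases)
  have "(*v) (\<gamma> t) ` L = vec.span {\<gamma> t *v w}"
    unfolding w vec.span_singleton by (auto simp: matrix_vector_mult_def vec_eq_iff sum_distrib_left image_iff mult_ac)
  then show "(*v) (\<gamma> t) ` L \<in> proj_points" using \<gamma>_nonzero[OF w(1)] unfolding proj_points_def by blast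
qed

text \<open>A polynomial nonzero at v stays nonzero at \<gamma> t v for small t, by continuity. This
  makes differentiation along the flow a local operation although \<open>W\<close> is only Zariski
  open.\<close>

lemma flow_stays:
  assumes W: "openin proj_zariski W" and L: "L \<in> W"
  obtains T where "open T" "0 \<in> T" "\<And>t. t \<in> T \<Longrightarrow> (*v) (\<gamma> t) ` L \<in> W"
proof -
  obtain F d where F: "F \<in> homogeneous_polys d" "L \<in> proj_basic F" "proj_basic F \<subseteq> W"
    using proj_zariski_base[OF W L] .
  have Lp: "L \<in> proj_points" using F by (simp add: proj_basic_def)
  then obtain v where v: "v \<in> L" "v \<noteq> 0" by (blast elim: proj_points_cases)
  have "F \<in> vec_polys" using F(1) by (simp add: homogeneous_polys_def)
  then obtain F' where F': "is_grad F F'" using grad_exists by blast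
  have "isCont (\<lambda>t. F (\<gamma> t *v v)) 0"
    by (rule DERIV_isCont[OF grad_chain[OF F' \<gamma>_vec_deriv]])
  moreover have "F (\<gamma> 0 *v v) \<noteq> 0" using proj_basic_iff[OF F(1) Lp v] F(2) by (simp add: \<gamma>_0)
  ultimately have "eventually (\<lambda>t. F (\<gamma> t *v v) \<noteq> 0) (nhds 0)"
    unfolding isCont_def eventually_nhds_conv_at by (simp add: tendsto_imp_eventually_ne)
  then obtain T where T: "open T" "0 \<in> T" "\<And>t. t \<in> T \<Longrightarrow> F (\<gamma> t *v v) \<noteq> 0"
    by (auto simp: eventually_nhds)
  show ?thesis
  proof (rule that[OF T(1,2)])
    fix t assume t: "t \<in> T"
    have "(*v) (\<gamma> t) ` L \<in> proj_basic F"
      using proj_basic_iff[OF F(1) \<gamma>_proj(1)[OF Lp v, of t], of "\<gamma> t *v v"] \<gamma>_proj(2)[OF Lp v, of t] T(3)[OF t] by blast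
    then show "(*v) (\<gamma> t) ` L \<in> W" using F(3) by blast
  qed
qed

lemma flow_deriv_cong:
  assumes "openin proj_zariski W" "L \<in> W" "\<And>L. L \<in> W \<Longrightarrow> h L = h' L"
  shows "flow_deriv h L = flow_deriv h' L"
proof -
  obtain T where T: "open T" "0 \<in> T" "\<And>t. t \<in> T \<Longrightarrow> (*v) (\<gamma> t) ` L \<in> W"
    by (rule flow_stays[OF assms(1,2)]) blast
  show ?thesis unfolding flow_deriv_def
    by (rule deriv_cong_ev) (use T assms(3) in \<open>auto simp: eventually_nhds\<close>)
qed

lemma flow_deriv_fraction:
  assumes W: "openin proj_zariski W" and L: "L \<in> W" and v: "v \<in> L" "v \<noteq> 0"
    and h: "\<And>L v. L \<in> W \<Longrightarrow> v \<in> L - {0} \<Longrightarrow> G v \<noteq> 0 \<and> h L = F v / G v"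
    and F': "is_grad F F'" and G': "is_grad G G'"
  shows "((\<lambda>t. h ((*v) (\<gamma> t) ` L)) has_field_derivative
      (along F F' generator v * G v - F v * along G G' generator v) / (G v * G v)) (at 0)"
proof -
  obtain T where T: "open T" "0 \<in> T" "\<And>t. t \<in> T \<Longrightarrow> (*v) (\<gamma> t) ` L \<in> W"
    by (rule flow_stays[OF W L]) blast
  have Lp: "L \<in> proj_points" using L openin_subset[OF W] topspace_proj_zariski by blast
  have "((\<lambda>t. F (\<gamma> t *v v) / G (\<gamma> t *v v)) has_field_derivative
      (along F F' generator v * G v - F v * along G G' generator v) / (G v * G v)) (at 0)"
    using DERIV_divide[OF grad_chain[OF F' \<gamma>_vec_deriv[of v]] grad_chain[OF G' \<gamma>_vec_deriv[of v]]] h[OF L, of v] v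
    by (simp add: along_def \<gamma>_0)
  then show ?thesis
  proof (rule has_field_derivative_transform_within_open[OF _ T(1,2)])
    fix t assume "t \<in> T"
    then show "F (\<gamma> t *v v) / G (\<gamma> t *v v) = h ((*v) (\<gamma> t) ` L)"
      using h[OF T(3) \<gamma>_proj(2)[OF Lp v]] by simp
  qed
qed

text \<open>The quotient rule expresses the derivative as a fraction whose numerator and denominator
  \<open>G v * G v\<close> both have degree 2 d.\<close>

lemma reg_flow:
  assumes W: "openin proj_zariski W" and h: "h \<in> reg CP W"
  shows "flow_deriv h \<in> reg CP W"
    and "L \<in> W \<Longrightarrow> ((\<lambda>t. h ((*v) (\<gamma> t) ` L)) has_field_derivative flow_deriv h L) (at 0)"
proof -
  have loc: "\<exists>V. L \<in> V \<and> V \<subseteq> W \<and> proj_fraction V (flow_deriv h) \<and>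
      ((\<lambda>t. h ((*v) (\<gamma> t) ` L)) has_field_derivative flow_deriv h L) (at 0)" if LW: "L \<in> W" for L
  proof -
    obtain V d F G where V: "L \<in> V" "V \<subseteq> W" and FG: "openin proj_zariski V"
       "F \<in> homogeneous_polys d" "G \<in> homogeneous_polys d"
       "\<And>L v. L \<in> V \<Longrightarrow> v \<in> L - {0} \<Longrightarrow> G v \<noteq> 0 \<and> h L = F v / G v"
      by (rule reg_CP_fraction[OF h LW]) blast
    have Vp: "L \<in> proj_points" if "L \<in> V" for L using that openin_subset[OF FG(1)] topspace_proj_zariski by blast
    have "F \<in> vec_polys" "G \<in> vec_polys" using FG by (auto simp: homogeneous_polys_def)
    then obtain F' G' where F': "is_grad F F'" and G': "is_grad G G'" using grad_exists by blast
    have der: "((\<lambda>t. h ((*v) (\<gamma> t) ` L)) has_field_derivative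
        (along F F' generator v * G v - F v * along G G' generator v) / (G v * G v)) (at 0)"
      if "L \<in> V" "v \<in> L" "v \<noteq> 0" for L v
      by (rule flow_deriv_fraction[OF FG(1) that _ F' G']) (rule FG(4))
    let ?N = "\<lambda>v. along F F' generator v * G v + (-1) * (F v * along G G' generator v)"
    have N1: "(\<lambda>v. F v * along G G' generator v) \<in> homogeneous_polys (d + d)"
      by (rule homogeneous_polys_closed(3)[OF FG(2) along_homogeneous[OF FG(3) G']])
    have N2: "(\<lambda>v. (-1) * (F v * along G G' generator v)) \<in> homogeneous_polys (d + d)"
      using homogeneous_polys_closed(3)[OF homogeneous_polys_closed(1) N1, of "-1"] by simp
    have N: "?N \<in> homogeneous_polys (d + d)"
      by (rule homogeneous_polys_closed(2)[OF homogeneous_polys_closed(3)[OF along_homogeneous[OF FG(2) F'] FG(3)] N2])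
    have "proj_fraction V (flow_deriv h)"
    proof (rule proj_fractionI[OF FG(1) N homogeneous_polys_closed(3)[OF FG(3) FG(3)]])
      fix L v assume L: "L \<in> V" "v \<in> L - {0}"
      show "G v * G v \<noteq> 0" using FG(4)[OF L] by simp
      show "flow_deriv h L = ?N v / (G v * G v)"
        unfolding flow_deriv_def using DERIV_imp_deriv[OF der[OF L(1), of v]] L(2) by auto
    qed
    moreover obtain v where v: "v \<in> L" "v \<noteq> 0" using Vp[OF V(1)] by (blast elim: proj_points_cases)
    then have "((\<lambda>t. h ((*v) (\<gamma> t) ` L)) has_field_derivative flow_deriv h L) (at 0)"
      using der[OF V(1) v] DERIV_imp_deriv[OF der[OF V(1) v]] unfolding flow_deriv_def by metis
    ultimately show ?thesis using V by blast
  qed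
  show "flow_deriv h \<in> reg CP W"
    unfolding reg_CP
  proof (intro CollectI ballI)
    fix L assume "L \<in> W"
    from loc[OF this] show "\<exists>V. L \<in> V \<and> V \<subseteq> W \<and> proj_fraction V (flow_deriv h)" by blast
  qed
  show "L \<in> W \<Longrightarrow> ((\<lambda>t. h ((*v) (\<gamma> t) ` L)) has_field_derivative flow_deriv h L) (at 0)"
    using loc by blast
qed

text \<open>Membership in \<open>projective_vector_fields\<close> presupposes a derivation on
  classes. It is constructed here by differentiating representatives along the flow.\<close>

lemma projective_field_exists:
  assumes "rat_space (CP :: (complex ^ 'm) set fspace)"
  obtains Y where "Y \<in> projective_vector_fields"
    "\<And>W h. (W, h) \<in> rat_reps CP \<Longrightarrow> Y (rat_class CP W h) = rat_class CP W (flow_deriv h)"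
proof -
  interpret CP: rat_space "CP :: (complex ^ 'm) set fspace" by (rule assms)
  have rep: "(W, flow_deriv h) \<in> rat_reps CP" if "(W, h) \<in> rat_reps CP" for W h
    using that reg_flow(1) by (auto simp: CP.reps_iff zar_CP)
  \<comment> \<open>The chosen representative is immaterial: two representatives agree on an open
    set in which the flow stays for small times.\<close>
  define Y where "Y = (\<lambda>\<xi>\<in>carrier CP.K. let r = (SOME r. r \<in> \<xi>) in CP.cls (fst r) (flow_deriv (snd r)))"
  have Y: "Y (CP.cls W h) = CP.cls W (flow_deriv h)" if r: "(W, h) \<in> rat_reps CP" for W h
  proof -
    define s where "s = (SOME r. r \<in> CP.cls W h)"
    have "(W, h) \<in> CP.cls W h" using r by (simp add: CP.mem_cls)
    then have "s \<in> CP.cls W h" unfolding s_def by (rule someI)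
    then have s: "(fst s, snd s) \<in> rat_reps CP" "\<And>x. x \<in> W \<inter> fst s \<Longrightarrow> h x = snd s x"
      using CP.mem_cls[OF r, of "fst s" "snd s"] by auto
    have "CP.cls (fst s) (flow_deriv (snd s)) = CP.cls W (flow_deriv h)"
    proof (rule CP.cls_eqI[OF rep[OF s(1)] rep[OF r]])
      fix x assume "x \<in> fst s" "x \<in> W"
      moreover have "openin proj_zariski (W \<inter> fst s)" using CP.reps_Int(1)[OF r s(1)] by (simp add: zar_CP)
      ultimately show "flow_deriv (snd s) x = flow_deriv h x"
        using s(2) by (intro flow_deriv_cong[of "W \<inter> fst s"]) auto
    qed
    then show ?thesis using CP.cls_in_K[OF r] by (simp add: Y_def s_def Let_def)
  qed
  have der: "((\<lambda>t. h ((*v) (\<gamma> t) ` L)) has_field_derivative flow_deriv h L) (at 0)"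
    if "(W, h) \<in> rat_reps CP" "L \<in> W" for W h L
    using that reg_flow(2) by (auto simp: CP.reps_iff zar_CP)
  have "Y \<in> rat_vector_fields CP"
    unfolding rat_vector_fields_def Let_def
  proof (intro CollectI conjI allI ballI)
    show "Y \<in> carrier CP.K \<rightarrow>\<^sub>E carrier CP.K"
    proof
      fix \<xi> assume "\<xi> \<in> carrier CP.K"
      then obtain W h where "(W, h) \<in> rat_reps CP" "\<xi> = CP.cls W h" by (rule CP.K_cases)
      then show "Y \<xi> \<in> carrier CP.K" using Y rep CP.cls_in_K by auto
    qed (simp add: Y_def)
    show "Y (rat_const CP c) = \<zero>\<^bsub>CP.K\<^esub>" for c
      unfolding rat_const_def Y[OF CP.reps_const] CP.K_zero
      by (intro CP.cls_eqI CP.reps_const rep) (simp add: flow_deriv_def)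
    fix \<xi> \<eta> assume "\<xi> \<in> carrier CP.K" "\<eta> \<in> carrier CP.K"
    then obtain W h W' h' where r: "(W, h) \<in> rat_reps CP" "\<xi> = CP.cls W h"
       and r': "(W', h') \<in> rat_reps CP" "\<eta> = CP.cls W' h'" by (metis CP.K_cases)
    show "Y (\<xi> \<oplus>\<^bsub>CP.K\<^esub> \<eta>) = Y \<xi> \<oplus>\<^bsub>CP.K\<^esub> Y \<eta>"
      unfolding r(2) r'(2) CP.K_add[OF r(1) r'(1)] Y[OF r(1)] Y[OF r'(1)] Y[OF CP.reps_add[OF r(1) r'(1)]]
        CP.K_add[OF rep[OF r(1)] rep[OF r'(1)]]
    proof (intro CP.cls_eqI CP.reps_add rep r r')
      fix x assume x: "x \<in> W \<inter> W'"
      then show "flow_deriv (\<lambda>x. h x + h' x) x = flow_deriv h x + flow_deriv h' x"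
        using DERIV_imp_deriv[OF DERIV_add[OF der[OF r(1)] der[OF r'(1)]], of x x] by (simp add: flow_deriv_def)
    qed
    have z: "(*v) (\<gamma> 0) ` x = x" for x :: "(complex ^ 'm) set" by (simp add: \<gamma>_0)
    show "Y (\<xi> \<otimes>\<^bsub>CP.K\<^esub> \<eta>) = (\<xi> \<otimes>\<^bsub>CP.K\<^esub> Y \<eta>) \<oplus>\<^bsub>CP.K\<^esub> (\<eta> \<otimes>\<^bsub>CP.K\<^esub> Y \<xi>)"
      unfolding r(2) r'(2) CP.K_mult[OF r(1) r'(1)] Y[OF r(1)] Y[OF r'(1)] Y[OF CP.reps_mult[OF r(1) r'(1)]]
        CP.K_mult[OF r(1) rep[OF r'(1)]] CP.K_mult[OF r'(1) rep[OF r(1)]]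
        CP.K_add[OF CP.reps_mult[OF r(1) rep[OF r'(1)]] CP.reps_mult[OF r'(1) rep[OF r(1)]]]
    proof (intro CP.cls_eqI CP.reps_add CP.reps_mult rep r r')
      fix x assume x: "x \<in> W \<inter> W'"
      then show "flow_deriv (\<lambda>x. h x * h' x) x = h x * flow_deriv h' x + h' x * flow_deriv h x"
        using DERIV_imp_deriv[OF DERIV_mult[OF der[OF r(1)] der[OF r'(1)]], of x x]
        by (simp add: flow_deriv_def z mult.commute)
    qed
  qed
  then have "Y \<in> projective_vector_fields"
    unfolding projective_vector_fields_def using one_parameter Y unfolding flow_deriv_def by blast
  then show ?thesis using Y by (rule that)
qed

end

section \<open>Pulling back projective vector fields\<close>

context framed_action
begin

lemma pullback_rep:
  assumes "(W, h) \<in> rat_reps CP"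
  shows "(V \<inter> proj_map -` W, h \<circ> proj_map) \<in> rat_reps M"
  using assms open_preimage preimage_nonempty reg_pullback unfolding reps_iff CP.reps_iff zar_CP by blast

lemma pullback_cls:
  assumes r: "(W, h) \<in> rat_reps CP"
  shows "pullback_fun M V proj_map (CP.cls W h) = cls (V \<inter> proj_map -` W) (h \<circ> proj_map)"
  unfolding pullback_fun_def
proof (intro UN_eq_const)
  show "CP.cls W h \<noteq> {}" using r CP.mem_cls[OF r, of W h] by auto
  fix z assume "z \<in> CP.cls W h"
  moreover obtain W' h' where z: "z = (W', h')" by fastforce
  ultimately have z': "(W', h') \<in> rat_reps CP" "\<And>x. x \<in> W \<inter> W' \<Longrightarrow> h x = h' x"
    using CP.mem_cls[OF r, of W' h'] by auto
  show "(case z of (W, h) \<Rightarrow> cls (V \<inter> proj_map -` W) (h \<circ> proj_map)) = cls (V \<inter> proj_map -` W) (h \<circ> proj_map)"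
    unfolding z prod.case by (rule cls_eqI[OF pullback_rep[OF z'(1)] pullback_rep[OF r]]) (use z'(2) in auto)
qed

text \<open>The part of the action along u contributes \<open>\<mu>\<close> times the Euler
  derivative, that is d F; what remains is the linear field - A.\<close>

lemma dv_poly:
  assumes T: "openin (zar M) T" "T \<subseteq> V" and p: "p \<in> T"
    and F: "F \<in> homogeneous_polys d" "is_grad F F'"
  shows "dv p A (cls T (\<lambda>q. F (u q))) = \<mu> A p * (of_nat d * F (u p)) + along F F' (- A) (u p)"
proof -
  have pV: "p \<in> V" and pU: "p \<in> U\<^sub>0" using p T V_sub by auto
  have urep: "(V, \<lambda>q. u q $ i) \<in> rat_reps M" for i using V_open V_ne u_reg by (simp add: reps_iff)
  have uT: "(\<lambda>q. u q $ i) \<in> reg M T" for i by (rule reg_restrict[OF V_open T u_reg])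
  have c: "cls T (\<lambda>q. u q $ i) = cls V (\<lambda>q. u q $ i)" for i
    by (rule cls_restrict[OF urep T(1) _ T(2)]) (use p in auto)
  have neg: "(- A *v x) $ i = - (A *v x) $ i" for x i by (simp add: matrix_vector_mult_def sum_negf)
  have "dv p A (cls T (\<lambda>q. F (u q))) = (\<Sum>i\<in>UNIV. F' i (u p) * dv p A (cls T (\<lambda>q. u q $ i)))"
    unfolding dv_def by (rule vf_grad[OF vf regular_at_\<delta>[OF pU] F(2) T(1) p uT])
  also have "\<dots> = (\<Sum>i\<in>UNIV. \<mu> A p * (F' i (u p) * u p $ i) + F' i (u p) * (- A *v u p) $ i)"
    by (intro sum.cong refl) (simp add: c du[OF pV] neg algebra_simps)
  also have "\<dots> = \<mu> A p * (\<Sum>i\<in>UNIV. F' i (u p) * u p $ i) + along F F' (- A) (u p)"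
    by (simp add: sum.distrib sum_distrib_left along_def)
  finally show ?thesis by (simp add: euler_homogeneous[OF F])
qed

lemma dv_product:
  assumes "p \<in> U\<^sub>0" "\<xi> \<in> local_ring M p" "\<eta> \<in> local_ring M p"
  shows "dv p A (\<xi> \<otimes>\<^bsub>K\<^esub> \<eta>) = rat_value p \<xi> * dv p A \<eta> + rat_value p \<eta> * dv p A \<xi>"
  using assms by (simp add: dv_def vf_mult[OF vf] local_ring_carrier value_add value_mult reg_\<delta> local_ring_mult)

text \<open>Numerator and denominator have the same degree, so the \<open>\<mu>\<close> terms cancel
  in the quotient rule: only the line of u matters.\<close>

lemma dv_fraction:
  assumes T: "openin (zar M) T" "T \<subseteq> V" and p: "p \<in> T" and h: "(T, h) \<in> rat_reps M"
    and F: "F \<in> homogeneous_polys d" "is_grad F F'" and G: "G \<in> homogeneous_polys d" "is_grad G G'"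
    and FG: "\<And>q. q \<in> T \<Longrightarrow> G (u q) \<noteq> 0 \<and> h q = F (u q) / G (u q)"
  shows "dv p A (cls T h) =
    (along F F' (- A) (u p) * G (u p) - F (u p) * along G G' (- A) (u p)) / (G (u p) * G (u p))"
proof -
  have pU: "p \<in> U\<^sub>0" using p T V_sub by auto
  have Gr: "(T, \<lambda>q. G (u q)) \<in> rat_reps M" and Fr: "(T, \<lambda>q. F (u q)) \<in> rat_reps M"
    using reg_restrict[OF V_open T reg_poly_u] F G T p by (auto simp: reps_iff)
  have e: "cls T h \<otimes>\<^bsub>K\<^esub> cls T (\<lambda>q. G (u q)) = cls T (\<lambda>q. F (u q))"
    unfolding K_mult[OF h Gr] by (rule cls_eqI[OF reps_mult[OF h Gr] Fr]) (use FG in auto)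
  have "dv p A (cls T (\<lambda>q. F (u q))) = h p * dv p A (cls T (\<lambda>q. G (u q))) + G (u p) * dv p A (cls T h)"
    using dv_product[OF pU local_ring_cls[OF h p] local_ring_cls[OF Gr p], of A]
    by (simp add: e value_cls[OF h p] value_cls[OF Gr p])
  then have "G (u p) * dv p A (cls T h) = along F F' (- A) (u p) - F (u p) / G (u p) * along G G' (- A) (u p)"
    using FG[OF p] by (simp add: dv_poly[OF T p F] dv_poly[OF T p G] field_simps)
  then have "dv p A (cls T h) = (along F F' (- A) (u p) - F (u p) / G (u p) * along G G' (- A) (u p)) / G (u p)"
    using FG[OF p] by (simp add: field_simps)
  then show ?thesis using FG[OF p] by (simp add: field_simps)
qed

text \<open>The minus sign compensates that in \<open>du\<close>: the action of - C moves u by C u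
  up to a multiple of u, exactly as a group with generator C does.\<close>

lemma pullback_intertwines:
  assumes \<gamma>: "one_parameter_subgroup \<gamma>"
    and Y: "\<And>W h. (W, h) \<in> rat_reps CP \<Longrightarrow> Y (CP.cls W h) = CP.cls W (one_parameter.flow_deriv \<gamma> h)"
    and \<xi>: "\<xi> \<in> carrier CP.K"
  shows "\<delta> (- one_parameter.generator \<gamma>) (pullback_fun M V proj_map \<xi>) = pullback_fun M V proj_map (Y \<xi>)"
proof -
  interpret \<gamma>: one_parameter \<gamma> by unfold_locales (rule \<gamma>)
  obtain W h where h: "(W, h) \<in> rat_reps CP" "\<xi> = CP.cls W h" using \<xi> by (rule CP.K_cases)
  have W: "openin proj_zariski W" "h \<in> reg CP W" using h(1) by (auto simp: CP.reps_iff zar_CP)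
  have h': "(W, \<gamma>.flow_deriv h) \<in> rat_reps CP" using h(1) \<gamma>.reg_flow(1) by (auto simp: CP.reps_iff zar_CP)
  let ?T = "V \<inter> proj_map -` W"
  note r = pullback_rep[OF h(1)] and r' = pullback_rep[OF h']
  have T: "openin (zar M) ?T" "?T \<noteq> {}" using r by (auto simp: reps_iff)
  show ?thesis
    unfolding h(2) Y[OF h(1)] pullback_cls[OF h(1)] pullback_cls[OF h']
  proof (rule K_eqI[OF T])
    fix p assume p: "p \<in> ?T"
    then have pV: "p \<in> V" and pU: "p \<in> U\<^sub>0" using V_sub by auto
    show "\<delta> (- \<gamma>.generator) (cls ?T (h \<circ> proj_map)) \<in> local_ring M p"
      by (rule reg_\<delta>[OF pU local_ring_cls[OF r p]])
    show "cls ?T (\<gamma>.flow_deriv h \<circ> proj_map) \<in> local_ring M p" by (rule local_ring_cls[OF r' p])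
    have pW: "proj_map p \<in> W" using p by simp
    obtain V' d F G where V': "proj_map p \<in> V'" "V' \<subseteq> W" "openin proj_zariski V'" and
       FG: "F \<in> homogeneous_polys d" "G \<in> homogeneous_polys d"
       "\<And>L v. L \<in> V' \<Longrightarrow> v \<in> L - {0} \<Longrightarrow> G v \<noteq> 0 \<and> h L = F v / G v"
      by (rule reg_CP_fraction[OF W(2) pW]) blast
    have "F \<in> vec_polys" "G \<in> vec_polys" using FG by (auto simp: homogeneous_polys_def)
    then obtain F' G' where F': "is_grad F F'" and G': "is_grad G G'" using grad_exists by blast
    let ?S = "V \<inter> proj_map -` V'"
    have S: "openin (zar M) ?S" "?S \<subseteq> V" "p \<in> ?S" "?S \<subseteq> ?T" "?S \<noteq> {}"
      using open_preimage[OF V'(3)] pV V' by auto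
    have hS: "(?S, h \<circ> proj_map) \<in> rat_reps M" by (rule reps_restrict[OF r S(1) S(5) S(4)])
    have "rat_value p (\<delta> (- \<gamma>.generator) (cls ?T (h \<circ> proj_map))) = dv p (- \<gamma>.generator) (cls ?S (h \<circ> proj_map))"
      by (simp only: cls_restrict[OF r S(1) S(5) S(4)] dv_def)
    also have "\<dots> = (along F F' (- (- \<gamma>.generator)) (u p) * G (u p) - F (u p) * along G G' (- (- \<gamma>.generator)) (u p)) / (G (u p) * G (u p))"
    proof (rule dv_fraction[OF S(1,2,3) hS FG(1) F' FG(2) G'])
      show "G (u q) \<noteq> 0 \<and> (h \<circ> proj_map) q = F (u q) / G (u q)" if "q \<in> ?S" for q
        using that FG(3)[of "proj_map q" "u q"] u_in_proj_map u_ne by auto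
    qed
    also have "\<dots> = \<gamma>.flow_deriv h (proj_map p)"
      unfolding \<gamma>.flow_deriv_def minus_minus
      by (rule DERIV_imp_deriv[symmetric], rule \<gamma>.flow_deriv_fraction[OF V'(3) V'(1) u_in_proj_map u_ne[OF pV] FG(3) F' G'])
    also have "\<dots> = rat_value p (cls ?T (\<gamma>.flow_deriv h \<circ> proj_map))" by (simp add: value_cls[OF r' p])
    finally show "rat_value p (\<delta> (- \<gamma>.generator) (cls ?T (h \<circ> proj_map))) = rat_value p (cls ?T (\<gamma>.flow_deriv h \<circ> proj_map))" .
  qed
qed

text \<open>A derivation agreeing with \<open>\<delta> A\<close> on the functions pulled back from projective space is at a
  generic point the value of some \<open>\<delta> B\<close>; then \<open>B - A\<close> fixes the line \<open>proj_map p\<close>, hence acts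
  as zero at \<open>p\<close>.\<close>

lemma extension_unique:
  assumes X: "X \<in> rat_vector_fields M"
    and W: "openin (zar M) W" "W \<noteq> {}" "W \<subseteq> V"
    and reg: "\<And>p. p \<in> W \<Longrightarrow> regular_at M p X"
    and tangent: "\<And>p. p \<in> W \<Longrightarrow> \<exists>B. \<forall>\<xi>\<in>local_ring M p. rat_value p (X \<xi>) = dv p B \<xi>"
    and agree: "\<And>\<xi>. \<xi> \<in> carrier CP.K \<Longrightarrow>
      X (pullback_fun M V proj_map \<xi>) = \<delta> A (pullback_fun M V proj_map \<xi>)"
  shows "X = \<delta> A"
proof (rule vf_eqI[OF X vf W(1,2)])
  fix p \<xi> assume p: "p \<in> W" and \<xi>: "\<xi> \<in> local_ring M p"
  have pV: "p \<in> V" and pU: "p \<in> U\<^sub>0" using p W V_sub by auto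
  obtain B where B: "\<And>\<xi>. \<xi> \<in> local_ring M p \<Longrightarrow> rat_value p (X \<xi>) = dv p B \<xi>" using tangent[OF p] by blast
  have diff: "dv p (B - A) \<eta> = dv p B \<eta> - dv p A \<eta>" if "\<eta> \<in> local_ring M p" for \<eta>
    by (simp add: dv_trace[OF pU that] matrix_diff_rdistrib trace_sub)
  have ur: "(V, \<lambda>q. u q $ i) \<in> rat_reps M" for i using V_open V_ne u_reg by (simp add: reps_iff)
  have eig: "((B - A) *v u p) $ i = (((B - A) *v u p) $ i\<^sub>0 / u p $ i\<^sub>0) * u p $ i" for i
  proof -
    \<comment> \<open>The affine coordinate with numerator i and denominator
      \<open>i\<^sub>0\<close>; any nonzero vector of the line gives the same quotient. It pulls
      back to the ratio of the corresponding entries of u.\<close>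
    define h where "h L = (SOME v. v \<in> L \<and> v \<noteq> 0) $ i / (SOME v. v \<in> L \<and> v \<noteq> 0) $ i\<^sub>0" for L :: "(complex ^ 'm) set"
    let ?W = "proj_basic (\<lambda>v :: complex ^ 'm. v $ i\<^sub>0)"
    have co: "(\<lambda>v. v $ j) \<in> homogeneous_polys 1" for j :: 'm
      unfolding homogeneous_polys_def by (auto intro!: poly_funs.gen)
    have oW: "openin proj_zariski ?W" by (rule open_proj_basic[OF co])
    have hv: "v $ i\<^sub>0 \<noteq> 0 \<and> h L = v $ i / v $ i\<^sub>0" if L: "L \<in> ?W" and v: "v \<in> L - {0}" for L v
    proof -
      have Lp: "L \<in> proj_points" using L by (simp add: proj_basic_def)
      have nz: "v $ i\<^sub>0 \<noteq> 0" using proj_basic_iff[OF co Lp, of v i\<^sub>0] v L by auto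
      have "\<exists>v. v \<in> L \<and> v \<noteq> 0" using v by blast
      from someI_ex[OF this] have w: "(SOME v. v \<in> L \<and> v \<noteq> 0) \<in> L" "(SOME v. v \<in> L \<and> v \<noteq> 0) \<noteq> 0" by auto
      then obtain c where c: "(SOME v. v \<in> L \<and> v \<noteq> 0) = c *s v" using proj_point_scale[OF Lp _ _ w(1), of v] v by auto
      then have "c \<noteq> 0" using w by auto
      then show ?thesis using nz by (simp add: h_def c)
    qed
    have sub: "V \<inter> proj_map -` ?W = V" using proj_map_basic[OF co] u_nz by auto
    have "proj_fraction ?W h" using hv by (intro proj_fractionI[OF oW co[of i] co[of i\<^sub>0]]) auto
    then have "h \<in> reg CP ?W" unfolding reg_CP by blast
    moreover have "?W \<noteq> {}" using sub V_ne by auto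
    ultimately have hr: "(?W, h) \<in> rat_reps CP" using oW by (simp add: CP.reps_iff zar_CP)
    have pr: "(V, h \<circ> proj_map) \<in> rat_reps M" and pc: "pullback_fun M V proj_map (CP.cls ?W h) = cls V (h \<circ> proj_map)"
      using pullback_rep[OF hr] pullback_cls[OF hr] unfolding sub by auto
    have hq: "h (proj_map q) = u q $ i / u q $ i\<^sub>0" if "q \<in> V" for q
      using hv[of "proj_map q" "u q"] that sub u_in_proj_map u_ne by blast
    note L = local_ring_cls[OF pr pV]
    have "X (cls V (h \<circ> proj_map)) = \<delta> A (cls V (h \<circ> proj_map))"
      using agree[OF CP.cls_in_K[OF hr]] unfolding pc .
    then have z: "dv p (B - A) (cls V (h \<circ> proj_map)) = 0"
      using diff[OF L] B[OF L] by (simp add: dv_def)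
    \<comment> \<open>B - A kills the ratio of entries at p; differentiating entry i = ratio * entry
      \<open>i\<^sub>0\<close> and cancelling the \<open>\<mu>\<close> terms leaves the eigenvector
      equation.\<close>
    have "cls V (h \<circ> proj_map) \<otimes>\<^bsub>K\<^esub> cls V (\<lambda>q. u q $ i\<^sub>0) = cls V (\<lambda>q. u q $ i)"
      unfolding K_mult[OF pr ur] by (rule cls_eqI[OF reps_mult[OF pr ur] ur]) (use hq u_nz in auto)
    then have "dv p (B - A) (cls V (\<lambda>q. u q $ i)) = h (proj_map p) * dv p (B - A) (cls V (\<lambda>q. u q $ i\<^sub>0))"
      using dv_product[OF pU L local_ring_cls[OF ur pV], of "B - A" i\<^sub>0] z
      by (simp add: value_cls[OF pr pV])
    then show ?thesis using u_nz[OF pV] by (simp add: du[OF pV] hq[OF pV] field_simps)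
  qed
  have "(B - A) *v u p = (((B - A) *v u p) $ i\<^sub>0 / u p $ i\<^sub>0) *s u p"
    unfolding vec_eq_iff vector_smult_component using eig by blast
  then have "dv p (B - A) \<xi> = 0" by (rule dv_eigen[OF pV \<xi>])
  then have "rat_value p (X \<xi>) = rat_value p (\<delta> A \<xi>)" using diff[OF \<xi>] B[OF \<xi>] by (simp add: dv_def)
  then show "X \<xi> \<in> local_ring M p \<and> \<delta> A \<xi> \<in> local_ring M p \<and> rat_value p (X \<xi>) = rat_value p (\<delta> A \<xi>)"
    using reg[OF p] \<xi> reg_\<delta>[OF pU \<xi>] by (auto simp: regular_at_def)
qed

text \<open>The definite description in \<open>pullback_field\<close> needs existence, from
  \<open>pullback_intertwines\<close>, and uniqueness, from \<open>extension_unique\<close>; the two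
  assumptions about arbitrary fields X serve the latter.\<close>

lemma conjugates_range:
  assumes generic: "\<And>X. X \<in> rat_vector_fields M \<Longrightarrow>
      \<exists>W. openin (zar M) W \<and> W \<noteq> {} \<and> (\<forall>p\<in>W. regular_at M p X)"
    and tangent: "\<And>X p. X \<in> rat_vector_fields M \<Longrightarrow> p \<in> U\<^sub>0 \<Longrightarrow> regular_at M p X \<Longrightarrow>
      \<exists>B. \<forall>\<xi>\<in>local_ring M p. rat_value p (X \<xi>) = rat_value p (\<delta> B \<xi>)"
  shows "conjugates M (range \<delta>) CP projective_vector_fields V proj_map"
proof -
  have pf: "pullback_field M CP V proj_map Y = \<delta> (- one_parameter.generator \<gamma>)"
    if \<gamma>: "one_parameter_subgroup \<gamma>" and Y: "\<And>W h. (W, h) \<in> rat_reps CP \<Longrightarrow> Y (CP.cls W h) = CP.cls W (one_parameter.flow_deriv \<gamma> h)"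
    for \<gamma> Y
    unfolding pullback_field_def
  proof (rule the_equality)
    have int: "\<delta> (- one_parameter.generator \<gamma>) (pullback_fun M V proj_map \<xi>) = pullback_fun M V proj_map (Y \<xi>)"
      if "\<xi> \<in> carrier CP.K" for \<xi>
      by (rule pullback_intertwines[OF \<gamma> _ that]) (rule Y)
    show "\<delta> (- one_parameter.generator \<gamma>) \<in> rat_vector_fields M \<and> (\<forall>\<xi>\<in>carrier CP.K.
        \<delta> (- one_parameter.generator \<gamma>) (pullback_fun M V proj_map \<xi>) = pullback_fun M V proj_map (Y \<xi>))"
      using vf int by blast
    fix X assume X: "X \<in> rat_vector_fields M \<and> (\<forall>\<xi>\<in>carrier CP.K. X (pullback_fun M V proj_map \<xi>) = pullback_fun M V proj_map (Y \<xi>))"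
    obtain W where W: "openin (zar M) W" "W \<noteq> {}" "\<And>p. p \<in> W \<Longrightarrow> regular_at M p X"
      using generic[OF conjunct1[OF X]] by (elim exE conjE) blast
    show "X = \<delta> (- one_parameter.generator \<gamma>)"
    proof (rule extension_unique[where W = "W \<inter> V"])
      show "openin (zar M) (W \<inter> V)" "W \<inter> V \<noteq> {}" using W V_open V_ne irreducible by auto
      show "\<exists>B. \<forall>\<xi>\<in>local_ring M p. rat_value p (X \<xi>) = dv p B \<xi>" if "p \<in> W \<inter> V" for p
        using tangent[OF conjunct1[OF X], of p] W(3)[of p] that V_sub by (auto simp: dv_def)
      show "X (pullback_fun M V proj_map \<xi>) = \<delta> (- one_parameter.generator \<gamma>) (pullback_fun M V proj_map \<xi>)"
        if "\<xi> \<in> carrier CP.K" for \<xi>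
        using X int[OF that] that by simp
    qed (use X W in auto)
  qed
  have "pullback_field M CP V proj_map ` projective_vector_fields = range \<delta>"
  proof
    show "pullback_field M CP V proj_map ` projective_vector_fields \<subseteq> range \<delta>"
    proof
      fix X assume "X \<in> pullback_field M CP V proj_map ` projective_vector_fields"
      then obtain Y where Y: "Y \<in> projective_vector_fields" "X = pullback_field M CP V proj_map Y" by blast
      then obtain \<gamma> where \<gamma>: "one_parameter_subgroup \<gamma>" "\<forall>(U, h) \<in> rat_reps CP. Y (rat_class CP U h) =
        rat_class CP U (\<lambda>L. deriv (\<lambda>t. h ((*v) (\<gamma> t) ` L)) 0)" unfolding projective_vector_fields_def by blast
      interpret \<gamma>: one_parameter \<gamma> by unfold_locales (rule \<gamma>)
      have "X = \<delta> (- \<gamma>.generator)" unfolding Y(2)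
        by (rule pf[OF \<gamma>(1)]) (use \<gamma>(2) in \<open>auto simp: \<gamma>.flow_deriv_def[abs_def]\<close>)
      then show "X \<in> range \<delta>" by blast
    qed
    show "range \<delta> \<subseteq> pullback_field M CP V proj_map ` projective_vector_fields"
    proof
      fix X assume "X \<in> range \<delta>"
      then obtain A where A: "X = \<delta> A" by blast
      \<comment> \<open>The group of - A has generator - A, and the pull-back changes the sign once
        more.\<close>
      interpret \<gamma>: one_parameter "matrix_exp (- A)" by unfold_locales (rule one_parameter_matrix_exp)
      have "deriv (\<lambda>t. matrix_exp (- A) t $ i $ j) 0 = (- A) $ i $ j" for i j
        using DERIV_imp_deriv[OF matrix_exp_derivative[of "- A" i j 0]] by (simp add: matrix_exp_0)
      then have g: "\<gamma>.generator = - A" by (simp add: \<gamma>.generator_def vec_eq_iff)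
      obtain Y where Y: "Y \<in> projective_vector_fields"
        "\<And>W h. (W, h) \<in> rat_reps CP \<Longrightarrow> Y (rat_class CP W h) = rat_class CP W (\<gamma>.flow_deriv h)"
        using \<gamma>.projective_field_exists[OF rat_space_CP] by blast
      have "pullback_field M CP V proj_map Y = X"
        using pf[OF one_parameter_matrix_exp Y(2)] by (simp add: g A)
      then show "X \<in> pullback_field M CP V proj_map ` projective_vector_fields" using Y(1) by blast
    qed
  qed
  then show ?thesis using dominant by (simp add: conjugates_def)
qed

end

section \<open>Infinitesimally homogeneous varieties of type \<open>\<ss>\<ll>\<close>\<close>

lemma (in column_action) column_conjugates:
  assumes generic: "\<And>X. X \<in> rat_vector_fields M \<Longrightarrow>
      \<exists>W. openin (zar M) W \<and> W \<noteq> {} \<and> (\<forall>p\<in>W. regular_at M p X)"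
    and tangent: "\<And>X p. X \<in> rat_vector_fields M \<Longrightarrow> p \<in> U\<^sub>0 \<Longrightarrow> regular_at M p X \<Longrightarrow>
      \<exists>B. \<forall>\<xi>\<in>local_ring M p. rat_value p (X \<xi>) = rat_value p (\<delta> B \<xi>)"
  shows "\<exists>U \<phi>. conjugates M (range \<delta>) (CP :: (complex ^ 'm) set fspace) projective_vector_fields U \<phi>"
proof -
  obtain V u i\<^sub>0 \<mu> where "frame V u i\<^sub>0 \<mu>" using frame_exists by blast
  then interpret framed_action M \<delta> U\<^sub>0 V u i\<^sub>0 \<mu> by unfold_locales
  show ?thesis using conjugates_range[OF generic tangent] by blast
qed

lemma (in sl_action) conjugates_exists:
  assumes generic: "\<And>X. X \<in> rat_vector_fields M \<Longrightarrow>
      \<exists>W. openin (zar M) W \<and> W \<noteq> {} \<and> (\<forall>p\<in>W. regular_at M p X)"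
    and tangent: "\<And>X p. X \<in> rat_vector_fields M \<Longrightarrow> p \<in> U\<^sub>0 \<Longrightarrow> regular_at M p X \<Longrightarrow>
      \<exists>B. \<forall>\<xi>\<in>local_ring M p. rat_value p (X \<xi>) = rat_value p (\<delta> B \<xi>)"
  shows "\<exists>U \<phi>. conjugates M (range \<delta>) (CP :: (complex ^ 'm) set fspace) projective_vector_fields U \<phi>"
proof -
  have inv: "- transpose (- transpose A) = A" for A :: "complex ^ 'm ^ 'm"
    by (simp add: transpose_simps)
  show ?thesis
  proof (rule column_action_cases)
    assume "column_action M \<delta> U\<^sub>0"
    then show ?thesis using generic tangent by (rule column_action.column_conjugates)
  next
    assume c: "column_action M (\<lambda>A. \<delta> (- transpose A)) U\<^sub>0"
    have "range (\<lambda>A. \<delta> (- transpose A)) = range \<delta>"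
    proof
      show "range \<delta> \<subseteq> range (\<lambda>A. \<delta> (- transpose A))"
      proof
        fix X assume "X \<in> range \<delta>"
        then obtain A where "X = \<delta> A" by blast
        then have "X = (\<lambda>A. \<delta> (- transpose A)) (- transpose A)" by (simp add: inv)
        then show "X \<in> range (\<lambda>A. \<delta> (- transpose A))" by blast
      qed
    qed blast
    moreover have "\<exists>B. \<forall>\<xi>\<in>local_ring M p. rat_value p (X \<xi>) = rat_value p (\<delta> (- transpose B) \<xi>)"
      if X: "X \<in> rat_vector_fields M" "p \<in> U\<^sub>0" "regular_at M p X" for X p
    proof -
      obtain B where "\<forall>\<xi>\<in>local_ring M p. rat_value p (X \<xi>) = rat_value p (\<delta> B \<xi>)"
        using tangent[OF X] by blast
      then show ?thesis by (intro exI[of _ "- transpose B"]) (simp only: inv)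
    qed
    ultimately show ?thesis using column_action.column_conjugates[OF c generic] by simp
  qed
qed

section \<open>Vector fields and their values at a point\<close>

context rat_space
begin

lemma vector_at_tangent:
  assumes X: "X \<in> rat_vector_fields M" and p: "p \<in> points M" and reg: "regular_at M p X"
  shows "vector_at M p X \<in> tangent_space M p"
proof -
  have XL: "X \<xi> \<in> local_ring M p" if "\<xi> \<in> local_ring M p" for \<xi> using reg that by (auto simp: regular_at_def)
  show ?thesis unfolding tangent_space_def vector_at_def
    by (simp add: vf_const[OF X] value_const[OF p] local_ring_const[OF p] vf_add[OF X] vf_mult[OF X] XL
        local_ring_carrier local_ring_add local_ring_mult value_add value_mult)
qed

lemma vector_at_lie_add: "regular_at M p D \<Longrightarrow> regular_at M p E \<Longrightarrow>
    vector_at M p (lie_add (vector_field_lie M) D E) = vector_at M p D + vector_at M p E"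
  by (auto simp: vector_at_def vector_field_lie_def Let_def regular_at_def local_ring_carrier value_add image_subset_iff)

lemma vector_at_lie_scale: "p \<in> points M \<Longrightarrow> regular_at M p D \<Longrightarrow>
    vector_at M p (lie_scale (vector_field_lie M) c D) = fun_scale c (vector_at M p D)"
  by (auto simp: vector_at_def vector_field_lie_def Let_def regular_at_def local_ring_carrier value_mult
      fun_scale_def local_ring_const value_const image_subset_iff)

lemma vector_at_lie_zero: "p \<in> points M \<Longrightarrow> vector_at M p (lie_zero (vector_field_lie M)) = 0"
  by (auto simp: vector_at_def vector_field_lie_def Let_def local_ring_carrier K_zero value_const)

lemma vector_at_bracket: "regular_at M p D \<Longrightarrow> regular_at M p E \<Longrightarrow> \<xi> \<in> local_ring M p \<Longrightarrow>
    rat_value p (lie_bracket (vector_field_lie M) D E \<xi>) = rat_value p (D (E \<xi>)) - rat_value p (E (D \<xi>))"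
  by (auto simp: vector_field_lie_def Let_def regular_at_def local_ring_carrier value_minus image_subset_iff)

end

text \<open>The dimension condition is the off-by-one N = n + 1; it turns the spanning hypothesis
  into rank less than N.\<close>

locale homogeneous_sl = rat_space M for M :: "'p fspace" +
  fixes \<ss> :: "('p ratfun \<Rightarrow> 'p ratfun) set" and \<rho> :: "('p ratfun \<Rightarrow> 'p ratfun) \<Rightarrow> complex ^ 'm ^ 'm" and U\<^sub>0
  assumes subspace: "linear_subspace (vector_field_lie M) \<ss>" and findim: "fin_dim (vector_field_lie M) \<ss>"
    and bracket_closed: "D \<in> \<ss> \<Longrightarrow> E \<in> \<ss> \<Longrightarrow> lie_bracket (vector_field_lie M) D E \<in> \<ss>"
    and bij: "bij_betw \<rho> \<ss> {A. trace A = 0}"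
    and \<rho>_add: "D \<in> \<ss> \<Longrightarrow> E \<in> \<ss> \<Longrightarrow> \<rho> (lie_add (vector_field_lie M) D E) = \<rho> D + \<rho> E"
    and \<rho>_scale: "D \<in> \<ss> \<Longrightarrow> \<rho> (lie_scale (vector_field_lie M) c D) = matrix_scale c (\<rho> D)"
    and \<rho>_bracket: "D \<in> \<ss> \<Longrightarrow> E \<in> \<ss> \<Longrightarrow>
       \<rho> (lie_bracket (vector_field_lie M) D E) = \<rho> D ** \<rho> E - \<rho> E ** \<rho> D"
    and open_U\<^sub>0: "openin (zar M) U\<^sub>0" and U\<^sub>0_ne: "U\<^sub>0 \<noteq> {}"
    and regular: "p \<in> U\<^sub>0 \<Longrightarrow> D \<in> \<ss> \<Longrightarrow> regular_at M p D"
    and spans: "p \<in> U\<^sub>0 \<Longrightarrow> module.span fun_scale (vector_at M p ` \<ss>) = tangent_space M p"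
    and dim: "p \<in> U\<^sub>0 \<Longrightarrow> Suc (vector_space.dim fun_scale (tangent_space M p)) = CARD('m)"
begin

interpretation fs: vector_space fun_scale by (rule vector_space_fun_scale)

definition \<sigma> :: "complex ^ 'm ^ 'm \<Rightarrow> 'p ratfun \<Rightarrow> 'p ratfun" where "\<sigma> = inv_into \<ss> \<rho>"

text \<open>Projection along the scalar matrices; it extends the inverse of the isomorphism from
  traceless to all matrices, with scalars acting as zero.\<close>

definition traceless :: "complex ^ 'm ^ 'm \<Rightarrow> complex ^ 'm ^ 'm" where
  "traceless A = A - matrix_scale (trace A / of_nat CARD('m)) (mat 1)"

definition \<delta> :: "complex ^ 'm ^ 'm \<Rightarrow> 'p ratfun \<Rightarrow> 'p ratfun" where "\<delta> A = \<sigma> (traceless A)"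

lemma \<ss>_vf: "D \<in> \<ss> \<Longrightarrow> D \<in> rat_vector_fields M"
  using subspace by (auto simp: linear_subspace_def vector_field_lie_def Let_def)

lemma closed:
  "D \<in> \<ss> \<Longrightarrow> E \<in> \<ss> \<Longrightarrow> lie_add (vector_field_lie M) D E \<in> \<ss>"
  "D \<in> \<ss> \<Longrightarrow> lie_scale (vector_field_lie M) c D \<in> \<ss>"
  "lie_zero (vector_field_lie M) \<in> \<ss>"
  using subspace by (auto simp: linear_subspace_def)

lemma \<sigma>_\<rho>: "D \<in> \<ss> \<Longrightarrow> \<sigma> (\<rho> D) = D"
  using bij by (simp add: \<sigma>_def bij_betw_def)

lemma \<sigma>_in: "trace A = 0 \<Longrightarrow> \<sigma> A \<in> \<ss>" and \<rho>_\<sigma>: "trace A = 0 \<Longrightarrow> \<rho> (\<sigma> A) = A"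
  using bij by (auto simp: \<sigma>_def bij_betw_def inv_into_into f_inv_into_f)

lemma trace_\<rho>: "D \<in> \<ss> \<Longrightarrow> trace (\<rho> D) = 0"
  using bij by (auto simp: bij_betw_def)

lemma trace_scale: "trace (matrix_scale c A) = c * trace A"
  by (simp add: trace_def sum_distrib_left)

lemma trace_one: "trace (mat 1 :: complex ^ 'm ^ 'm) = of_nat CARD('m)"
  by (simp add: trace_def mat_def)

lemma trace_traceless: "trace (traceless A) = 0"
  by (simp add: traceless_def trace_sub trace_scale trace_one)

lemma traceless_id: "trace A = 0 \<Longrightarrow> traceless A = A"
  by (simp add: traceless_def vec_eq_iff)

lemma \<delta>_in: "\<delta> A \<in> \<ss>"
  by (simp add: \<delta>_def \<sigma>_in trace_traceless)

lemma range_\<delta>: "range \<delta> = \<ss>"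
proof
  show "\<ss> \<subseteq> range \<delta>"
  proof
    fix D assume D: "D \<in> \<ss>"
    then have "D = \<delta> (\<rho> D)" by (simp add: \<delta>_def traceless_id trace_\<rho> \<sigma>_\<rho>)
    then show "D \<in> range \<delta>" by blast
  qed
qed (use \<delta>_in in blast)

lemma \<sigma>_add: "trace A = 0 \<Longrightarrow> trace B = 0 \<Longrightarrow> \<sigma> (A + B) = lie_add (vector_field_lie M) (\<sigma> A) (\<sigma> B)"
  using \<sigma>_\<rho>[OF closed(1)[OF \<sigma>_in \<sigma>_in], of A B] by (simp add: \<rho>_add \<sigma>_in \<rho>_\<sigma>)

lemma \<sigma>_scale: "trace A = 0 \<Longrightarrow> \<sigma> (matrix_scale c A) = lie_scale (vector_field_lie M) c (\<sigma> A)"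
  using \<sigma>_\<rho>[OF closed(2)[OF \<sigma>_in], of A c] by (simp add: \<rho>_scale \<sigma>_in \<rho>_\<sigma>)

lemma \<sigma>_bracket: "trace A = 0 \<Longrightarrow> trace B = 0 \<Longrightarrow>
    \<sigma> (A ** B - B ** A) = lie_bracket (vector_field_lie M) (\<sigma> A) (\<sigma> B)"
  using \<sigma>_\<rho>[OF bracket_closed[OF \<sigma>_in \<sigma>_in], of A B] by (simp add: \<rho>_bracket \<sigma>_in \<rho>_\<sigma>)

lemma \<delta>_add': "\<delta> (A + B) = lie_add (vector_field_lie M) (\<delta> A) (\<delta> B)"
proof -
  have "traceless (A + B) = traceless A + traceless B"
    by (simp add: traceless_def vec_eq_iff trace_add add_divide_distrib algebra_simps)
  then show ?thesis by (simp add: \<delta>_def \<sigma>_add trace_traceless)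
qed

lemma \<delta>_scale': "\<delta> (matrix_scale c A) = lie_scale (vector_field_lie M) c (\<delta> A)"
proof -
  have "traceless (matrix_scale c A) = matrix_scale c (traceless A)"
    by (simp add: traceless_def vec_eq_iff trace_scale algebra_simps)
  then show ?thesis by (simp add: \<delta>_def \<sigma>_scale trace_traceless)
qed

text \<open>Scalar matrices are central, so removing the trace parts does not change a
  commutator.\<close>

lemma \<delta>_bracket': "\<delta> (A ** B - B ** A) = lie_bracket (vector_field_lie M) (\<delta> A) (\<delta> B)"
proof -
  let ?t = "\<lambda>A :: complex ^ 'm ^ 'm. trace A / of_nat CARD('m)"
  have "trace (A ** B - B ** A) = 0" by (simp add: trace_sub trace_mul_sym[of A B])
  then have "traceless (A ** B - B ** A) = A ** B - B ** A" by (rule traceless_id)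
  also have "\<dots> = traceless A ** traceless B - traceless B ** traceless A"
  proof -
    have l: "matrix_scale c (mat 1) ** X = matrix_scale c X" and r: "X ** matrix_scale c (mat 1) = matrix_scale c X"
      for c and X :: "complex ^ 'm ^ 'm"
      by (simp_all add: vec_eq_iff matrix_matrix_mult_def mat_def if_distrib[of "\<lambda>a. _ * a"]
          if_distrib[of "\<lambda>a. a * _"] mult.commute cong: if_cong)
    have ld: "X ** (Y - Z) = X ** Y - X ** Z" for X Y Z :: "complex ^ 'm ^ 'm"
      by (simp add: vec_eq_iff matrix_matrix_mult_def right_diff_distrib sum_subtractf)
    have "traceless A ** traceless B = A ** B - matrix_scale (?t A) B - matrix_scale (?t B) A
        + matrix_scale (?t A * ?t B) (mat 1)" for A B
      by (simp only: traceless_def matrix_diff_rdistrib ld l r mat.scale_right_diff_distrib mat.scale_scale)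
        (simp only: mult.commute[of "?t B"] algebra_simps)
    note e = this[of A B] this[of B A]
    show ?thesis unfolding e mult.commute[of "?t B"] by simp
  qed
  finally show ?thesis by (simp add: \<delta>_def \<sigma>_bracket trace_traceless)
qed

text \<open>The identity and the zero matrix have the same traceless part; writing the result as a
  multiple by 0 makes its vanishing at points follow from
  \<open>vector_at_lie_scale\<close>.\<close>

lemma \<delta>_one': "\<delta> (mat 1) = lie_scale (vector_field_lie M) 0 (\<delta> 0)"
proof -
  have "traceless (mat 1) = traceless (matrix_scale 0 0)"
    using trace_scale[of 0 "0 :: complex ^ 'm ^ 'm"] by (simp add: traceless_def trace_one vec_eq_iff)
  then show ?thesis using \<delta>_scale'[of 0 0] by (simp add: \<delta>_def)
qed

lemma subspace_vectors:
  assumes p: "p \<in> U\<^sub>0"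
  shows "fs.subspace (vector_at M p ` \<ss>)"
proof -
  have pM: "p \<in> points M" using p open_sub_points[OF open_U\<^sub>0] by blast
  show ?thesis
    unfolding fs.subspace_def
  proof (intro conjI ballI allI)
    show "0 \<in> vector_at M p ` \<ss>" using vector_at_lie_zero[OF pM] closed(3) by (metis image_eqI)
    fix x y assume "x \<in> vector_at M p ` \<ss>" "y \<in> vector_at M p ` \<ss>"
    then show "x + y \<in> vector_at M p ` \<ss>"
      by clarify (metis vector_at_lie_add regular[OF p] closed(1) image_eqI)
  next
    fix x c assume "x \<in> vector_at M p ` \<ss>"
    then show "fun_scale c x \<in> vector_at M p ` \<ss>"
      by clarify (metis vector_at_lie_scale[OF pM] regular[OF p] closed(2) image_eqI)
  qed
qed

lemma tangent_eq: "p \<in> U\<^sub>0 \<Longrightarrow> tangent_space M p = vector_at M p ` \<ss>"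
  using spans subspace_vectors fs.span_eq_iff by metis

text \<open>\<open>fin_dim\<close> speaks of linear subspaces of fields containing a finite set. It
  is applied to the subspace of those fields whose value at p is a combination of the values of that
  set.\<close>

lemma finite_spanning:
  assumes p: "p \<in> U\<^sub>0"
  obtains B where "finite B" "vector_at M p ` \<ss> \<subseteq> fs.span B"
proof -
  have pM: "p \<in> points M" using p open_sub_points[OF open_U\<^sub>0] by blast
  from findim[unfolded fin_dim_def] obtain B where B: "finite B" "B \<subseteq> \<ss>"
    and B_min: "\<forall>W. linear_subspace (vector_field_lie M) W \<and> B \<subseteq> W \<longrightarrow> \<ss> \<subseteq> W"
    by (elim exE conjE)
  define W where "W = {D \<in> \<ss>. vector_at M p D \<in> fs.span (vector_at M p ` B)}"
  have "linear_subspace (vector_field_lie M) W"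
    unfolding linear_subspace_def
  proof (intro conjI ballI allI)
    show "W \<subseteq> lie_carrier (vector_field_lie M)" using subspace by (auto simp: W_def linear_subspace_def)
    show "lie_zero (vector_field_lie M) \<in> W"
      using closed(3) vector_at_lie_zero[OF pM] fs.span_zero by (simp add: W_def)
    show "lie_add (vector_field_lie M) x y \<in> W" if "x \<in> W" "y \<in> W" for x y
      using that closed(1) fs.span_add by (auto simp: W_def vector_at_lie_add regular[OF p])
    show "lie_scale (vector_field_lie M) c x \<in> W" if "x \<in> W" for c x
      using that closed(2) fs.span_scale by (auto simp: W_def vector_at_lie_scale[OF pM] regular[OF p])
  qed
  moreover have "B \<subseteq> W" using B(2) by (auto simp: W_def intro: fs.span_base)
  ultimately have "\<ss> \<subseteq> W" using B_min by simp
  then show ?thesis using B(1) by (intro that[of "vector_at M p ` B"]) (auto simp: W_def)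
qed

sublocale sl: sl_action M \<delta> U\<^sub>0
proof
  show "\<delta> A \<in> rat_vector_fields M" for A using \<delta>_in \<ss>_vf by blast
  show "openin (zar M) U\<^sub>0" "U\<^sub>0 \<noteq> {}" by (rule open_U\<^sub>0 U\<^sub>0_ne)+
  fix p assume p: "p \<in> U\<^sub>0"
  have pM: "p \<in> points M" using p open_sub_points[OF open_U\<^sub>0] by blast
  note reg = regular[OF p \<delta>_in]
  show "\<exists>F. finite F \<and> card F < CARD('m) \<and> (\<forall>A. vector_at M p (\<delta> A) \<in> fs.span F)"
  proof -
    obtain F where F: "F \<subseteq> vector_at M p ` \<ss>" "fs.independent F" "vector_at M p ` \<ss> \<subseteq> fs.span F"
      using fs.maximal_independent_subset by blast
    \<comment> \<open>Finiteness must be established separately: an infinite basis has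
      \<open>card\<close> 0, so \<open>dim\<close> alone would not bound the rank.\<close>
    obtain B where "finite B" "vector_at M p ` \<ss> \<subseteq> fs.span B" using finite_spanning[OF p] by blast
    then have "finite F" using fs.independent_span_bound[of B F] F by blast
    moreover have "fs.dim (tangent_space M p) = card F"
      using fs.basis_card_eq_dim[OF F(1,3,2)] by (simp add: tangent_eq[OF p])
    ultimately show ?thesis using dim[OF p] F(3) \<delta>_in by (intro exI[of _ F]) auto
  qed
  fix \<xi> assume \<xi>: "\<xi> \<in> local_ring M p"
  have va: "rat_value p (D \<xi>) = vector_at M p D \<xi>" for D using \<xi> by (simp add: vector_at_def)
  show "\<delta> A \<xi> \<in> local_ring M p" for A using reg \<xi> by (auto simp: regular_at_def)
  show "rat_value p (\<delta> (A + B) \<xi>) = rat_value p (\<delta> A \<xi>) + rat_value p (\<delta> B \<xi>)" for A B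
    unfolding va \<delta>_add' by (simp add: vector_at_lie_add reg)
  show "rat_value p (\<delta> (matrix_scale c A) \<xi>) = c * rat_value p (\<delta> A \<xi>)" for c A
    unfolding va \<delta>_scale' by (simp add: vector_at_lie_scale[OF pM] reg fun_scale_def)
  show "rat_value p (\<delta> (A ** B - B ** A) \<xi>) = rat_value p (\<delta> A (\<delta> B \<xi>)) - rat_value p (\<delta> B (\<delta> A \<xi>))" for A B
    unfolding \<delta>_bracket' by (rule vector_at_bracket[OF reg reg \<xi>])
  show "rat_value p (\<delta> (mat 1) \<xi>) = 0"
    unfolding va \<delta>_one' by (simp add: vector_at_lie_scale[OF pM] reg fun_scale_def)
next
  show "CARD('m) = 1 \<or> (\<exists>p\<in>U\<^sub>0. \<exists>\<xi>\<in>local_ring M p. \<exists>A. rat_value p (\<delta> A \<xi>) \<noteq> 0)"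
  proof (rule ccontr)
    \<comment> \<open>If every field of the action vanished at p, the tangent space would be zero,
      and the dimension condition would give N = 1.\<close>
    assume n: "\<not> ?thesis"
    have n0: "rat_value p (\<delta> A \<xi>) = 0" if "p \<in> U\<^sub>0" "\<xi> \<in> local_ring M p" for p \<xi> A
      using n that by blast
    obtain p where p: "p \<in> U\<^sub>0" using U\<^sub>0_ne by blast
    have "vector_at M p D = 0" if "D \<in> \<ss>" for D
    proof -
      have "D \<in> range \<delta>" using that by (simp only: range_\<delta>)
      then obtain A where "D = \<delta> A" by (rule rangeE)
      then have "vector_at M p D \<xi> = 0" for \<xi> using n0[OF p] by (simp add: vector_at_def)
      then show ?thesis by (simp add: fun_eq_iff)
    qed
    then have "tangent_space M p \<subseteq> fs.span {}" using tangent_eq[OF p] by auto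
    then have "fs.dim (tangent_space M p) \<le> card ({} :: ('p ratfun \<Rightarrow> complex) set)"
      by (rule fs.dim_le_card) simp
    then show False using dim[OF p] n by simp
  qed
qed

text \<open>The value at p of any regular field is a tangent vector, and the values of
  \<open>\<ss>\<close> already fill the tangent space.\<close>

lemma tangent_value:
  assumes "X \<in> rat_vector_fields M" "p \<in> U\<^sub>0" "regular_at M p X"
  shows "\<exists>B. \<forall>\<xi>\<in>local_ring M p. rat_value p (X \<xi>) = rat_value p (\<delta> B \<xi>)"
proof -
  have "p \<in> points M" using assms(2) open_sub_points[OF open_U\<^sub>0] by blast
  then have "vector_at M p X \<in> vector_at M p ` \<ss>"
    using vector_at_tangent[OF assms(1) _ assms(3)] tangent_eq[OF assms(2)] by blast
  then obtain D where D: "vector_at M p X = vector_at M p D" "D \<in> range \<delta>" unfolding range_\<delta> by (rule imageE)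
  from D(2) obtain B where "D = \<delta> B" by (rule rangeE)
  with D(1) have B: "vector_at M p X = vector_at M p (\<delta> B)" by simp
  have "rat_value p (X \<xi>) = rat_value p (\<delta> B \<xi>)" if "\<xi> \<in> local_ring M p" for \<xi>
    using fun_cong[OF B, of \<xi>] that by (simp add: vector_at_def)
  then show ?thesis by blast
qed

end

theorem mainTheorem2:
  fixes M :: "'p fspace"
    and \<ss> :: "('p ratfun \<Rightarrow> 'p ratfun) set"
    and n :: nat
  assumes "CARD('m::finite) = n + 1"
    and "infinitesimally_homogeneous M \<ss> (sl_lie :: (complex ^ 'm ^ 'm) lie_struct)"
    and "variety_dim M = enat n"
  shows "\<exists>U \<phi>. conjugates M \<ss>
    (CP :: (complex ^ 'm) set fspace) projective_vector_fields U \<phi>"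
proof -
  note hom = assms(2)[unfolded infinitesimally_homogeneous_def]
  have M: "irreducible_variety M" and smooth: "smooth M" using hom by auto
  interpret rat_space M by (rule rat_space_variety[OF M])
  have prevar: "prevariety M" using M by (simp add: irreducible_variety_def)
  obtain \<rho> where \<rho>: "bij_betw \<rho> \<ss> {A :: complex ^ 'm ^ 'm. trace A = 0}"
    "\<And>x y. x \<in> \<ss> \<Longrightarrow> y \<in> \<ss> \<Longrightarrow> \<rho> (lie_add (vector_field_lie M) x y) = \<rho> x + \<rho> y"
    "\<And>c x. x \<in> \<ss> \<Longrightarrow> \<rho> (lie_scale (vector_field_lie M) c x) = matrix_scale c (\<rho> x)"
    "\<And>x y. x \<in> \<ss> \<Longrightarrow> y \<in> \<ss> \<Longrightarrow> \<rho> (lie_bracket (vector_field_lie M) x y) = \<rho> x ** \<rho> y - \<rho> y ** \<rho> x"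
  proof -
    have "lie_isomorphic (vector_field_lie M \<lparr> lie_carrier := \<ss> \<rparr>) (sl_lie :: (complex ^ 'm ^ 'm) lie_struct)"
      using hom by blast
    then show ?thesis unfolding lie_isomorphic_def
      by (elim exE conjE) (rule that, auto simp: sl_lie_def matrix_scale_def)
  qed
  obtain U\<^sub>0 where U\<^sub>0: "openin (zar M) U\<^sub>0" "U\<^sub>0 \<noteq> {}" "\<And>p D. p \<in> U\<^sub>0 \<Longrightarrow> D \<in> \<ss> \<Longrightarrow> regular_at M p D"
    "\<And>p. p \<in> U\<^sub>0 \<Longrightarrow> module.span fun_scale (vector_at M p ` \<ss>) = tangent_space M p"
    using hom unfolding spans_tangent_generically_def by blast
  have "vector_space.dim fun_scale (tangent_space M p) = n" if "p \<in> U\<^sub>0" for p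
  proof -
    have "p \<in> points M" using that open_sub_points[OF U\<^sub>0(1)] by blast
    then have "enat (vector_space.dim fun_scale (tangent_space M p)) = enat n"
      using smooth assms(3) by (simp add: smooth_def)
    then show ?thesis by simp
  qed
  then interpret homogeneous_sl M \<ss> \<rho> U\<^sub>0
    using hom \<rho> U\<^sub>0 assms(1) by unfold_locales (auto simp: lie_subalgebra_def)
  \<comment> \<open>One chart, around any point, suffices: by irreducibility an open subset of it is
    generic in M.\<close>
  have "\<exists>W. openin (zar M) W \<and> W \<noteq> {} \<and> (\<forall>p\<in>W. regular_at M p X)" if X: "X \<in> rat_vector_fields M" for X
  proof -
    obtain x where "x \<in> points M" using points_nonempty by blast
    from prevariety_charts[OF prevar this] obtain U k Z \<phi> \<psi> where U: "x \<in> U" "chart M U k Z \<phi> \<psi>" .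
    then have "U \<noteq> {}" by blast
    from regular_generically[OF X U(2) this] show ?thesis by metis
  qed
  from sl.conjugates_exists[OF this tangent_value] show ?thesis unfolding range_\<delta> .
qed

end
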